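(* Let $n\ge1$ and let $\mu=(\mu_1\ge\dots\ge\mu_n\ge0)$ be a partition (a dominant weight of type $C_n$) with conjugate $\mu'$. Let $\overline{\mathcal F}(\mu)$, the filling map $f$, the map $\mathrm{ord}$ and $B_\mu$ be as in the context. Then the composite $\mathrm{ord}\circ f$ is a bijection from $\overline{\mathcal F}(\mu)$ onto $B_\mu$.
   Context: Let $[\overline{n}]=\{1<2<\dots<n<\overline{n}<\overline{n-1}<\dots<\overline{1}\}$ (totally ordered), with $\overline{\overline{\imath}}=i$, $|\overline{\imath}|=|i|=i$. The Weyl group is the group $B_n$ of signed permutations: bijections $w$ of $[\overline{n}]$ with $w(\overline{\imath})=\overline{w(i)}$; write $w[1,k]=w(1)\dots w(k)$. Length: $\ell(w)=\#\{(k,l)\in[n]\times[\overline{n}]: k\le |l|,\ w(k)>w(l)\}$; $<$ on $B_n$ denotes Bruhat order. Positive roots and reflections: for $1\le i<j\le n$, $(i,j)$ is the root $\varepsilon_i-\varepsilon_j$ and the reflection $t_{ij}t_{\overline{\jmath}\,\overline{\imath}}$; $(i,\overline{\jmath})$ is $\varepsilon_i+\varepsilon_j$ and the reflection $t_{i\overline{\jmath}}t_{j\overline{\imath}}$; for $1\le i\le n$, $(i,\overline{\imath})$ is $2\varepsilon_i$ and the transposition $t_{i\overline{\imath}}$; right multiplication $w\,t_{ab}$ swaps the entries of $w$ in positions $a,b$. Set $\langle\rho,(i,j)^\vee\rangle=j-i$, $\langle\rho,(i,\overline{\jmath})^\vee\rangle=2n+2-i-j$, $\langle\rho,(i,\overline{\imath})^\vee\rangle=n+1-i$.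 For $2\le i\le n$ let $\Gamma_i=((1,\overline{\imath}),(2,\overline{\imath}),\dots,(i-1,\overline{\imath}))$; for $1\le i\le k\le n$ let $\Gamma_{ki}=((1,\overline{\imath}),\dots,(i-1,\overline{\imath}),(i,\overline{k+1}),(i,\overline{k+2}),\dots,(i,\overline{n}),(i,\overline{\imath}),(i,n),(i,n-1),\dots,(i,k+1))$. Let $\Gamma_r(k)=\Gamma_2\cdots\Gamma_k$, $\Gamma_l(k)=\Gamma_{k1}\cdots\Gamma_{kk}$, $\Gamma(k)=\Gamma_r(k)\Gamma_l(k)$. Let $\Gamma=\Gamma^{\mu_1}\cdots\Gamma^1=(\beta_1,\dots,\beta_m)$ with $\Gamma^j=\Gamma^j_r\Gamma^j_l$, $\Gamma^j_r=\Gamma_r(\mu'_j)$, $\Gamma^j_l=\Gamma_l(\mu'_j)$. A folding pair is $(w,J)$ with $w\in B_n$, $J=\{j_1<\dots<j_s\}\subseteq\{1,\dots,m\}$; $w_0=w$, $w_i=w\beta_{j_1}\cdots\beta_{j_i}$ (product of reflections), $\mathrm{end}(w,J)=w_s$; $j_i$ is a negative folding if $w_{i-1}<w_i$ and positive if $w_{i-1}>w_i$; $J^-$ is the set of negative foldings. $\overline{\mathcal F}(\mu)$ is the set of folding pairs with $\frac12(\ell(w)+\ell(\mathrm{end}(w,J))-\#J)+\sum_{j\in J^-}\langle\rho,\beta_j^\vee\rangle=0$. Identify $J$ with the subsequence $T$ of $\Gamma$, factored as $T=T^{\mu_1}\cdots T^1$ and $T^j=T^j_rT^j_l$ according to the factorizations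 of $\Gamma$. Let $\pi^j_r=wT^{\mu_1}\cdots T^{j+1}$ and $\pi^j_l=\pi^j_rT^j_r$. The filling map sends $(w,T)$ to the filling $f(w,T)=C^{\mu_1}_rC^{\mu_1}_l\cdots C^1_rC^1_l$ of the Young diagram $2\mu$ (columns displayed left to right in this order), where $C^j_r=\pi^j_r[1,\mu'_j]$, $C^j_l=\pi^j_l[1,\mu'_j]$, read top to bottom. $\mathrm{ord}$ sorts each column increasingly in the order of $[\overline{n}]$. Kashiwara–Nakashima (KN) columns and splitting: let $D$ be a strictly increasing sequence in $[\overline{n}]$ and $I=\{z_1>\dots>z_r\}$ the set of $z\in[n]$ with both $z,\overline z\in D$. $D$ can be split if there exist $t_1>\dots>t_r$ in $[n]$ with: $t_1$ the greatest element of $[n]$ with $t_1<z_1$ and $t_1,\overline{t_1}\notin D$; for $i\ge2$, $t_i$ the greatest element of $[n]$ with $t_i<\min(t_{i-1},z_i)$ and $t_i,\overline{t_i}\notin D$. Then $rD$ is obtained from $D$ by replacing each $\overline{z_i}$ by $\overline{t_i}$ and sorting, and $lD$ by replacing each $z_i$ by $t_i$ and sorting. A KN column is a $D$ that can be split. $B_\mu$ is the set of fillings $D^{\mu_1}_rD^{\mu_1}_l\cdots D^1_rD^1_l$ of shape $2\mu$ such that for each $j$, $(D^j_r,D^j_l)=(rD^j,lD^j)$ for some KN column $D^j$ of height $\mu'_j$. *)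

theory Defs
  imports Complex_Main "HOL-Combinatorics.Permutations"
begin

text \<open>
  The ordered alphabet 1 < 2 < ... < n < n-bar < ... < 1-bar is encoded by the numbers
  1, ..., 2n with their usual order: the letter i-bar is the number 2n + 1 - i.
\<close>

definition letters :: "nat \<Rightarrow> nat set" where
  "letters n = {1..2 * n}"

definition bar :: "nat \<Rightarrow> nat \<Rightarrow> nat" where
  "bar n x = 2 * n + 1 - x"

definition letter_abs :: "nat \<Rightarrow> nat \<Rightarrow> nat" where
  "letter_abs n x = (if x \<le> n then x else bar n x)"

text \<open>
  Signed permutations are functions on all of \<^typ>\<open>nat\<close>, equal to the identity off the alphabet
  (this is part of \<^const>\<open>permutes\<close>). The product \<open>u w\<close> is \<open>u \<circ> w\<close>, so right multiplication acts on
  positions.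
\<close>

definition signed_perms :: "nat \<Rightarrow> (nat \<Rightarrow> nat) set" where
  "signed_perms n = {w. w permutes letters n \<and> (\<forall>x\<in>letters n. w (bar n x) = bar n (w x))}"

definition len :: "nat \<Rightarrow> (nat \<Rightarrow> nat) \<Rightarrow> nat" where
  "len n w = card {(k, l). k \<in> {1..n} \<and> l \<in> letters n \<and> k \<le> letter_abs n l \<and> w k > w l}"

type_synonym root = "nat \<times> nat"

definition pos_roots :: "nat \<Rightarrow> root set" where
  "pos_roots n =
     {(i, j) | i j. 1 \<le> i \<and> i < j \<and> j \<le> n} \<union>
     {(i, bar n j) | i j. 1 \<le> i \<and> i < j \<and> j \<le> n} \<union>
     {(i, bar n i) | i. 1 \<le> i \<and> i \<le> n}"

fun reflection :: "nat \<Rightarrow> root \<Rightarrow> nat \<Rightarrow> nat" where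
  "reflection n (a, b) =
     (if b = bar n a then transpose a b
      else transpose a b \<circ> transpose (bar n b) (bar n a))"

text \<open>The pairing of \<open>\<rho>\<close> with the coroot of a root, for roots in \<^term>\<open>pos_roots n\<close>.\<close>

fun rho_pairing :: "nat \<Rightarrow> root \<Rightarrow> nat" where
  "rho_pairing n (a, b) =
     (if b \<le> n then b - a
      else if b = bar n a then n + 1 - a
      else 2 * n + 2 - a - bar n b)"

text \<open>Strict Bruhat order: the transitive closure of length-increasing multiplication by reflections.\<close>

inductive bruhat_less :: "nat \<Rightarrow> (nat \<Rightarrow> nat) \<Rightarrow> (nat \<Rightarrow> nat) \<Rightarrow> bool" for n where
  step: "u \<in> signed_perms n \<Longrightarrow> \<beta> \<in> pos_roots n \<Longrightarrow> len n u < len n (u \<circ> reflection n \<beta>)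
     \<Longrightarrow> bruhat_less n u (u \<circ> reflection n \<beta>)"
| trans: "bruhat_less n u v \<Longrightarrow> bruhat_less n v w \<Longrightarrow> bruhat_less n u w"

definition Gamma_row :: "nat \<Rightarrow> nat \<Rightarrow> root list" where
  "Gamma_row n i = map (\<lambda>j. (j, bar n i)) [1..<i]"

definition Gamma_row_l :: "nat \<Rightarrow> nat \<Rightarrow> nat \<Rightarrow> root list" where
  "Gamma_row_l n k i =
     map (\<lambda>j. (j, bar n i)) [1..<i] @
     map (\<lambda>j. (i, bar n j)) [k + 1..<n + 1] @
     [(i, bar n i)] @
     map (\<lambda>j. (i, j)) (rev [k + 1..<n + 1])"

definition Gamma_r :: "nat \<Rightarrow> nat \<Rightarrow> root list" where
  "Gamma_r n k = concat (map (Gamma_row n) [2..<k + 1])"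

definition Gamma_l :: "nat \<Rightarrow> nat \<Rightarrow> root list" where
  "Gamma_l n k = concat (map (Gamma_row_l n k) [1..<k + 1])"

definition dominant :: "nat \<Rightarrow> (nat \<Rightarrow> nat) \<Rightarrow> bool" where
  "dominant n \<mu> \<longleftrightarrow> (\<forall>i j. 1 \<le> i \<longrightarrow> i \<le> j \<longrightarrow> j \<le> n \<longrightarrow> \<mu> j \<le> \<mu> i)"

definition conj_part :: "nat \<Rightarrow> (nat \<Rightarrow> nat) \<Rightarrow> nat \<Rightarrow> nat" where
  "conj_part n \<mu> j = card {i \<in> {1..n}. j \<le> \<mu> i}"

text \<open>\<open>Gamma_above n \<mu> j\<close> is the initial part of the chain \<open>\<Gamma>\<close> consisting of the blocks with upper
  indices \<open>\<mu> 1, ..., j + 1\<close>; the whole chain is obtained for \<open>j = 0\<close>.\<close>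

definition Gamma_above :: "nat \<Rightarrow> (nat \<Rightarrow> nat) \<Rightarrow> nat \<Rightarrow> root list" where
  "Gamma_above n \<mu> j =
     concat (map (\<lambda>i. Gamma_r n (conj_part n \<mu> i) @ Gamma_l n (conj_part n \<mu> i))
                 (rev [j + 1..<\<mu> 1 + 1]))"

definition Gamma :: "nat \<Rightarrow> (nat \<Rightarrow> nat) \<Rightarrow> root list" where
  "Gamma n \<mu> = Gamma_above n \<mu> 0"

text \<open>
  A folding pair is \<open>(w, J)\<close> where \<open>J\<close> is a set of positions of the list \<^term>\<open>Gamma n \<mu>\<close>, counted
  from 0 as usual for lists. \<open>fold_upto n \<mu> w J p\<close> is the product of \<open>w\<close> with the reflections at
  those positions in \<open>J\<close> that are smaller than \<open>p\<close>, in increasing order.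
\<close>

type_synonym folding = "(nat \<Rightarrow> nat) \<times> nat set"

definition fold_upto ::
  "nat \<Rightarrow> (nat \<Rightarrow> nat) \<Rightarrow> (nat \<Rightarrow> nat) \<Rightarrow> nat set \<Rightarrow> nat \<Rightarrow> nat \<Rightarrow> nat" where
  "fold_upto n \<mu> w J p =
     foldl (\<lambda>u \<beta>. u \<circ> reflection n \<beta>) w (nths (take p (Gamma n \<mu>)) J)"

definition end_perm :: "nat \<Rightarrow> (nat \<Rightarrow> nat) \<Rightarrow> (nat \<Rightarrow> nat) \<Rightarrow> nat set \<Rightarrow> nat \<Rightarrow> nat" where
  "end_perm n \<mu> w J = fold_upto n \<mu> w J (length (Gamma n \<mu>))"

definition neg_foldings :: "nat \<Rightarrow> (nat \<Rightarrow> nat) \<Rightarrow> (nat \<Rightarrow> nat) \<Rightarrow> nat set \<Rightarrow> nat set" where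
  "neg_foldings n \<mu> w J =
     {p \<in> J. bruhat_less n (fold_upto n \<mu> w J p) (fold_upto n \<mu> w J (Suc p))}"

definition Fbar :: "nat \<Rightarrow> (nat \<Rightarrow> nat) \<Rightarrow> folding set" where
  "Fbar n \<mu> = {(w, J).
     w \<in> signed_perms n \<and> J \<subseteq> {..<length (Gamma n \<mu>)} \<and>
     (1 / 2) * (real (len n w) + real (len n (end_perm n \<mu> w J)) - real (card J))
       + (\<Sum>p\<in>neg_foldings n \<mu> w J. real (rho_pairing n (Gamma n \<mu> ! p))) = 0}"

text \<open>A filling of the diagram of shape \<open>2\<mu>\<close> is the list of its columns from left to right, each
  read from top to bottom.\<close>

type_synonym filling = "nat list list"

definition pi_r :: "nat \<Rightarrow> (nat \<Rightarrow> nat) \<Rightarrow> (nat \<Rightarrow> nat) \<Rightarrow> nat set \<Rightarrow> nat \<Rightarrow> nat \<Rightarrow> nat" where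
  "pi_r n \<mu> w J j = fold_upto n \<mu> w J (length (Gamma_above n \<mu> j))"

definition pi_l :: "nat \<Rightarrow> (nat \<Rightarrow> nat) \<Rightarrow> (nat \<Rightarrow> nat) \<Rightarrow> nat set \<Rightarrow> nat \<Rightarrow> nat \<Rightarrow> nat" where
  "pi_l n \<mu> w J j =
     fold_upto n \<mu> w J (length (Gamma_above n \<mu> j) + length (Gamma_r n (conj_part n \<mu> j)))"

definition initial_word :: "(nat \<Rightarrow> nat) \<Rightarrow> nat \<Rightarrow> nat list" where
  "initial_word w k = map w [1..<k + 1]"

fun filling_map :: "nat \<Rightarrow> (nat \<Rightarrow> nat) \<Rightarrow> folding \<Rightarrow> filling" where
  "filling_map n \<mu> (w, J) =
     concat (map (\<lambda>j. [initial_word (pi_r n \<mu> w J j) (conj_part n \<mu> j),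
                       initial_word (pi_l n \<mu> w J j) (conj_part n \<mu> j)])
                 (rev [1..<\<mu> 1 + 1]))"

definition ord_filling :: "filling \<Rightarrow> filling" where
  "ord_filling = map sort"

definition is_column :: "nat \<Rightarrow> nat list \<Rightarrow> bool" where
  "is_column n D \<longleftrightarrow> sorted_wrt (<) D \<and> set D \<subseteq> letters n"

definition paired_letters :: "nat \<Rightarrow> nat list \<Rightarrow> nat list" where
  "paired_letters n D = rev (sorted_list_of_set {z \<in> {1..n}. z \<in> set D \<and> bar n z \<in> set D})"

text \<open>\<open>is_splitting n D ts\<close>: the list \<open>ts\<close> consists of the letters \<open>t\<^sub>1 > t\<^sub>2 > ...\<close> used to split \<open>D\<close>,
  where \<^term>\<open>paired_letters n D\<close> is the list \<open>z\<^sub>1 > z\<^sub>2 > ...\<close>.\<close>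

definition is_splitting :: "nat \<Rightarrow> nat list \<Rightarrow> nat list \<Rightarrow> bool" where
  "is_splitting n D ts \<longleftrightarrow>
     (let zs = paired_letters n D in
      length ts = length zs \<and>
      (\<forall>i<length zs.
         let cand = {t \<in> {1..n}. t < zs ! i \<and> (0 < i \<longrightarrow> t < ts ! (i - 1)) \<and>
                                 t \<notin> set D \<and> bar n t \<notin> set D}
         in ts ! i \<in> cand \<and> (\<forall>t\<in>cand. t \<le> ts ! i)))"

definition KN_column :: "nat \<Rightarrow> nat list \<Rightarrow> bool" where
  "KN_column n D \<longleftrightarrow> is_column n D \<and> (\<exists>ts. is_splitting n D ts)"

definition splitting :: "nat \<Rightarrow> nat list \<Rightarrow> nat list" where
  "splitting n D = (THE ts. is_splitting n D ts)"

text \<open>\<open>replace_letters xs ys D\<close> replaces each entry of \<open>D\<close> equal to some \<open>xs ! i\<close> by \<open>ys ! i\<close>.\<close>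

definition replace_letters :: "nat list \<Rightarrow> nat list \<Rightarrow> nat list \<Rightarrow> nat list" where
  "replace_letters xs ys D = map (\<lambda>x. case map_of (zip xs ys) x of None \<Rightarrow> x | Some y \<Rightarrow> y) D"

definition r_col :: "nat \<Rightarrow> nat list \<Rightarrow> nat list" where
  "r_col n D =
     sort (replace_letters (map (bar n) (paired_letters n D)) (map (bar n) (splitting n D)) D)"

definition l_col :: "nat \<Rightarrow> nat list \<Rightarrow> nat list" where
  "l_col n D = sort (replace_letters (paired_letters n D) (splitting n D) D)"

definition B_set :: "nat \<Rightarrow> (nat \<Rightarrow> nat) \<Rightarrow> filling set" where
  "B_set n \<mu> =
     {concat (map (\<lambda>j. [r_col n (D j), l_col n (D j)]) (rev [1..<\<mu> 1 + 1])) | D.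
        \<forall>j\<in>{1..\<mu> 1}. KN_column n (D j) \<and> length (D j) = conj_part n \<mu> j}"

end

theory Submission
  imports Defs
begin

text \<open>
  Up to a factor 2 the statistic defining \<^const>\<open>Fbar\<close> is \<open>2 \<ell>(end)\<close> plus one nonnegative term per
  folding, so it vanishes iff the path ends at the identity and every step, read backwards, is an
  edge of the quantum Bruhat graph. Hence \<^const>\<open>Fbar\<close> consists of the walks from the identity along
  the reversed chain. Such a walk is cut into blocks, and it is enough to treat one block from an
  arbitrary signed permutation.

  Along the reversed left block every set of \<open>k\<close> letters without a pair \<open>z\<close>, \<open>z\<close>-bar is reached at the
  positions \<open>1, \<dots>, k\<close> by exactly one walk: the values at the positions \<open>k, \<dots>, 1\<close> become final one
  after the other, and the final value at each position is forced to be the one given by the greedy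
  cyclic assignment of the current values to the target set, an assignment that is invariant under
  the swaps which change later values.

  Along the reversed right block only signs are exchanged: a positive sign moves from an absolute
  value to a larger one that is reachable without leaving the set of absolute values present. The
  pairs of sets joined by a walk are therefore given by a dominance condition on signs, again with
  exactly one walk for each pair, and this condition characterizes the split pairs of
  Kashiwara-Nakashima columns.
\<close>

section \<open>Length changes and quantum Bruhat edges\<close>

text \<open>Reading paths backwards gives all of them the same starting point, the identity. Sorting
  keeps only the set of values at the first positions, so bijectivity asks for exactly one walk per
  prescribed set, from whatever signed permutation a block starts at. What makes walks countable is
  a uniform edge criterion: exchanging the values x and y at positions i < l is an edge iff no
  position in between carries a value cyclically between x and y and, when the root has the form
  \<epsilon>_i + \<epsilon>_j, also x < y within one half of the alphabet. A wanted final value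
  therefore decides every single step. The obstacle is the last segment of each stage of a left
  block. It exchanges with barred positions whose mirror images are treated later, so the later
  stages start from altered values. These values only rise, and a pigeonhole count over the pairs z,
  z-bar shows that the letters they jump over are already taken; this is why the greedy assignment
  survives. The same kind of count shows that the greedy letter can always be attained.\<close>

declare reflection.simps [simp del] rho_pairing.simps [simp del]

lemma bar_bar [simp]: "x \<in> letters n \<Longrightarrow> bar n (bar n x) = x"
  by (auto simp: bar_def letters_def)

lemma bar_letters: "x \<in> letters n \<Longrightarrow> bar n x \<in> letters n"
  by (auto simp: bar_def letters_def)

lemma signed_permD:
  assumes "v \<in> signed_perms n"
  shows "v permutes letters n" "inj v"
    "x \<in> letters n \<Longrightarrow> v x \<in> letters n"
    "x \<in> letters n \<Longrightarrow> v (bar n x) = bar n (v x)"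
  using assms by (auto simp: signed_perms_def permutes_in_image permutes_inj)

lemma bar_neq: "x \<in> letters n \<Longrightarrow> bar n x \<noteq> x"
  unfolding bar_def letters_def by (simp add: atLeastAtMost_iff) presburger

lemma bar_inj: "x \<in> letters n \<Longrightarrow> y \<in> letters n \<Longrightarrow> bar n x = bar n y \<longleftrightarrow> x = y"
  by (auto simp: bar_def letters_def)

lemma bar_less_iff:
  assumes "x \<in> letters n" "y \<in> letters n"
  shows "bar n x < bar n y \<longleftrightarrow> y < x" "bar n x \<le> bar n y \<longleftrightarrow> y \<le> x"
    "bar n x < y \<longleftrightarrow> bar n y < x" "x < bar n y \<longleftrightarrow> y < bar n x"
    "bar n x \<le> n \<longleftrightarrow> n < x" "n < bar n x \<longleftrightarrow> x \<le> n"
  using assms by (auto simp: bar_def letters_def)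

text \<open>Valid for every \<open>l > i\<close> up to \<open>2 * n\<close>, also beyond
  \<open>bar n i\<close>, where \<open>(i, l)\<close> is not the normal form of a positive root. For
  \<open>l = bar n i\<close> the last two swaps repeat the first two.\<close>

lemma reflection_apply:
  assumes "1 \<le> i" "i \<le> n" "i < l" "l \<le> 2 * n"
  shows "reflection n (i, l) c =
    (if c = i then l else if c = l then i else if c = bar n i then bar n l
     else if c = bar n l then bar n i else c)"
proof (cases "l = bar n i")
  case True
  then have "bar n l = i" using assms by (auto simp: letters_def)
  with True show ?thesis by (simp add: reflection.simps transpose_def)
next
  case False
  have L: "i \<in> letters n" "l \<in> letters n" using assms by (auto simp: letters_def)
  have "bar n i \<noteq> i" "bar n l \<noteq> l" "bar n i \<noteq> bar n l" "i \<noteq> bar n l"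
    using L assms(3) False bar_neq bar_inj by auto
  with False assms(3) show ?thesis by (simp add: reflection.simps transpose_def)
qed

lemma reflection_reflection:
  assumes "1 \<le> i" "i \<le> n" "i < l" "l \<le> 2 * n"
  shows "reflection n (i, l) (reflection n (i, l) c) = c"
proof (cases "l = bar n i")
  case True
  then show ?thesis by (simp add: reflection.simps)
next
  case False
  have L: "i \<in> letters n" "l \<in> letters n" using assms by (auto simp: letters_def)
  have "bar n i \<noteq> i" "bar n l \<noteq> l" "bar n i \<noteq> bar n l" "i \<noteq> bar n l"
    using L assms(3) False bar_neq bar_inj by auto
  then show ?thesis unfolding reflection_apply[OF assms] using False assms(3) by simp
qed

lemma reflection_invol:
  assumes "1 \<le> i" "i \<le> n" "i < l" "l \<le> 2 * n"
  shows "v \<circ> reflection n (i, l) \<circ> reflection n (i, l) = v"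
  by (rule ext) (simp add: reflection_reflection[OF assms])

lemma reflection_signed_perm:
  assumes "1 \<le> i" "i \<le> n" "i < l" "l \<le> 2 * n" "v \<in> signed_perms n"
  shows "v \<circ> reflection n (i, l) \<in> signed_perms n"
proof -
  let ?r = "reflection n (i, l)"
  note app = reflection_apply[OF assms(1-4)]
  have L: "i \<in> letters n" "l \<in> letters n" using assms by (auto simp: letters_def)
  have d: "bar n i \<noteq> i" "bar n l \<noteq> l" "bar n i \<noteq> bar n l"
    using L assms(3) bar_neq bar_inj by auto
  have out: "?r c = c" if "c \<notin> letters n" for c
    unfolding app using L that bar_letters by auto
  have "?r permutes letters n"
    unfolding permutes_def using reflection_reflection[OF assms(1-4)] out by metis
  moreover have "?r (bar n c) = bar n (?r c)" "?r c \<in> letters n" if "c \<in> letters n" for c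
  proof -
    have "bar n c = x \<longleftrightarrow> c = bar n x" if "x \<in> letters n" for x
      using that \<open>c \<in> letters n\<close> by auto
    then show "?r (bar n c) = bar n (?r c)"
      unfolding app using that L d by (auto simp: bar_letters)
    show "?r c \<in> letters n" unfolding app using that L by (auto intro: bar_letters)
  qed
  ultimately show ?thesis
    using assms(5) by (auto simp: signed_perms_def intro: permutes_compose)
qed

section \<open>Length as an inversion count in the full alphabet\<close>

definition discord :: "nat \<Rightarrow> (nat \<Rightarrow> nat) \<Rightarrow> (nat \<times> nat) set" where
  "discord n w = {(a, b). a \<in> letters n \<and> b \<in> letters n \<and> a < b \<and> w b < w a}"

definition negs :: "nat \<Rightarrow> (nat \<Rightarrow> nat) \<Rightarrow> nat set" where
  "negs n w = {k \<in> {1..n}. n < w k}"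

lemma finite_letters [simp]: "finite (letters n)"
  by (simp add: letters_def)

lemma finite_discord [simp]: "finite (discord n w)"
  by (rule finite_subset[of _ "letters n \<times> letters n"]) (auto simp: discord_def)

text \<open>The map sending \<open>(a, b)\<close> to \<open>(bar n b, bar n a)\<close> matches the
  inversions with \<open>a + b < 2 * n + 1\<close> with those above. The length counts the former
  and the self-paired inversions \<open>(k, bar n k)\<close>; the latter correspond to
  \<open>negs\<close>, so they must be added once more to reach twice the length.\<close>

lemma two_len:
  assumes w: "w \<in> signed_perms n"
  shows "2 * len n w = card (discord n w) + card (negs n w)"
proof -
  let ?X = "{(a, b) \<in> discord n w. a + b < 2 * n + 1}"
  let ?Y = "{(a, b) \<in> discord n w. a + b > 2 * n + 1}"
  let ?D = "{(a, b) \<in> discord n w. a + b = 2 * n + 1}"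
  have len: "len n w = card (?X \<union> ?D)"
    unfolding len_def
    by (rule arg_cong[where f = card])
      (force simp: discord_def letters_def letter_abs_def bar_def split: if_splits
        intro: Suc_leI le_neq_implies_less)
  have Y: "?Y = (\<lambda>(a, b). (bar n b, bar n a)) ` ?X"
  proof (intro set_eqI iffI)
    fix p assume "p \<in> ?Y"
    moreover obtain a b where "p = (a, b)" by (cases p)
    ultimately have p: "p = (a, b)" "a \<in> letters n" "b \<in> letters n" "a < b" "w b < w a"
      "a + b > 2 * n + 1"
      by (auto simp: discord_def)
    have "bar n (w a) < bar n (w b)"
      using p signed_permD(3)[OF w p(2)] signed_permD(3)[OF w p(3)]
      by (auto simp: bar_def letters_def)
    moreover have "bar n a \<in> letters n" "bar n b \<in> letters n" using p by (auto intro: bar_letters)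
    ultimately have "(bar n b, bar n a) \<in> ?X"
      using p signed_permD(4)[OF w] by (auto simp: discord_def) (auto simp: letters_def bar_def)
    moreover have "p = (\<lambda>(a, b). (bar n b, bar n a)) (bar n b, bar n a)"
      using p by simp
    ultimately show "p \<in> (\<lambda>(a, b). (bar n b, bar n a)) ` ?X" by blast
  next
    fix p assume "p \<in> (\<lambda>(a, b). (bar n b, bar n a)) ` ?X"
    then obtain a b where p: "p = (bar n b, bar n a)" "a \<in> letters n" "b \<in> letters n" "a < b"
      "w b < w a" "a + b < 2 * n + 1"
      by (auto simp: discord_def)
    moreover have "bar n (w a) < bar n (w b)"
      using p signed_permD(3)[OF w p(2)] signed_permD(3)[OF w p(3)]
      by (auto simp: bar_def letters_def)
    moreover have "bar n a \<in> letters n" "bar n b \<in> letters n" using p by (auto intro: bar_letters)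
    ultimately show "p \<in> ?Y"
      using signed_permD(4)[OF w] by (auto simp: discord_def) (auto simp: letters_def bar_def)
  qed
  have "inj_on (\<lambda>(a, b). (bar n b, bar n a)) ?X"
    by (auto simp: inj_on_def discord_def letters_def bar_def)
  then have cY: "card ?Y = card ?X"
    unfolding Y by (rule card_image)
  have D: "?D = (\<lambda>k. (k, bar n k)) ` negs n w"
  proof (intro set_eqI iffI)
    fix p assume "p \<in> ?D"
    then obtain a b where p: "p = (a, b)" "a \<in> letters n" "b \<in> letters n" "a < b" "w b < w a"
      "a + b = 2 * n + 1"
      by (auto simp: discord_def)
    then have b: "b = bar n a" and a: "a \<in> {1..n}" by (auto simp: bar_def letters_def)
    have "w b = bar n (w a)" using p b signed_permD(4)[OF w] by simp
    then have "n < w a" using p by (auto simp: bar_def)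
    then show "p \<in> (\<lambda>k. (k, bar n k)) ` negs n w" using p b a by (auto simp: negs_def)
  next
    fix p assume "p \<in> (\<lambda>k. (k, bar n k)) ` negs n w"
    then obtain k where k: "p = (k, bar n k)" "1 \<le> k" "k \<le> n" "n < w k"
      by (auto simp: negs_def)
    have "k \<in> letters n" using k by (auto simp: letters_def)
    then show "p \<in> ?D" using k signed_permD(3,4)[OF w, of k]
      by (auto simp: discord_def letters_def bar_def)
  qed
  have cD: "card ?D = card (negs n w)"
    unfolding D by (rule card_image) (auto simp: inj_on_def)
  have fin: "finite ?X" "finite ?Y" "finite ?D"
    by (auto intro: finite_subset[OF _ finite_discord[of n w]])
  have "card ((?X \<union> ?D) \<union> ?Y) = card (?X \<union> ?D) + card ?Y"
    using fin by (intro card_Un_disjoint) auto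
  moreover have "(?X \<union> ?D) \<union> ?Y = discord n w" by auto
  ultimately have "card (discord n w) = card (?X \<union> ?D) + card ?Y" by simp
  moreover have "card (?X \<union> ?D) = card ?X + card ?D"
    using fin by (subst card_Un_disjoint) auto
  ultimately show ?thesis using len cY cD by simp
qed

definition sg :: "nat \<Rightarrow> nat \<Rightarrow> int" where
  "sg a b = (if a < b then - 1 else if a = b then 0 else 1)"

text \<open>An inversion count in product form. Since the sum runs over all ordered pairs, a
  transposition of positions can be moved to the first factor by reindexing, and the change of the
  inversion number becomes a termwise difference.\<close>

definition concord_sum :: "nat \<Rightarrow> (nat \<Rightarrow> nat) \<Rightarrow> int" where
  "concord_sum n w = (\<Sum>a\<in>letters n. \<Sum>b\<in>letters n. sg a b * sg (w a) (w b))"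

lemma concord_sum_discord:
  assumes w: "inj_on w (letters n)"
  shows "concord_sum n w = concord_sum n id - 4 * int (card (discord n w))"
proof -
  let ?L = "letters n"
  let ?P = "\<lambda>a b. a < b \<and> w b < w a"
  have pt: "sg a b * sg (w a) (w b) = sg a b * sg a b - 2 * of_bool (?P a b) - 2 * of_bool (?P b a)"
    if "a \<in> ?L" "b \<in> ?L" for a b
    using that inj_onD[OF w, of a b] by (auto simp: sg_def)
  have c: "(\<Sum>a\<in>?L. \<Sum>b\<in>?L. of_bool (?P a b)) = int (card (discord n w))"
  proof -
    have "(\<Sum>a\<in>?L. \<Sum>b\<in>?L. of_bool (?P a b)) = (\<Sum>p\<in>?L \<times> ?L. of_bool (?P (fst p) (snd p)) :: int)"
      by (simp only: sum.cartesian_product case_prod_unfold)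
    also have "\<dots> = (\<Sum>p\<in>discord n w. 1)"
      by (rule sum.mono_neutral_cong_right) (auto simp: discord_def)
    finally show ?thesis by simp
  qed
  have c': "(\<Sum>a\<in>?L. \<Sum>b\<in>?L. of_bool (?P b a)) = int (card (discord n w))"
    by (subst sum.swap) (rule c)
  have "concord_sum n w = (\<Sum>a\<in>?L. \<Sum>b\<in>?L. sg a b * sg a b - 2 * of_bool (?P a b) - 2 * of_bool (?P b a))"
    unfolding concord_sum_def by (intro sum.cong refl pt)
  also have "\<dots> = concord_sum n id - 2 * (\<Sum>a\<in>?L. \<Sum>b\<in>?L. of_bool (?P a b))
      - 2 * (\<Sum>a\<in>?L. \<Sum>b\<in>?L. of_bool (?P b a))"
    by (simp add: concord_sum_def sum_subtractf sum_distrib_left del: sum_of_bool_eq sum_mult_of_bool_eq)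
  also have "\<dots> = concord_sum n id - 4 * int (card (discord n w))"
    unfolding c c' by simp
  finally show ?thesis .
qed

definition between :: "(nat \<Rightarrow> nat) \<Rightarrow> nat \<Rightarrow> nat \<Rightarrow> nat set" where
  "between w p q = {c. p < c \<and> c < q \<and> w p < w c \<and> w c < w q}"

lemma finite_between [simp]: "finite (between w p q)"
  by (rule finite_subset[of _ "{p..q}"]) (auto simp: between_def)

lemma sum_sum_remove2:
  fixes f :: "'a \<Rightarrow> 'a \<Rightarrow> int"
  assumes "finite L" "p \<in> L" "q \<in> L" "p \<noteq> q"
    and z: "\<And>a b. a \<in> L - {p, q} \<Longrightarrow> b \<in> L - {p, q} \<Longrightarrow> f a b = 0"
  shows "(\<Sum>a\<in>L. \<Sum>b\<in>L. f a b) = f p p + f p q + f q p + f q q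
    + (\<Sum>c\<in>L - {p, q}. f p c + f c p + f q c + f c q)"
proof -
  have ins: "(\<Sum>b\<in>L. g b) = g p + g q + (\<Sum>b\<in>L - {p, q}. g b)" for g :: "'a \<Rightarrow> int"
  proof -
    have "(\<Sum>b\<in>L. g b) = g p + (\<Sum>b\<in>L - {p}. g b)"
      using assms(1,2) by (rule sum.remove)
    also have "(\<Sum>b\<in>L - {p}. g b) = g q + (\<Sum>b\<in>L - {p} - {q}. g b)"
      using assms(1,3,4) by (intro sum.remove) auto
    also have "L - {p} - {q} = L - {p, q}" by auto
    finally show ?thesis by (simp add: add.assoc)
  qed
  have "(\<Sum>a\<in>L - {p, q}. \<Sum>b\<in>L. f a b) = (\<Sum>a\<in>L - {p, q}. f a p + f a q)"
    by (intro sum.cong refl) (simp add: ins z)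
  then show ?thesis
    by (subst ins) (simp add: ins sum.distrib)
qed

text \<open>In the difference of the two sums only pairs containing \<open>p\<close> or
  \<open>q\<close> survive: these two together give 4, each position of \<open>between w p q\<close>
  gives 8, every other position 0. One inversion is worth 4 by
  \<open>concord_sum_discord\<close>.\<close>

lemma card_discord_transpose:
  assumes w: "inj_on w (letters n)" and pq: "p \<in> letters n" "q \<in> letters n" "p < q" "w p < w q"
  shows "card (discord n (w \<circ> transpose p q)) = card (discord n w) + 1 + 2 * card (between w p q)"
proof -
  let ?L = "letters n" and ?t = "transpose p q"
  have t: "bij_betw ?t ?L ?L"
    using pq by (simp add: bij_betw_transpose_iff)
  have tt: "?t (?t x) = x" for x by simp
  have inj: "inj_on (w \<circ> ?t) ?L"
    using w t by (metis bij_betw_def comp_inj_on)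
  have re: "(\<Sum>a\<in>?L. h (?t a)) = (\<Sum>a\<in>?L. h a)" for h :: "nat \<Rightarrow> int"
    by (rule sum.reindex_bij_betw[OF t])
  \<comment> \<open>Writing \<open>a\<close> as \<open>?t (?t a)\<close> prepares the reindexing
    along the involution \<open>?t\<close>, done once per summation variable.\<close>
  have "concord_sum n (w \<circ> ?t) = (\<Sum>a\<in>?L. \<Sum>b\<in>?L. sg (?t (?t a)) (?t (?t b)) * sg (w (?t a)) (w (?t b)))"
    by (simp add: concord_sum_def)
  also have "\<dots> = (\<Sum>a\<in>?L. \<Sum>b\<in>?L. sg (?t a) (?t (?t b)) * sg (w a) (w (?t b)))"
    by (rule re[where h = "\<lambda>a. \<Sum>b\<in>?L. sg (?t a) (?t (?t b)) * sg (w a) (w (?t b))"])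
  also have "\<dots> = (\<Sum>a\<in>?L. \<Sum>b\<in>?L. sg (?t a) (?t b) * sg (w a) (w b))"
    by (rule sum.cong[OF refl], rule re)
  finally have "concord_sum n w - concord_sum n (w \<circ> ?t) =
      (\<Sum>a\<in>?L. \<Sum>b\<in>?L. (sg a b - sg (?t a) (?t b)) * sg (w a) (w b))"
    by (simp add: concord_sum_def sum_subtractf left_diff_distrib)
  also have "\<dots> = 4 + (\<Sum>c\<in>?L - {p, q}. 2 * (sg p c - sg q c) * (sg (w p) (w c) - sg (w q) (w c)))"
  proof (subst sum_sum_remove2[of _ p q], goal_cases)
    case 6
    have "(\<Sum>c\<in>?L - {p, q}. (sg p c - sg (?t p) (?t c)) * sg (w p) (w c) +
        (sg c p - sg (?t c) (?t p)) * sg (w c) (w p) + (sg q c - sg (?t q) (?t c)) * sg (w q) (w c) +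
        (sg c q - sg (?t c) (?t q)) * sg (w c) (w q)) =
      (\<Sum>c\<in>?L - {p, q}. 2 * (sg p c - sg q c) * (sg (w p) (w c) - sg (w q) (w c)))"
    proof (rule sum.cong[OF refl])
      fix c assume c: "c \<in> ?L - {p, q}"
      then have "?t c = c" by (auto simp: transpose_def)
      moreover have "sg c p = - sg p c" "sg c q = - sg q c" "sg (w c) (w p) = - sg (w p) (w c)"
        "sg (w c) (w q) = - sg (w q) (w c)"
        by (auto simp: sg_def)
      ultimately show "(sg p c - sg (?t p) (?t c)) * sg (w p) (w c) +
        (sg c p - sg (?t c) (?t p)) * sg (w c) (w p) + (sg q c - sg (?t q) (?t c)) * sg (w q) (w c) +
        (sg c q - sg (?t c) (?t q)) * sg (w c) (w q) =
        2 * (sg p c - sg q c) * (sg (w p) (w c) - sg (w q) (w c))"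
        by (simp add: algebra_simps)
    qed
    moreover have "sg p q = -1" "sg q p = 1" "sg (w p) (w q) = -1" "sg (w q) (w p) = 1"
      "\<And>x. sg x x = 0"
      using pq by (auto simp: sg_def)
    ultimately show ?case by simp
  qed (use pq in \<open>auto simp: transpose_def\<close>)
  also have "(\<Sum>c\<in>?L - {p, q}. 2 * (sg p c - sg q c) * (sg (w p) (w c) - sg (w q) (w c))) =
      (\<Sum>c\<in>between w p q. 8)"
  proof (rule sum.mono_neutral_cong_right)
    show "between w p q \<subseteq> ?L - {p, q}" using pq by (auto simp: between_def letters_def)
    have ne: "w c \<noteq> w p" "w c \<noteq> w q" if "c \<in> ?L - {p, q}" for c
      using that pq w by (auto dest: inj_onD)
    show "\<forall>c\<in>?L - {p, q} - between w p q.
        2 * (sg p c - sg q c) * (sg (w p) (w c) - sg (w q) (w c)) = 0"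
    proof
      fix c assume "c \<in> ?L - {p, q} - between w p q"
      then show "2 * (sg p c - sg q c) * (sg (w p) (w c) - sg (w q) (w c)) = 0"
        using pq ne[of c] by (auto simp: sg_def between_def)
    qed
  qed (use pq in \<open>auto simp: sg_def between_def\<close>)
  finally have "concord_sum n w - concord_sum n (w \<circ> ?t) = 4 + 8 * int (card (between w p q))"
    by (simp add: comp_def)
  then show ?thesis
    using concord_sum_discord[OF w] concord_sum_discord[OF inj] by linarith
qed

section \<open>Length changes under the three kinds of reflections\<close>

lemma inj_on_signed: "v \<in> signed_perms n \<Longrightarrow> inj_on v A"
  using signed_permD(2) by (auto intro: inj_on_subset)

text \<open>A single transposition: it adds \<open>1 + 2 * card (between v i (bar n i))\<close>
  inversions of the full alphabet and one negative position; half of the total is the claim.\<close>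

lemma len_reflection_long:
  assumes v: "v \<in> signed_perms n" and i: "1 \<le> i" "i \<le> n" and lt: "v i < v (bar n i)"
  shows "len n (v \<circ> reflection n (i, bar n i)) = len n v + 1 + card (between v i (bar n i))"
proof -
  let ?u = "v \<circ> reflection n (i, bar n i)"
  have L: "i \<in> letters n" "bar n i \<in> letters n" "i < bar n i" "bar n i \<le> 2 * n"
    using i by (auto simp: letters_def bar_def)
  have u: "?u \<in> signed_perms n"
    by (rule reflection_signed_perm[OF i L(3,4) v])
  have vi: "v (bar n i) = bar n (v i)" "v i \<in> letters n"
    using signed_permD(3,4)[OF v] L by auto
  then have le: "v i \<le> n" using lt by (auto simp: bar_def letters_def)
  have uk: "?u k = v k" if "k \<in> {1..n}" "k \<noteq> i" for k
    using that L i by (auto simp: reflection.simps transpose_def bar_def)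
  have ui: "?u i = bar n (v i)" using vi by (simp add: reflection.simps)
  have "negs n ?u = insert i (negs n v)"
  proof (intro set_eqI)
    fix k show "k \<in> negs n ?u \<longleftrightarrow> k \<in> insert i (negs n v)"
      using uk[of k] ui i vi le by (cases "k = i") (auto simp: negs_def bar_less_iff)
  qed
  moreover have "i \<notin> negs n v" using le by (auto simp: negs_def)
  ultimately have "card (negs n ?u) = card (negs n v) + 1"
    by (simp add: negs_def)
  moreover have "card (discord n ?u) = card (discord n v) + 1 + 2 * card (between v i (bar n i))"
    using card_discord_transpose[OF inj_on_signed[OF v] L(1,2,3) lt] by (simp add: reflection.simps)
  ultimately show ?thesis
    using two_len[OF v] two_len[OF u] by simp
qed

lemma card_between_bar:
  assumes v: "v \<in> signed_perms n" and pq: "p \<in> letters n" "q \<in> letters n"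
  shows "card (between v (bar n q) (bar n p)) = card (between v p q)"
proof -
  have "between v (bar n q) (bar n p) = bar n ` between v p q"
  proof (intro set_eqI iffI)
    fix c assume "c \<in> between v (bar n q) (bar n p)"
    then have c: "bar n q < c" "c < bar n p" "v (bar n q) < v c" "v c < v (bar n p)"
      by (auto simp: between_def)
    then have cL: "c \<in> letters n" using pq by (auto simp: letters_def bar_def)
    have "v (bar n c) = bar n (v c)" "v (bar n q) = bar n (v q)" "v (bar n p) = bar n (v p)"
      "v c \<in> letters n" "v p \<in> letters n" "v q \<in> letters n"
      using signed_permD(3,4)[OF v] cL pq by auto
    then have "bar n c \<in> between v p q" using c pq cL
      by (simp add: between_def bar_less_iff)
    then show "c \<in> bar n ` between v p q" using cL by (metis bar_bar image_eqI)
  next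
    fix c assume "c \<in> bar n ` between v p q"
    then obtain d where d: "c = bar n d" "p < d" "d < q" "v p < v d" "v d < v q"
      by (auto simp: between_def)
    then have dL: "d \<in> letters n" using pq by (auto simp: letters_def)
    have "v (bar n d) = bar n (v d)" "v (bar n q) = bar n (v q)" "v (bar n p) = bar n (v p)"
      "v d \<in> letters n" "v p \<in> letters n" "v q \<in> letters n"
      using signed_permD(3,4)[OF v] dL pq by auto
    then show "c \<in> between v (bar n q) (bar n p)" using d pq dL
      by (simp add: between_def bar_less_iff)
  qed
  moreover have "inj_on (bar n) (between v p q)"
    using pq by (auto simp: inj_on_def between_def bar_def letters_def)
  ultimately show ?thesis by (simp add: card_image)
qed

text \<open>The two transpositions do not interfere, since the first leaves all positions above
  \<open>j\<close> alone. Their windows are mirror images and contribute equally, and the number of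
  negative positions is unchanged.\<close>

lemma len_reflection_short:
  assumes v: "v \<in> signed_perms n" and ij: "1 \<le> i" "i < j" "j \<le> n" and lt: "v i < v j"
  shows "len n (v \<circ> reflection n (i, j)) = len n v + 1 + 2 * card (between v i j)"
proof -
  let ?u = "v \<circ> reflection n (i, j)" and ?w = "v \<circ> transpose i j"
  have L: "i \<in> letters n" "j \<in> letters n" "bar n i \<in> letters n" "bar n j \<in> letters n"
    "bar n j < bar n i" "j \<noteq> bar n i" "j < bar n j" "j \<le> 2 * n"
    using ij by (auto simp: letters_def bar_def)
  have u: "?u \<in> signed_perms n"
    by (rule reflection_signed_perm) (use ij v L in auto)
  have vb: "v (bar n i) = bar n (v i)" "v (bar n j) = bar n (v j)" "v i \<in> letters n" "v j \<in> letters n"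
    using signed_permD(3,4)[OF v] L by auto
  have w: "?w c = v c" if "j < c" for c using that ij by (auto simp: transpose_def)
  have neg: "card (negs n ?u) = card (negs n v)"
  proof -
    have uk: "?u k = v (transpose i j k)" if "k \<in> {1..n}" for k
    proof -
      have "k \<noteq> bar n i" "k \<noteq> bar n j" using that ij by (auto simp: bar_def)
      then show ?thesis using L by (simp add: reflection.simps)
    qed
    have tk: "transpose i j k \<in> {1..n}" if "k \<in> {1..n}" for k
      using that ij by (auto simp: transpose_def)
    have "transpose i j ` negs n ?u = negs n v"
    proof (intro set_eqI iffI)
      fix k assume "k \<in> transpose i j ` negs n ?u"
      then obtain m where "k = transpose i j m" "m \<in> {1..n}" "n < ?u m" unfolding negs_def by blast
      then show "k \<in> negs n v" using uk[of m] tk[of m] unfolding negs_def by simp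
    next
      fix k assume "k \<in> negs n v"
      then have "k \<in> {1..n}" "n < v k" unfolding negs_def by auto
      then have "transpose i j k \<in> negs n ?u"
        using uk[OF tk[of k]] tk[of k] unfolding negs_def by simp
      then show "k \<in> transpose i j ` negs n ?u" by (metis image_eqI transpose_involutory)
    qed
    moreover have "inj_on (transpose i j) (negs n ?u)"
      by (rule inj_onI) (metis transpose_involutory)
    ultimately show ?thesis by (metis card_image)
  qed
  have inj: "inj ?w" using signed_permD(2)[OF v] by (simp add: inj_compose)
  have "card (discord n (?w \<circ> transpose (bar n j) (bar n i))) =
      card (discord n ?w) + 1 + 2 * card (between ?w (bar n j) (bar n i))"
  proof (rule card_discord_transpose)
    have "?w (bar n j) = bar n (v j)" "?w (bar n i) = bar n (v i)"
      using w[of "bar n j"] w[of "bar n i"] L vb by auto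
    then show "?w (bar n j) < ?w (bar n i)"
      using vb lt by (simp add: bar_less_iff)
  qed (use inj L in \<open>auto intro: inj_on_subset\<close>)
  moreover have "between ?w (bar n j) (bar n i) = between v (bar n j) (bar n i)"
    using w L by (auto simp: between_def)
  moreover have "card (discord n ?w) = card (discord n v) + 1 + 2 * card (between v i j)"
    using card_discord_transpose[OF inj_on_signed[OF v] L(1,2) ij(2) lt] .
  moreover have "?w \<circ> transpose (bar n j) (bar n i) = ?u" using L by (simp add: comp_assoc reflection.simps)
  ultimately have "card (discord n ?u) = card (discord n v) + 2 + 4 * card (between v i j)"
    using card_between_bar[OF v L(1,2)] by simp
  then show ?thesis using two_len[OF v] two_len[OF u] neg by simp
qed

text \<open>Now the second window \<open>j..bar n i\<close> contains \<open>bar n j\<close>, whose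
  value the first transposition has changed, so \<open>?C\<close> and \<open>?M\<close> may differ
  in this one position. For values in the same half they agree; otherwise they differ by exactly one
  element and two positions become negative. The third claim leaves a gap of 2 where a quantum edge
  has 1, so these roots admit no quantum edge.\<close>

lemma len_reflection_mixed:
  assumes v: "v \<in> signed_perms n" and ij: "1 \<le> i" "i < j" "j \<le> n" and lt: "v i < v (bar n j)"
  defines "u \<equiv> v \<circ> reflection n (i, bar n j)"
  shows "v i \<le> n \<longleftrightarrow> v (bar n j) \<le> n \<Longrightarrow> len n u = len n v + 1 + 2 * card (between v i (bar n j))"
    and "\<not> (v i \<le> n \<longleftrightarrow> v (bar n j) \<le> n) \<Longrightarrow> len n v + 2 \<le> len n u"
    and "len n u + 2 \<le> len n v + 2 * (2 * n + 2 - i - j)"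
proof -
  let ?w = "v \<circ> transpose i (bar n j)"
  let ?B = "between v i (bar n j)" and ?C = "between ?w j (bar n i)" and ?M = "between v j (bar n i)"
  have L: "i \<in> letters n" "j \<in> letters n" "bar n i \<in> letters n" "bar n j \<in> letters n"
    "i < bar n j" "j < bar n i" "bar n j \<noteq> bar n i" "j < bar n j" "bar n j < bar n i" "bar n j \<le> 2 * n"
    "bar n (bar n j) = j"
    using ij by (auto simp: letters_def bar_def)
  have u: "u \<in> signed_perms n" unfolding u_def
    by (rule reflection_signed_perm) (use ij v L in auto)
  define a b where "a = v i" and "b = v (bar n j)"
  have vb: "v (bar n i) = bar n a" "v j = bar n b" "a \<in> letters n" "b \<in> letters n" "a < b"
    using signed_permD(3)[OF v, of i] signed_permD(3)[OF v, of "bar n j"] signed_permD(4)[OF v, of i]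
      signed_permD(4)[OF v, of "bar n j"] L lt unfolding a_def b_def by simp_all
  have ab: "a \<noteq> bar n b"
    using vb(2) a_def ij signed_permD(2)[OF v] by (metis injD less_irrefl)
  have w: "?w c = (if c = bar n j then a else v c)" if "j \<le> c" for c
    using that ij by (auto simp: transpose_def a_def)
  have inj: "inj ?w" using signed_permD(2)[OF v] by (simp add: inj_compose)
  have d2: "card (discord n (?w \<circ> transpose j (bar n i))) = card (discord n ?w) + 1 + 2 * card ?C"
  proof (rule card_discord_transpose)
    have "?w j = bar n b" "?w (bar n i) = bar n a"
      using w[of j] w[of "bar n i"] L vb by auto
    then show "?w j < ?w (bar n i)"
      using vb by (simp add: bar_less_iff)
  qed (use inj L in \<open>auto intro: inj_on_subset\<close>)
  have d1: "card (discord n ?w) = card (discord n v) + 1 + 2 * card ?B"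
    by (rule card_discord_transpose[OF inj_on_signed[OF v] L(1,4,5) lt])
  have "?w \<circ> transpose j (bar n i) = u" using L by (simp add: comp_assoc u_def reflection.simps)
  then have d: "card (discord n u) = card (discord n v) + 2 + 2 * card ?B + 2 * card ?C"
    using d1 d2 by simp
  have BM: "card ?M = card ?B"
    using card_between_bar[OF v L(1,4)] L by simp
  have uk: "u k = (if k = i then b else if k = j then bar n a else v k)" if "k \<in> {1..n}" for k
  proof -
    have "k \<noteq> bar n i" "k \<noteq> bar n j" using that ij by (auto simp: bar_def)
    have "u k = v (reflection n (i, bar n j) k)" by (simp add: u_def)
    also have "\<dots> = (if k = i then b else if k = j then bar n a else v k)"
      using reflection_apply[of i n "bar n j" k] ij L(5,10,11) vb(1) \<open>k \<noteq> bar n i\<close> \<open>k \<noteq> bar n j\<close>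
      unfolding a_def b_def by simp
    finally show ?thesis .
  qed
  have vk: "v k = (if k = i then a else if k = j then bar n b else v k)" for k
    using vb a_def by auto
  have cM: "card ?B \<le> 2 * n - i - j"
  proof -
    have "card ?B \<le> card {i<..<bar n j}" by (rule card_mono) (auto simp: between_def)
    then show ?thesis by (auto simp: bar_def)
  qed
  have wji: "?w j = bar n b" "?w (bar n i) = bar n a"
    using w[of j] w[of "bar n i"] L(6-9) vb(1,2) by auto
  have C: "c \<in> ?C \<longleftrightarrow> j < c \<and> c < bar n i \<and>
      (if c = bar n j then bar n b < a \<and> a < bar n a else bar n b < v c \<and> v c < bar n a)" for c
    using w[of c] unfolding between_def wji mem_Collect_eq by (auto simp del: comp_apply)
  have M: "c \<in> ?M \<longleftrightarrow> j < c \<and> c < bar n i \<and> bar n b < v c \<and> v c < bar n a" for c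
    unfolding between_def vb(1,2) mem_Collect_eq ..
  have jB: "j < bar n j \<and> bar n j < bar n i" using L by simp
  have same: "card (negs n u) = card (negs n v) \<and> card ?C = card ?B" if s: "a \<le> n \<longleftrightarrow> b \<le> n"
  proof -
    have "\<not> (bar n b < a \<and> a < bar n a)" "\<not> (bar n b < b \<and> b < bar n a)"
      using s vb(3-5) by (auto simp: bar_def letters_def)
    then have "c \<in> ?C \<longleftrightarrow> c \<in> ?M" for c
      unfolding C M using b_def by auto
    then have "?C = ?M" by blast
    moreover have "card (negs n u) = card (negs n v)"
    proof -
      have "n < u k \<longleftrightarrow> n < v k" if "k \<in> {1..n}" for k
        using uk[OF that] vk[of k] s vb(3,4) by (auto simp: bar_less_iff)
      then show ?thesis unfolding negs_def by (metis (no_types, lifting))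
    qed
    ultimately show ?thesis using BM by simp
  qed
  have diff: "card (negs n u) = card (negs n v) + 2 \<and>
      (card ?B = card ?C + 1 \<or> card ?C = card ?B + 1 \<and> card ?B + 1 \<le> 2 * n - i - j)"
    if s: "\<not> (a \<le> n \<longleftrightarrow> b \<le> n)"
  proof -
    have s': "a \<le> n" "n < b" using s vb by auto
    have "negs n u = insert i (insert j (negs n v))"
    proof (intro set_eqI)
      fix k show "k \<in> negs n u \<longleftrightarrow> k \<in> insert i (insert j (negs n v))"
        using uk[of k] ij s' vb
        by (cases "k = i"; cases "k = j") (auto simp: negs_def bar_def)
    qed
    moreover have "i \<notin> negs n v" "j \<notin> negs n v" using s' a_def vb by (auto simp: negs_def bar_def)
    ultimately have N: "card (negs n u) = card (negs n v) + 2"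
      using ij by (simp add: negs_def)
    show ?thesis
    proof (cases "a < bar n b")
      case True
      then have "b < bar n a" using vb by (auto simp: bar_def letters_def)
      then have M': "bar n j \<in> ?M" unfolding M using jB s' True b_def by (auto simp: bar_def)
      have "\<not> bar n b < a" using True by simp
      then have "c \<in> ?C \<longleftrightarrow> c \<in> ?M - {bar n j}" for c
        unfolding Diff_iff C M by auto
      then have "?C = ?M - {bar n j}" by blast
      then have "card ?M = card ?C + 1" using card.remove[OF finite_between M'] by simp
      then show ?thesis using N BM by simp
    next
      case False
      then have lt: "bar n b < a" using ab by simp
      then have "bar n a < b" using vb by (auto simp: bar_def letters_def)
      then have M': "bar n j \<notin> ?M" unfolding M using b_def by auto
      have "a < bar n a" using s' by (auto simp: bar_def)
      then have "c \<in> ?C \<longleftrightarrow> c \<in> insert (bar n j) ?M" for c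
        unfolding insert_iff C M using jB lt b_def by auto
      then have "?C = insert (bar n j) ?M" by blast
      then have "card ?C = card ?M + 1" using M' by simp
      \<comment> \<open>Here \<open>?C\<close> is the larger set, and the bound survives because
        position \<open>j\<close>, with value \<open>bar n b < a\<close>, is missing from the first
        window.\<close>
      moreover have "card ?B \<le> card ({i<..<bar n j} - {j})"
        by (rule card_mono) (use lt vb a_def in \<open>auto simp: between_def\<close>)
      then have "card ?B + 1 \<le> 2 * n - i - j"
        using ij L by (simp add: card_Diff_singleton) (auto simp: bar_def)
      ultimately show ?thesis using N BM by simp
    qed
  qed
  show "len n u = len n v + 1 + 2 * card ?B" if "v i \<le> n \<longleftrightarrow> v (bar n j) \<le> n"
    using same that two_len[OF u] two_len[OF v] d a_def b_def by auto
  show "len n v + 2 \<le> len n u" if "\<not> (v i \<le> n \<longleftrightarrow> v (bar n j) \<le> n)"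
    using diff that two_len[OF u] two_len[OF v] d a_def b_def by auto
  show "len n u + 2 \<le> len n v + 2 * (2 * n + 2 - i - j)"
    using same diff two_len[OF u] two_len[OF v] d cM ij by linarith
qed

text \<open>The edges of the quantum Bruhat graph. A quantum edge lowers the length by
  \<open>2 * rho_pairing n \<beta> - 1\<close>; this is written additively to stay within the
  natural numbers.\<close>

definition qedge :: "nat \<Rightarrow> (nat \<Rightarrow> nat) \<Rightarrow> root \<Rightarrow> bool" where
  "qedge n v \<beta> \<longleftrightarrow> len n (v \<circ> reflection n \<beta>) = len n v + 1 \<or>
     len n (v \<circ> reflection n \<beta>) + 2 * rho_pairing n \<beta> = len n v + 1"

text \<open>Going upwards from \<open>x\<close> on the alphabet closed to a circle, \<open>c\<close>
  is met strictly before \<open>y\<close>; nothing lies between for \<open>x = y\<close>. Quantum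
  edges are the ones that wrap around.\<close>

definition cyc :: "nat \<Rightarrow> nat \<Rightarrow> nat \<Rightarrow> bool" where
  "cyc x c y \<longleftrightarrow> x < c \<and> c < y \<or> c < y \<and> y < x \<or> y < x \<and> x < c"

definition half_less :: "nat \<Rightarrow> nat \<Rightarrow> nat \<Rightarrow> bool" where
  "half_less n y z \<longleftrightarrow> y < z \<and> (y \<le> n \<longleftrightarrow> z \<le> n)"

lemma qedge_up:
  assumes "len n (v \<circ> reflection n \<beta>) = len n v + 1 + m" "1 \<le> rho_pairing n \<beta>"
  shows "qedge n v \<beta> \<longleftrightarrow> m = 0"
  using assms by (auto simp: qedge_def)

text \<open>An ascent is an edge iff \<open>between\<close> is empty. A descent is one iff, after
  the exchange, \<open>between\<close> is the whole interval of positions, because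
  \<open>2 * rho_pairing n (i, l) - 2\<close> is \<open>e\<close> times its size. Both mean that no
  intermediate value lies cyclically between. The two further claims later make the contribution of
  every folding nonnegative.\<close>

lemma qedge_short_long:
  assumes v: "v \<in> signed_perms n" and i: "1 \<le> i" "i \<le> n" and l: "i < l" "l \<le> n \<or> l = bar n i"
  shows "qedge n v (i, l) \<longleftrightarrow> (\<forall>c. i < c \<and> c < l \<longrightarrow> \<not> cyc (v i) (v c) (v l))" (is "_ \<longleftrightarrow> ?R")
    and "len n (v \<circ> reflection n (i, l)) \<noteq> len n v"
    and "len n (v \<circ> reflection n (i, l)) + 1 \<le> len n v + 2 * rho_pairing n (i, l)"
proof -
  \<comment> \<open>The factor is 2 if the reflection exchanges two pairs of positions and 1 for the
    single transposition of \<open>i\<close> and \<open>bar n i\<close>.\<close>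
  define e where "e = (if l \<le> n then 2 else 1 :: nat)"
  have l2: "l \<le> 2 * n" using l i by (auto simp: bar_def)
  have ne: "v c \<noteq> v l" "v c \<noteq> v i" if "i < c" "c < l" for c
    using that signed_permD(2)[OF v] by (auto dest: injD)
  have up: "len n (x \<circ> reflection n (i, l)) = len n x + 1 + e * card (between x i l)"
    if "x \<in> signed_perms n" "x i < x l" for x
  proof (cases "l \<le> n")
    case True
    then show ?thesis using len_reflection_short[OF that(1) i(1) l(1)] that(2) by (simp add: e_def)
  next
    case False
    then show ?thesis using len_reflection_long[OF that(1) i] that(2) l by (simp add: e_def)
  qed
  have ht: "2 * rho_pairing n (i, l) = e * card {i<..<l} + 2" "1 \<le> rho_pairing n (i, l)"
    using i l by (auto simp: e_def bar_def rho_pairing.simps)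
  have btw_le: "card (between x i l) \<le> card {i<..<l}" for x
    by (rule card_mono) (auto simp: between_def)
  have le: "e * card (between x i l) \<le> e * card {i<..<l}" for x
    using btw_le by simp
  let ?u = "v \<circ> reflection n (i, l)"
  have main: "(qedge n v (i, l) \<longleftrightarrow> ?R) \<and> len n ?u \<noteq> len n v \<and>
      len n ?u + 1 \<le> len n v + 2 * rho_pairing n (i, l)"
  proof (cases "v i < v l")
    case True
    have "e * card (between v i l) = 0 \<longleftrightarrow> between v i l = {}"
      by (simp add: e_def)
    also have "\<dots> \<longleftrightarrow> ?R" using True by (auto simp: between_def cyc_def)
    finally have "qedge n v (i, l) \<longleftrightarrow> ?R" using qedge_up[OF up[OF v True] ht(2)] by simp
    moreover have "len n ?u \<noteq> len n v" "len n ?u + 1 \<le> len n v + 2 * rho_pairing n (i, l)"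
      using up[OF v True] ht le[of v] by linarith+
    ultimately show ?thesis by blast
  next
    case False
    then have lt: "v l < v i" using l signed_permD(2)[OF v] by (metis injD linorder_neqE_nat less_irrefl)
    have u: "?u \<in> signed_perms n" by (rule reflection_signed_perm[OF i l(1) l2 v])
    have ui: "?u i = v l" "?u l = v i"
      using reflection_apply[OF i l(1) l2, of i] reflection_apply[OF i l(1) l2, of l]
      by auto
    have uc: "?u c = v c" if "i < c" "c < l" for c
    proof -
      have "c \<noteq> bar n i" "c \<noteq> bar n l" using that l i by (auto simp: bar_def)
      then show ?thesis using reflection_apply[OF i l(1) l2, of c] that
        by auto
    qed
    have lenv: "len n v = len n ?u + 1 + e * card (between ?u i l)"
      using up[OF u] ui lt reflection_invol[OF i l(1) l2, of v] by simp
    have "qedge n v (i, l) \<longleftrightarrow> len n ?u + 2 * rho_pairing n (i, l) = len n v + 1"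
      using lenv by (auto simp: qedge_def)
    also have "\<dots> \<longleftrightarrow> e * card (between ?u i l) = e * card {i<..<l}"
      using lenv ht by linarith
    also have "\<dots> \<longleftrightarrow> card (between ?u i l) = card {i<..<l}" by (simp add: e_def)
    also have "\<dots> \<longleftrightarrow> between ?u i l = {i<..<l}"
    proof
      have sub: "between ?u i l \<subseteq> {i<..<l}" unfolding between_def by (rule subsetI) simp
      show "between ?u i l = {i<..<l}" if "card (between ?u i l) = card {i<..<l}"
        by (rule card_subset_eq[OF _ sub that]) simp
    qed simp
    also have "\<dots> \<longleftrightarrow> ?R"
    proof
      assume eq: "between ?u i l = {i<..<l}"
      show ?R
      proof (intro allI impI)
        fix c assume c: "i < c \<and> c < l"
        then have "c \<in> between ?u i l" using eq by simp
        then have "v l < v c" "v c < v i" using c uc ui unfolding between_def by auto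
        then show "\<not> cyc (v i) (v c) (v l)" by (auto simp: cyc_def)
      qed
    next
      assume R: ?R
      have "c \<in> between ?u i l" if "c \<in> {i<..<l}" for c
      proof -
        have "i < c" "c < l" using that by auto
        moreover from this have "v l < v c" "v c < v i"
          using R[rule_format, of c] lt ne[of c] unfolding cyc_def by auto
        ultimately show ?thesis using uc[of c] ui unfolding between_def by simp
      qed
      then show "between ?u i l = {i<..<l}" by (auto simp: between_def)
    qed
    moreover have "len n ?u \<noteq> len n v" "len n ?u + 1 \<le> len n v + 2 * rho_pairing n (i, l)"
      using lenv ht by linarith+
    ultimately show ?thesis by blast
  qed
  then show "qedge n v (i, l) \<longleftrightarrow> ?R" "len n ?u \<noteq> len n v"
    "len n ?u + 1 \<le> len n v + 2 * rho_pairing n (i, l)" by auto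
qed

text \<open>The length changes by at most \<open>2 * rho_pairing - 2\<close>, which rules out
  descents, and an ascent across the two halves changes it by at least 2. Only ascents within one
  half remain.\<close>

lemma qedge_mixed:
  assumes v: "v \<in> signed_perms n" and ij: "1 \<le> i" "i < j" "j \<le> n"
  shows "qedge n v (i, bar n j) \<longleftrightarrow> half_less n (v i) (v (bar n j)) \<and>
      (\<forall>c. i < c \<and> c < bar n j \<longrightarrow> \<not> cyc (v i) (v c) (v (bar n j)))"
    and "len n (v \<circ> reflection n (i, bar n j)) \<noteq> len n v"
    and "len n (v \<circ> reflection n (i, bar n j)) + 1 \<le> len n v + 2 * rho_pairing n (i, bar n j)"
proof -
  let ?l = "bar n j" and ?u = "v \<circ> reflection n (i, bar n j)"
  have i: "i \<le> n" "i < ?l" "?l \<le> 2 * n" using ij by (auto simp: bar_def)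
  have ht: "rho_pairing n (i, ?l) = 2 * n + 2 - i - j" "1 \<le> rho_pairing n (i, ?l)"
    using ij by (auto simp: bar_def rho_pairing.simps)
  have main: "(qedge n v (i, ?l) \<longleftrightarrow> half_less n (v i) (v ?l) \<and>
      (\<forall>c. i < c \<and> c < ?l \<longrightarrow> \<not> cyc (v i) (v c) (v ?l))) \<and> len n ?u \<noteq> len n v \<and>
     len n ?u + 1 \<le> len n v + 2 * rho_pairing n (i, ?l)"
  proof (cases "v i < v ?l")
    case True
    have le: "len n ?u + 2 \<le> len n v + 2 * rho_pairing n (i, ?l)"
      using len_reflection_mixed(3)[OF v ij True] ht by simp
    show ?thesis
    proof (cases "v i \<le> n \<longleftrightarrow> v ?l \<le> n")
      case s: True
      have eq: "len n ?u = len n v + 1 + 2 * card (between v i ?l)"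
        using len_reflection_mixed(1)[OF v ij True] s by simp
      have "2 * card (between v i ?l) = 0 \<longleftrightarrow> between v i ?l = {}" by simp
      also have "\<dots> \<longleftrightarrow> (\<forall>c. i < c \<and> c < ?l \<longrightarrow> \<not> cyc (v i) (v c) (v ?l))"
        using True by (auto simp: between_def cyc_def)
      finally show ?thesis using qedge_up[OF eq ht(2)] True s eq le by (simp add: half_less_def)
    next
      case s: False
      have "len n v + 2 \<le> len n ?u" using len_reflection_mixed(2)[OF v ij True] s by simp
      then show ?thesis using s le ht(2) by (auto simp: qedge_def half_less_def)
    qed
  next
    case False
    then have lt: "v ?l < v i" using i signed_permD(2)[OF v] by (metis injD linorder_neqE_nat less_irrefl)
    have u: "?u \<in> signed_perms n" by (rule reflection_signed_perm[OF ij(1) i v])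
    have ui: "?u i = v ?l" "?u ?l = v i"
      using reflection_apply[OF ij(1) i, of i] reflection_apply[OF ij(1) i, of ?l] i
      by auto
    have lt': "?u i < ?u ?l" using ui lt by simp
    have inv: "?u \<circ> reflection n (i, ?l) = v" by (rule reflection_invol[OF ij(1) i])
    have "len n v + 2 \<le> len n ?u + 2 * rho_pairing n (i, ?l)"
      using len_reflection_mixed(3)[OF u ij lt'] unfolding inv ht(1) .
    moreover have "len n ?u < len n v"
    proof (cases "?u i \<le> n \<longleftrightarrow> ?u ?l \<le> n")
      case True
      then show ?thesis using len_reflection_mixed(1)[OF u ij lt' True] unfolding inv by linarith
    next
      case False
      then show ?thesis using len_reflection_mixed(2)[OF u ij lt' False] unfolding inv by linarith
    qed
    ultimately show ?thesis using lt by (auto simp: qedge_def half_less_def)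
  qed
  then show "qedge n v (i, ?l) \<longleftrightarrow> half_less n (v i) (v ?l) \<and>
      (\<forall>c. i < c \<and> c < ?l \<longrightarrow> \<not> cyc (v i) (v c) (v ?l))"
    "len n ?u \<noteq> len n v" "len n ?u + 1 \<le> len n v + 2 * rho_pairing n (i, ?l)" by auto
qed

text \<open>
  The root whose reflection swaps the positions \<open>i\<close> and \<open>l\<close>; for \<open>l > bar i\<close> it is written with the
  mirror images of these positions.
\<close>

definition stage_root :: "nat \<Rightarrow> nat \<Rightarrow> nat \<Rightarrow> root" where
  "stage_root n i l = (if l \<le> bar n i then (i, l) else (bar n l, bar n i))"

lemma reflection_stage_root:
  assumes "1 \<le> i" "i \<le> n" "i < l" "l \<le> 2 * n"
  shows "reflection n (stage_root n i l) = reflection n (i, l)"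
proof (cases "l \<le> bar n i")
  case False
  have L: "i \<in> letters n" "l \<in> letters n" using assms by (auto simp: letters_def)
  have d: "bar n l < i" "i < bar n i" "bar n l < l" "1 \<le> bar n l" "bar n i \<le> 2 * n"
    using False assms by (auto simp: bar_def)
  show ?thesis
  proof
    fix c
    have "reflection n (bar n l, bar n i) c = reflection n (i, l) c"
      unfolding reflection_apply[OF assms]
      by (subst reflection_apply) (use d assms L in auto)
    then show "reflection n (stage_root n i l) c = reflection n (i, l) c"
      using False by (simp add: stage_root_def)
  qed
qed (simp add: stage_root_def)

text \<open>One criterion for all \<open>l > i\<close>, so that a stage becomes a sequence of
  exchanges at the fixed position \<open>i\<close>. Beyond \<open>bar n i\<close> the root is mixed
  in the mirrored positions; \<open>bar\<close> reverses the order of positions and of values, and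
  the criterion is invariant under doing both.\<close>

lemma qedge_stage_root:
  assumes v: "v \<in> signed_perms n" and il: "1 \<le> i" "i \<le> n" "i < l" "l \<le> 2 * n"
  shows "qedge n v (stage_root n i l) \<longleftrightarrow>
      (l \<le> n \<or> l = bar n i \<or> half_less n (v i) (v l)) \<and>
      (\<forall>c. i < c \<and> c < l \<longrightarrow> \<not> cyc (v i) (v c) (v l))"
    and "len n (v \<circ> reflection n (stage_root n i l)) \<noteq> len n v"
    and "len n (v \<circ> reflection n (stage_root n i l)) + 1 \<le> len n v + 2 * rho_pairing n (stage_root n i l)"
proof -
  consider "l \<le> n \<or> l = bar n i" | "n < l" "l < bar n i" | "bar n i < l" by linarith
  then have "(qedge n v (stage_root n i l) \<longleftrightarrow>
      (l \<le> n \<or> l = bar n i \<or> half_less n (v i) (v l)) \<and>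
      (\<forall>c. i < c \<and> c < l \<longrightarrow> \<not> cyc (v i) (v c) (v l))) \<and>
    len n (v \<circ> reflection n (stage_root n i l)) \<noteq> len n v \<and>
    len n (v \<circ> reflection n (stage_root n i l)) + 1 \<le> len n v + 2 * rho_pairing n (stage_root n i l)"
  proof cases
    case 1
    then have "stage_root n i l = (i, l)" using il by (auto simp: stage_root_def bar_def)
    then show ?thesis using qedge_short_long[OF v il(1-3) 1] 1 by metis
  next
    case 2
    then have "stage_root n i l = (i, l)" by (auto simp: stage_root_def)
    moreover obtain j where "l = bar n j" "i < j" "j \<le> n"
      using 2 il by (auto simp: bar_def intro!: that[of "2 * n + 1 - l"])
    ultimately show ?thesis using qedge_mixed[OF v il(1), of j] 2 by simp
  next
    case 3
    then have sr: "stage_root n i l = (bar n l, bar n i)" by (auto simp: stage_root_def)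
    let ?a = "bar n l"
    have a: "1 \<le> ?a" "?a < i" using 3 il by (auto simp: bar_def)
    have L: "l \<in> letters n" "i \<in> letters n" using il by (auto simp: letters_def)
    have vL: "v ?a = bar n (v l)" "v (bar n i) = bar n (v i)" "v l \<in> letters n" "v i \<in> letters n"
      using L signed_permD(3,4)[OF v] by auto
    have "half_less n (v ?a) (v (bar n i)) \<longleftrightarrow> half_less n (v i) (v l)"
      using vL by (auto simp: half_less_def bar_def letters_def)
    moreover have eq: "cyc (v ?a) (v c) (v (bar n i)) \<longleftrightarrow> cyc (v i) (v (bar n c)) (v l)"
      if "c \<in> letters n" for c
    proof -
      have "v (bar n c) = bar n (v c)" "v c \<in> letters n" using that signed_permD(3,4)[OF v] by auto
      then show ?thesis using vL by (auto simp: cyc_def bar_less_iff)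
    qed
    have "(\<forall>c. ?a < c \<and> c < bar n i \<longrightarrow> \<not> cyc (v ?a) (v c) (v (bar n i))) \<longleftrightarrow>
        (\<forall>c. i < c \<and> c < l \<longrightarrow> \<not> cyc (v i) (v c) (v l))"
    proof (intro iffI allI impI)
      fix c assume H: "\<forall>c. ?a < c \<and> c < bar n i \<longrightarrow> \<not> cyc (v ?a) (v c) (v (bar n i))"
        and c: "i < c \<and> c < l"
      have cL: "c \<in> letters n" using c il by (auto simp: letters_def)
      have "?a < bar n c" "bar n c < bar n i" using c L cL by (simp_all add: bar_less_iff)
      then have "\<not> cyc (v ?a) (v (bar n c)) (v (bar n i))" using H by blast
      then show "\<not> cyc (v i) (v c) (v l)" using eq[OF bar_letters[OF cL]] cL by simp
    next
      fix c assume H: "\<forall>c. i < c \<and> c < l \<longrightarrow> \<not> cyc (v i) (v c) (v l)"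
        and c: "?a < c \<and> c < bar n i"
      have cL: "c \<in> letters n" using c a(1) il by (auto simp: letters_def bar_def)
      have "i < bar n c" "bar n c < l" using c L cL bar_less_iff[of l n c] bar_less_iff[of c n i] by simp_all
      then show "\<not> cyc (v ?a) (v c) (v (bar n i))" using H eq[OF cL] by blast
    qed
    ultimately show ?thesis
      using qedge_mixed[OF v a il(2)] sr 3 il by (auto simp: bar_def)
  qed
  then show "qedge n v (stage_root n i l) \<longleftrightarrow>
      (l \<le> n \<or> l = bar n i \<or> half_less n (v i) (v l)) \<and>
      (\<forall>c. i < c \<and> c < l \<longrightarrow> \<not> cyc (v i) (v c) (v l))"
    "len n (v \<circ> reflection n (stage_root n i l)) \<noteq> len n v"
    "len n (v \<circ> reflection n (stage_root n i l)) + 1 \<le> len n v + 2 * rho_pairing n (stage_root n i l)"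
    by auto
qed

section \<open>Walks in the quantum Bruhat graph\<close>

text \<open>The bits record which roots are used. Uniqueness of walks becomes equality of bit lists,
  which are finally turned into the set of folding positions.\<close>

fun qwalk :: "nat \<Rightarrow> (nat \<Rightarrow> nat) \<Rightarrow> root list \<Rightarrow> bool list \<Rightarrow> (nat \<Rightarrow> nat) \<Rightarrow> bool" where
  "qwalk n v [] bs v' \<longleftrightarrow> bs = [] \<and> v' = v"
| "qwalk n v (\<beta> # \<beta>s) bs v' \<longleftrightarrow> (\<exists>b cs. bs = b # cs \<and> (b \<longrightarrow> qedge n v \<beta>) \<and>
     qwalk n (if b then v \<circ> reflection n \<beta> else v) \<beta>s cs v')"

lemma qwalk_Cons:
  "qwalk n v (\<beta> # \<beta>s) bs v' \<longleftrightarrow> (\<exists>cs. bs = False # cs \<and> qwalk n v \<beta>s cs v') \<or>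
     (\<exists>cs. bs = True # cs \<and> qedge n v \<beta> \<and> qwalk n (v \<circ> reflection n \<beta>) \<beta>s cs v')"
  by (auto split: if_splits)

declare qwalk.simps(2) [simp del]

lemma qwalk_length: "qwalk n v \<beta>s bs v' \<Longrightarrow> length bs = length \<beta>s"
  by (induction \<beta>s arbitrary: v bs) (auto simp: qwalk_Cons)

lemma qwalk_determ: "qwalk n v \<beta>s bs v1 \<Longrightarrow> qwalk n v \<beta>s bs v2 \<Longrightarrow> v1 = v2"
  by (induction \<beta>s arbitrary: v bs) (auto simp: qwalk_Cons)

lemma qwalk_append:
  "qwalk n v (as @ cs) bs v' \<longleftrightarrow>
    (\<exists>bs1 bs2 u. bs = bs1 @ bs2 \<and> qwalk n v as bs1 u \<and> qwalk n u cs bs2 v')"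
proof (induction as arbitrary: v bs)
  case (Cons a as)
  show ?case
  proof
    assume "qwalk n v ((a # as) @ cs) bs v'"
    then show "\<exists>bs1 bs2 u. bs = bs1 @ bs2 \<and> qwalk n v (a # as) bs1 u \<and> qwalk n u cs bs2 v'"
      unfolding append_Cons qwalk_Cons Cons.IH by (metis append_Cons)
  next
    assume "\<exists>bs1 bs2 u. bs = bs1 @ bs2 \<and> qwalk n v (a # as) bs1 u \<and> qwalk n u cs bs2 v'"
    then show "qwalk n v ((a # as) @ cs) bs v'"
      unfolding append_Cons qwalk_Cons Cons.IH by (metis append_Cons)
  qed
qed auto

section \<open>Stages: successive exchanges of the value at one position\<close>

abbreviation stage_walk ::
  "nat \<Rightarrow> nat \<Rightarrow> (nat \<Rightarrow> nat) \<Rightarrow> nat list \<Rightarrow> bool list \<Rightarrow> (nat \<Rightarrow> nat) \<Rightarrow> bool" where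
  "stage_walk n i v ls bs v' \<equiv> qwalk n v (map (stage_root n i) ls) bs v'"

lemma stage_walk_Cons:
  assumes "1 \<le> i" "i \<le> n" "i < l" "l \<le> 2 * n"
  shows "stage_walk n i v (l # ls) bs v' \<longleftrightarrow> (\<exists>cs. bs = False # cs \<and> stage_walk n i v ls cs v') \<or>
     (\<exists>cs. bs = True # cs \<and> qedge n v (stage_root n i l) \<and>
        stage_walk n i (v \<circ> reflection n (i, l)) ls cs v')"
  by (simp add: qwalk_Cons reflection_stage_root[OF assms])

lemma stage_walk_append:
  "stage_walk n i v (as @ cs) bs v' \<longleftrightarrow>
    (\<exists>bs1 bs2 u. bs = bs1 @ bs2 \<and> stage_walk n i v as bs1 u \<and> stage_walk n i u cs bs2 v')"
  by (simp add: qwalk_append)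

lemma stage_step:
  assumes "1 \<le> i" "i \<le> n" "i < l" "l \<le> 2 * n" and v: "v \<in> signed_perms n"
  defines "u \<equiv> v \<circ> reflection n (i, l)"
  shows "u \<in> signed_perms n" "u i = v l" "u l = v i" "u (bar n i) = bar n (v l)"
    "u (bar n l) = bar n (v i)" "c \<notin> {i, l, bar n i, bar n l} \<Longrightarrow> u c = v c"
proof -
  have L: "i \<in> letters n" "l \<in> letters n" using assms(1-4) by (auto simp: letters_def)
  show u: "u \<in> signed_perms n" unfolding u_def by (rule reflection_signed_perm[OF assms(1-5)])
  show *: "u i = v l" "u l = v i" "c \<notin> {i, l, bar n i, bar n l} \<Longrightarrow> u c = v c"
    unfolding u_def comp_apply reflection_apply[OF assms(1-4)] using assms(3) by auto
  show "u (bar n i) = bar n (v l)" "u (bar n l) = bar n (v i)"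
    using signed_permD(4)[OF u] L * by auto
qed

lemma stage_walk_signed:
  assumes "1 \<le> i" "i \<le> n" "v \<in> signed_perms n" "stage_walk n i v ls bs v'"
    and "\<And>l. l \<in> set ls \<Longrightarrow> i < l \<and> l \<le> 2 * n"
  shows "v' \<in> signed_perms n"
  using assms(3-5)
proof (induction ls arbitrary: v bs)
  case (Cons l ls)
  have l: "i < l" "l \<le> 2 * n" using Cons.prems(3) by auto
  show ?case
    using Cons.prems Cons.IH stage_step(1)[OF assms(1,2) l]
    unfolding stage_walk_Cons[OF assms(1,2) l] by (metis list.set_intros(2))
qed auto

lemma stage_walk_fixed:
  assumes "1 \<le> i" "i \<le> n" "v \<in> signed_perms n" "stage_walk n i v ls bs v'"
    and "\<And>l. l \<in> set ls \<Longrightarrow> i < l \<and> l \<le> 2 * n"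
    and "c \<notin> {i, bar n i}" "c \<notin> set ls" "c \<notin> bar n ` set ls"
  shows "v' c = v c"
  using assms(3-5,7,8)
proof (induction ls arbitrary: v bs)
  case (Cons l ls)
  have l: "i < l" "l \<le> 2 * n" using Cons.prems(3) by auto
  show ?case
    using Cons.prems Cons.IH assms(6) stage_step(1)[OF assms(1,2) l, of v]
      stage_step(6)[OF assms(1,2) l, of v c]
    unfolding stage_walk_Cons[OF assms(1,2) l] by (auto simp del: comp_apply)
qed auto

text \<open>As \<open>S\<close> avoids its mirror image, each reflection acts on it as the plain
  transposition of \<open>i\<close> and \<open>l\<close>; the mirrored exchange happens
  outside.\<close>

lemma stage_walk_image:
  assumes "1 \<le> i" "i \<le> n" "v \<in> signed_perms n" "stage_walk n i v ls bs v'"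
    and ls: "\<And>l. l \<in> set ls \<Longrightarrow> i < l \<and> l \<le> 2 * n"
    and S: "i \<in> S" "set ls \<subseteq> S" "S \<inter> bar n ` S = {}"
  shows "v' ` S = v ` S"
  using assms(3-5) S(2)
proof (induction ls arbitrary: v bs)
  case (Cons l ls)
  have l: "i < l" "l \<le> 2 * n" using Cons.prems(3) by auto
  let ?u = "v \<circ> reflection n (i, l)"
  note st = stage_step[OF assms(1,2) l Cons.prems(1)]
  have nb: "c \<noteq> bar n i" "c \<noteq> bar n l" if "c \<in> S" for c using that S Cons.prems(4) by auto
  have lS: "l \<in> S" using Cons.prems(4) by auto
  have uc: "?u c = v (transpose i l c)" if "c \<in> S" for c
    using st(2,3) st(6)[of c] nb[OF that] l
    by (cases "c = i"; cases "c = l") (auto simp: transpose_def simp del: comp_apply)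
  have "?u ` S = v ` transpose i l ` S"
    using uc by (simp add: image_image del: comp_apply)
  also have "transpose i l ` S = S" using S(1) lS by (simp add: transpose_image_eq)
  finally have "?u ` S = v ` S" .
  then show ?case
    using Cons.prems Cons.IH st(1)
    unfolding stage_walk_Cons[OF assms(1,2) l] by (metis insert_subset list.set_intros(2) list.simps(15))
qed auto

text \<open>
  The flag \<open>hi\<close> marks the segments of barred positions, where the swapped values stay in one half of
  the alphabet.
\<close>

definition chain_ok :: "nat \<Rightarrow> bool \<Rightarrow> nat \<Rightarrow> nat \<Rightarrow> bool" where
  "chain_ok n hi y z \<longleftrightarrow> (hi \<longrightarrow> half_less n y z)"

text \<open>The values with which position \<open>i\<close> can leave the segment
  \<open>p..<q\<close>. Positions of the segment impose no betweenness condition: a value there that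
  comes in between is swapped in on the way. Only the positions skipped before \<open>p\<close>
  obstruct.\<close>

definition chain_reach :: "nat \<Rightarrow> bool \<Rightarrow> nat \<Rightarrow> nat \<Rightarrow> nat \<Rightarrow> (nat \<Rightarrow> nat) \<Rightarrow> nat \<Rightarrow> bool" where
  "chain_reach n hi i p q v z \<longleftrightarrow> (z = v i \<or> z \<in> v ` {p..<q} \<and> chain_ok n hi (v i) z) \<and>
     (\<forall>c. i < c \<and> c < p \<longrightarrow> \<not> cyc (v i) (v c) z)"

text \<open>
  The elements of \<open>I\<close> are the values already passed; \<open>y\<close> is the next one. A walk from \<open>x\<close> to a
  later target \<open>z\<close> swaps \<open>y\<close> in exactly when \<open>y\<close> lies between \<open>x\<close> and \<open>z\<close>.
\<close>

lemma chain_dichotomy: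
  fixes x y z n :: nat and hi :: bool and I :: "nat set"
  assumes "x \<noteq> y" "y \<noteq> z" "x \<noteq> z" "x \<notin> I" "y \<notin> I" "z \<notin> I"
  defines "stay \<equiv> chain_ok n hi x z \<and> (\<forall>w\<in>I. \<not> cyc x w z) \<and> \<not> cyc x y z"
    and "move \<equiv> chain_ok n hi x y \<and> (\<forall>w\<in>I. \<not> cyc x w y) \<and> chain_ok n hi y z \<and>
      (\<forall>w\<in>I. \<not> cyc y w z) \<and> \<not> cyc y x z"
  shows "stay \<or> move \<longleftrightarrow> chain_ok n hi x z \<and> (\<forall>w\<in>I. \<not> cyc x w z)" "\<not> (stay \<and> move)"
proof -
  have A: "cyc x y z \<or> cyc y x z" "\<not> (cyc x y z \<and> cyc y x z)"
    using assms(1-3) by (auto simp: cyc_def)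
  have B: "cyc x w z \<longleftrightarrow> cyc x w y \<or> cyc y w z" if "w \<in> I" "cyc x y z" for w
  proof -
    have "w \<noteq> x" "w \<noteq> y" "w \<noteq> z" using that assms by auto
    then show ?thesis using that(2) unfolding cyc_def by linarith
  qed
  have C: "chain_ok n hi x z \<longleftrightarrow> chain_ok n hi x y \<and> chain_ok n hi y z" if "cyc x y z"
    using that by (auto simp: chain_ok_def half_less_def cyc_def)
  show "stay \<or> move \<longleftrightarrow> chain_ok n hi x z \<and> (\<forall>w\<in>I. \<not> cyc x w z)"
    unfolding stay_def move_def using A B C by blast
  show "\<not> (stay \<and> move)" unfolding stay_def move_def using A by blast
qed

text \<open>A segment along which the edge criterion keeps one form: unbarred positions, or barred
  positions on one side of \<open>bar n i\<close>. As \<open>q\<close> is exclusive,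
  \<open>q \<le> bar n i\<close> keeps \<open>bar n i\<close> itself out.\<close>

definition chain_range :: "nat \<Rightarrow> nat \<Rightarrow> nat \<Rightarrow> bool \<Rightarrow> nat \<Rightarrow> bool" where
  "chain_range n i q hi p \<longleftrightarrow> i < p \<and>
     (if hi then n < p \<and> q \<le> 2 * n + 1 \<and> (q \<le> bar n i \<or> bar n i < p) else q \<le> n + 1)"

context
  fixes n i q :: nat and hi :: bool
  assumes i: "1 \<le> i" "i \<le> n"
begin

text \<open>The last claim is the delicate one. An exchange also alters the positions
  \<open>bar n i\<close> and \<open>bar n p\<close>, which may precede \<open>p\<close>; but before
  and after it their values lie in the half opposite to \<open>v p\<close> and \<open>z\<close>, so
  they never come between these two.\<close>

lemma chain_step:
  assumes v: "v \<in> signed_perms n" and p: "chain_range n i q hi p" "p < q"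
  defines "u \<equiv> v \<circ> reflection n (i, p)"
  shows "u \<in> signed_perms n" "u i = v p" "u p = v i"
    and "p < c \<Longrightarrow> c < q \<Longrightarrow> u c = v c"
    and "qedge n v (stage_root n i p) \<longleftrightarrow> chain_ok n hi (v i) (v p) \<and>
        (\<forall>w\<in>v ` {i<..<p}. \<not> cyc (v i) w (v p))"
    and "chain_ok n hi (v i) (v p) \<Longrightarrow> chain_ok n hi (v p) z \<Longrightarrow> i < c \<Longrightarrow> c < p \<Longrightarrow>
        cyc (v p) (u c) z \<longleftrightarrow> cyc (v p) (v c) z"
proof -
  have ip: "i < p" "p \<le> 2 * n" using p i by (auto simp: chain_range_def split: if_splits)
  note st = stage_step[OF i ip v, folded u_def]
  show "u \<in> signed_perms n" "u i = v p" "u p = v i" by (fact st(1-3))+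
  show "u c = v c" if "p < c" "c < q"
  proof -
    have "c \<noteq> bar n i" "c \<noteq> bar n p"
      using that p i ip by (auto simp: chain_range_def bar_def split: if_splits)
    then show ?thesis using st(6) that ip by auto
  qed
  have "p \<le> n \<or> p = bar n i \<longleftrightarrow> \<not> hi"
    using p i by (auto simp: chain_range_def bar_def split: if_splits)
  then show "qedge n v (stage_root n i p) \<longleftrightarrow> chain_ok n hi (v i) (v p) \<and>
        (\<forall>w\<in>v ` {i<..<p}. \<not> cyc (v i) w (v p))"
    using qedge_stage_root(1)[OF v i ip] by (auto simp: chain_ok_def)
  show "cyc (v p) (u c) z \<longleftrightarrow> cyc (v p) (v c) z"
    if ok: "chain_ok n hi (v i) (v p)" "chain_ok n hi (v p) z" and c: "i < c" "c < p"
  proof (cases "c = bar n i \<or> c = bar n p")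
    case False
    then show ?thesis using st(6)[of c] c by auto
  next
    case True
    then have hi: hi using p i c by (auto simp: chain_range_def bar_def split: if_splits)
    have L: "i \<in> letters n" "p \<in> letters n" using i ip by (auto simp: letters_def)
    have vL: "v (bar n i) = bar n (v i)" "v (bar n p) = bar n (v p)" "v i \<in> letters n" "v p \<in> letters n"
      using signed_permD(3,4)[OF v] L by auto
    have "v c \<le> n \<longleftrightarrow> \<not> v p \<le> n" "u c \<le> n \<longleftrightarrow> \<not> v p \<le> n"
      using True ok(1) hi vL st(4,5) by (auto simp: bar_less_iff chain_ok_def half_less_def)
    then show ?thesis using ok(2) hi by (auto simp: chain_ok_def half_less_def cyc_def)
  qed
qed

text \<open>At each position of the segment its value either lies cyclically between the current
  value and \<open>z\<close> or not, and by \<open>chain_dichotomy\<close> exactly one of moving and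
  staying keeps a reachable \<open>z\<close> reachable. Induction on the length of the segment gives
  existence and uniqueness together.\<close>

lemma chain_walk:
  assumes "v \<in> signed_perms n" "chain_range n i q hi p"
  shows "(\<exists>bs v'. stage_walk n i v [p..<q] bs v' \<and> v' i = z) \<longleftrightarrow> chain_reach n hi i p q v z"
    and "stage_walk n i v [p..<q] bs v1 \<Longrightarrow> stage_walk n i v [p..<q] bs' v2 \<Longrightarrow> v1 i = v2 i \<Longrightarrow> bs = bs'"
proof -
  have "((\<exists>bs v'. stage_walk n i v [p..<q] bs v' \<and> v' i = z) \<longleftrightarrow> chain_reach n hi i p q v z) \<and>
    (stage_walk n i v [p..<q] bs v1 \<longrightarrow> stage_walk n i v [p..<q] bs' v2 \<longrightarrow> v1 i = v2 i \<longrightarrow> bs = bs')"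
    for z bs bs' v1 v2
    using assms
  proof (induction "q - p" arbitrary: p v z bs bs' v1 v2)
    case 0
    then have "[p..<q] = []" "{p..<q} = {}" by auto
    moreover have "\<not> cyc (v i) w (v i)" for w by (auto simp: cyc_def)
    ultimately show ?case unfolding chain_reach_def by auto
  next
    case (Suc m)
    then have pq: "p < q" by simp
    have ip: "i < p" "p \<le> 2 * n"
      using Suc.prems pq i by (auto simp: chain_range_def split: if_splits)
    have rng: "chain_range n i q hi (Suc p)" using Suc.prems pq by (auto simp: chain_range_def split: if_splits)
    have m: "m = q - Suc p" using Suc.hyps(2) by simp
    define u where "u = v \<circ> reflection n (i, p)"
    note st = chain_step[OF Suc.prems pq, folded u_def]
    note IHv = Suc.hyps(1)[OF m Suc.prems(1) rng]
    note IHu = Suc.hyps(1)[OF m st(1) rng]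
    have inj: "v a = v b \<longleftrightarrow> a = b" for a b
      using signed_permD(2)[OF Suc.prems(1)] by (auto dest: injD)
    have upt: "[p..<q] = p # [Suc p..<q]" using pq by (simp add: upt_conv_Cons)
    have pqs: "{p..<q} = insert p {Suc p..<q}" using pq by auto
    let ?stay = "\<lambda>z. chain_reach n hi i (Suc p) q v z"
    let ?move = "\<lambda>z. qedge n v (stage_root n i p) \<and> chain_reach n hi i (Suc p) q u z"
    have img: "u ` {Suc p..<q} = v ` {Suc p..<q}" using st(4) by auto
    have nocyc: "\<not> cyc x w x" "\<not> cyc x x w" "\<not> cyc w x x" for x w by (auto simp: cyc_def)
    let ?I = "v ` {i<..<p}"
    have stay: "?stay z \<longleftrightarrow> (z = v i \<or> z \<in> v ` {Suc p..<q} \<and> chain_ok n hi (v i) z) \<and>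
        (\<forall>w\<in>?I. \<not> cyc (v i) w z) \<and> \<not> cyc (v i) (v p) z" for z
      unfolding chain_reach_def using ip by (auto simp: less_Suc_eq)
    have move: "?move z \<longleftrightarrow> chain_ok n hi (v i) (v p) \<and> (\<forall>w\<in>?I. \<not> cyc (v i) w (v p)) \<and>
        (z = v p \<or> z \<in> v ` {Suc p..<q} \<and> chain_ok n hi (v p) z) \<and>
        (\<forall>w\<in>?I. \<not> cyc (v p) w z) \<and> \<not> cyc (v p) (v i) z" for z
    proof (cases "z = v p")
      case True
      then show ?thesis unfolding chain_reach_def st(2,5) img using nocyc by auto
    next
      case False
      show ?thesis
      proof (cases "chain_ok n hi (v i) (v p) \<and> chain_ok n hi (v p) z")
        case True
        then have "(\<forall>c. i < c \<and> c < Suc p \<longrightarrow> \<not> cyc (v p) (u c) z) \<longleftrightarrow>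
            (\<forall>w\<in>?I. \<not> cyc (v p) w z) \<and> \<not> cyc (v p) (v i) z"
          using st(6)[of z] st(3) ip by (auto simp: less_Suc_eq)
        then show ?thesis unfolding chain_reach_def st(2,5) img using True False by blast
      next
        case False
        then show ?thesis unfolding chain_reach_def st(2,5) img using \<open>z \<noteq> v p\<close> by blast
      qed
    qed
    have key: "(?stay z \<or> ?move z \<longleftrightarrow> chain_reach n hi i p q v z) \<and> \<not> (?stay z \<and> ?move z)" for z
    proof -
      have R: "chain_reach n hi i p q v z \<longleftrightarrow> (z = v i \<or> z = v p \<and> chain_ok n hi (v i) z \<or>
          z \<in> v ` {Suc p..<q} \<and> chain_ok n hi (v i) z) \<and> (\<forall>w\<in>?I. \<not> cyc (v i) w z)"
        unfolding chain_reach_def pqs by auto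
      consider "z = v i" | "z = v p" | "z \<in> v ` {Suc p..<q}" |
        "z \<noteq> v i" "z \<noteq> v p" "z \<notin> v ` {Suc p..<q}" by blast
      then show ?thesis
      proof cases
        case 1
        then have "v i \<noteq> v p" "v i \<notin> v ` {Suc p..<q}" using inj ip by auto
        then show ?thesis unfolding stay move R using 1 nocyc by auto
      next
        case 2
        then have "v p \<noteq> v i" "v p \<notin> v ` {Suc p..<q}" using inj ip by auto
        then show ?thesis unfolding stay move R using 2 nocyc by auto
      next
        case 3
        then obtain c where c: "z = v c" "p < c" by auto
        have d: "v i \<noteq> v p" "v p \<noteq> z" "v i \<noteq> z" "v i \<notin> ?I" "v p \<notin> ?I" "z \<notin> ?I"
          using c ip inj by auto
        have e: "(z = v i) = False" "(z = v p) = False" "(z \<in> v ` {Suc p..<q}) = True"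
          using 3 d(1-3) by auto
        show ?thesis
          unfolding stay move R e simp_thms using chain_dichotomy[OF d, of n hi] by (rule conjI)
      next
        case 4
        then show ?thesis unfolding stay move R by blast
      qed
    qed
    have split: "stage_walk n i v [p..<q] bs v' \<longleftrightarrow>
        (\<exists>cs. bs = False # cs \<and> stage_walk n i v [Suc p..<q] cs v') \<or>
        (\<exists>cs. bs = True # cs \<and> qedge n v (stage_root n i p) \<and> stage_walk n i u [Suc p..<q] cs v')"
      for bs v'
      unfolding upt stage_walk_Cons[OF i ip] u_def ..
    have exv: "(\<exists>cs v'. stage_walk n i v [Suc p..<q] cs v' \<and> v' i = z) \<longleftrightarrow> ?stay z" for z
      using IHv by blast
    have exu: "(\<exists>cs v'. stage_walk n i u [Suc p..<q] cs v' \<and> v' i = z) \<longleftrightarrow>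
        chain_reach n hi i (Suc p) q u z" for z
      using IHu by blast
    have ex: "(\<exists>bs v'. stage_walk n i v [p..<q] bs v' \<and> v' i = z) \<longleftrightarrow> chain_reach n hi i p q v z"
    proof
      assume "\<exists>bs v'. stage_walk n i v [p..<q] bs v' \<and> v' i = z"
      then obtain bs v' where w: "stage_walk n i v [p..<q] bs v'" "v' i = z" by blast
      from w(1) have "?stay z \<or> ?move z"
        unfolding split using exv exu w(2) by blast
      then show "chain_reach n hi i p q v z" using key by blast
    next
      assume "chain_reach n hi i p q v z"
      then have "?stay z \<or> ?move z" using key by blast
      then show "\<exists>bs v'. stage_walk n i v [p..<q] bs v' \<and> v' i = z"
      proof
        assume "?stay z"
        then obtain cs v' where "stage_walk n i v [Suc p..<q] cs v'" "v' i = z" using exv by blast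
        then show ?thesis using split[of "False # cs" v'] by blast
      next
        assume "?move z"
        then obtain cs v' where "stage_walk n i u [Suc p..<q] cs v'" "v' i = z" using exu by blast
        then show ?thesis using split[of "True # cs" v'] \<open>?move z\<close> by blast
      qed
    qed
    moreover have "bs = bs'" if w: "stage_walk n i v [p..<q] bs v1" "stage_walk n i v [p..<q] bs' v2"
      and e: "v1 i = v2 i"
    proof -
      have no: False if "stage_walk n i v [Suc p..<q] cs w1" "qedge n v (stage_root n i p)"
        "stage_walk n i u [Suc p..<q] cs' w2" "w1 i = w2 i" for cs cs' w1 w2
      proof -
        have "?stay (w1 i)" using that(1) exv[of "w1 i"] by blast
        moreover have "?move (w1 i)" using that(2-4) exu[of "w1 i"] by auto
        ultimately show False using key[of "w1 i"] by blast
      qed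
      have same_v: "cs = cs'" if "stage_walk n i v [Suc p..<q] cs v1" "stage_walk n i v [Suc p..<q] cs' v2"
        for cs cs' using IHv that e by blast
      have same_u: "cs = cs'" if "stage_walk n i u [Suc p..<q] cs v1" "stage_walk n i u [Suc p..<q] cs' v2"
        for cs cs' using IHu that e by blast
      have no12: False if "stage_walk n i v [Suc p..<q] cs v1" "qedge n v (stage_root n i p)"
        "stage_walk n i u [Suc p..<q] cs' v2" for cs cs' using no[OF that e] .
      have no21: False if "stage_walk n i v [Suc p..<q] cs v2" "qedge n v (stage_root n i p)"
        "stage_walk n i u [Suc p..<q] cs' v1" for cs cs' using no[OF that e[symmetric]] .
      from w show ?thesis
        unfolding split
        using same_v same_u no12 no21 by blast
    qed
    ultimately show ?case by blast
  qed
  then show "(\<exists>bs v'. stage_walk n i v [p..<q] bs v' \<and> v' i = z) \<longleftrightarrow> chain_reach n hi i p q v z"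
    "stage_walk n i v [p..<q] bs v1 \<Longrightarrow> stage_walk n i v [p..<q] bs' v2 \<Longrightarrow> v1 i = v2 i \<Longrightarrow> bs = bs'"
    by blast+
qed

end

section \<open>Greedy assignments\<close>

text \<open>Beyond \<open>bar n i\<close> the value at \<open>i\<close> climbs within one half, and
  \<open>p\<close> receives the value that \<open>i\<close> gives up; hence the mirror position of
  \<open>p\<close> rises to the bar of that value. These mirror positions are visited downwards, and
  the last clause concerns those visited before \<open>a\<close>: if one with value in
  \<open>[bar n (v' i), v' a)\<close> was passed over, its bar was an illegally skipped value; if it
  was swapped in, no later mirror position can rise above its old value.\<close>

lemma walk_bump:
  assumes i: "1 \<le> i" "i \<le> n" and "v \<in> signed_perms n" "bar n i < p" "p \<le> 2 * n + 1"
    and "stage_walk n i v [p..<2 * n + 1] bs v'" and "1 \<le> a" "a \<le> bar n p" "v' a \<noteq> v a"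
  shows "bar n (v' i) \<le> v a \<and> v a < v' a \<and> v' a \<le> bar n (v i) \<and>
    (\<forall>b. a < b \<and> b \<le> bar n p \<longrightarrow> \<not> (bar n (v' i) \<le> v b \<and> v b < v' a))"
  using assms(3-9)
proof (induction "2 * n + 1 - p" arbitrary: p v bs)
  case 0
  then show ?case by simp
next
  case (Suc m)
  have m: "m = 2 * n + 1 - Suc p" using Suc.hyps(2) by simp
  have pq: "p < 2 * n + 1" using Suc.hyps(2) by simp
  have ip: "i < p" "p \<le> 2 * n" using Suc.prems(2) pq i by (auto simp: bar_def)
  have rng: "chain_range n i (2 * n + 1) True p" "chain_range n i (2 * n + 1) True (Suc p)"
    using Suc.prems(2) pq i by (auto simp: chain_range_def bar_def)
  define u where "u = v \<circ> reflection n (i, p)"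
  note st = chain_step[OF i Suc.prems(1) rng(1) pq, folded u_def]
  note ss = stage_step[OF i ip Suc.prems(1), folded u_def]
  have upt: "[p..<2 * n + 1] = p # [Suc p..<2 * n + 1]" using pq by (simp add: upt_conv_Cons)
  let ?b = "bar n p" and ?z = "v' i"
  have L: "i \<in> letters n" "p \<in> letters n" using i ip by (auto simp: letters_def)
  have b: "?b < i" "1 \<le> ?b" "bar n (Suc p) = ?b - 1" using Suc.prems(2) ip i by (auto simp: bar_def)
  have vL: "v ?b = bar n (v p)" "v p \<in> letters n" "v i \<in> letters n"
    using signed_permD(3,4)[OF Suc.prems(1)] L by auto
  have fixd: "v' ?b = w ?b" if "stage_walk n i w [Suc p..<2 * n + 1] cs v'" "w \<in> signed_perms n" for w cs
  proof (rule stage_walk_fixed[OF i that(2,1)])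
    show "?b \<notin> bar n ` set [Suc p..<2 * n + 1]" using ip by (auto simp: bar_def)
    show "?b \<notin> {i, bar n i}" "?b \<notin> set [Suc p..<2 * n + 1]" using b i ip by (auto simp: bar_def)
  qed (use ip in auto)
  have zL: "?z \<in> letters n"
    using stage_walk_signed[OF i Suc.prems(1,4)] ip L signed_permD(3) by fastforce
  from Suc.prems(4) consider cs where "stage_walk n i v [Suc p..<2 * n + 1] cs v'" |
    cs where "qedge n v (stage_root n i p)" "stage_walk n i u [Suc p..<2 * n + 1] cs v'"
    unfolding upt stage_walk_Cons[OF i ip] u_def by blast
  then show ?case
  proof cases
    case 1
    then have "a \<noteq> ?b" using fixd[OF 1 Suc.prems(1)] Suc.prems(7) by auto
    then have a: "a \<le> bar n (Suc p)" using Suc.prems(6) b by simp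
    have IH: "bar n ?z \<le> v a \<and> v a < v' a \<and> v' a \<le> bar n (v i) \<and>
        (\<forall>b. a < b \<and> b \<le> bar n (Suc p) \<longrightarrow> \<not> (bar n ?z \<le> v b \<and> v b < v' a))"
      by (rule Suc.hyps(1)[OF m Suc.prems(1) _ _ 1 Suc.prems(5) a Suc.prems(7)]) (use Suc.prems(2) pq in auto)
    have reach: "chain_reach n True i (Suc p) (2 * n + 1) v ?z"
      using chain_walk(1)[OF i Suc.prems(1) rng(2)] 1 by blast
    have "\<not> (bar n ?z \<le> v ?b \<and> v ?b < v' a)"
    proof
      assume H: "bar n ?z \<le> v ?b \<and> v ?b < v' a"
      then have "v i < v p" "v p \<le> ?z"
        using IH vL zL bar_less_iff[of "v p" n "v i"] bar_less_iff[of ?z n "v p"] by auto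
      moreover have "?z \<noteq> v p"
        using reach \<open>v i < v p\<close> inj_eq[OF signed_permD(2)[OF Suc.prems(1)]]
        unfolding chain_reach_def by auto
      ultimately have "cyc (v i) (v p) ?z" by (auto simp: cyc_def)
      then show False using reach ip unfolding chain_reach_def by auto
    qed
    then show ?thesis using IH b by (metis Suc_pred' le_SucE less_eq_Suc_le One_nat_def)
  next
    case 2
    have edge: "half_less n (v i) (v p)" using 2(1) st(5) by (auto simp: chain_ok_def)
    have "chain_reach n True i (Suc p) (2 * n + 1) u ?z"
      using chain_walk(1)[OF i st(1) rng(2)] 2(2) by blast
    then have le: "v p \<le> ?z" unfolding chain_reach_def st(2) by (auto simp: chain_ok_def half_less_def)
    show ?thesis
    proof (cases "a = ?b")
      case True
      have "v' a = bar n (v i)" using fixd[OF 2(2) st(1)] ss(5) True by simp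
      then show ?thesis using True vL zL edge le by (auto simp: bar_less_iff half_less_def)
    next
      case False
      then have a: "a \<le> bar n (Suc p)" using Suc.prems(6) b by simp
      have ub: "u c = v c" if "1 \<le> c" "c < ?b" for c
        using ss(6)[of c] that b ip i by (auto simp: bar_def)
      have ne: "v' a \<noteq> u a" using ub Suc.prems(5-7) False by simp
      have IH: "bar n ?z \<le> u a \<and> u a < v' a \<and> v' a \<le> bar n (u i) \<and>
          (\<forall>b. a < b \<and> b \<le> bar n (Suc p) \<longrightarrow> \<not> (bar n ?z \<le> u b \<and> u b < v' a))"
        by (rule Suc.hyps(1)[OF m st(1) _ _ 2(2) Suc.prems(5) a ne]) (use Suc.prems(2) pq in auto)
      have lt: "bar n (v p) < bar n (v i)" using edge vL by (auto simp: bar_less_iff half_less_def)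
      have "\<not> (bar n ?z \<le> v c \<and> v c < v' a)" if "a < c" "c \<le> ?b" for c
      proof (cases "c = ?b")
        case True
        then show ?thesis using IH st(2) vL by auto
      next
        case False
        then show ?thesis using IH ub[of c] that Suc.prems(5) b by auto
      qed
      then show ?thesis using IH ub[of a] st(2) lt Suc.prems(5,6) False by auto
    qed
  qed
qed

definition transversal :: "nat \<Rightarrow> nat set \<Rightarrow> bool" where
  "transversal n A \<longleftrightarrow> A \<subseteq> letters n \<and> (\<forall>w\<in>A. bar n w \<notin> A)"

text \<open>The half-open cyclic interval from \<open>x\<close> to \<open>y\<close>: the letters
  passed over by a search that starts at \<open>x\<close> and stops at \<open>y\<close>.\<close>

definition cyc_in :: "nat \<Rightarrow> nat \<Rightarrow> nat \<Rightarrow> bool" where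
  "cyc_in x w y \<longleftrightarrow> w = x \<and> x \<noteq> y \<or> cyc x w y"

text \<open>
  A greedy assignment sends the starting values \<open>x 1\<close>, \<open>x 2\<close>, \<open>\<dots>\<close> in this order to the cyclically
  first element of \<open>A\<close> that is still free; the upper bound \<open>m\<close> is exclusive.
\<close>

definition greedy :: "nat set \<Rightarrow> (nat \<Rightarrow> nat) \<Rightarrow> nat \<Rightarrow> (nat \<Rightarrow> nat) \<Rightarrow> bool" where
  "greedy A x m h \<longleftrightarrow> inj_on h {1..<m} \<and> h ` {1..<m} \<subseteq> A \<and>
     (\<forall>a\<in>{1..<m}. \<forall>w\<in>A. cyc_in (x a) w (h a) \<longrightarrow> w \<in> h ` {1..<a})"

lemma inj_on_not_before:
  assumes "inj_on h {1..<m}" "a \<in> {1..<m}"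
  shows "h a \<notin> h ` {1..<a :: nat}"
proof
  assume "h a \<in> h ` {1..<a}"
  then obtain x where x: "h a = h x" "x \<in> {1..<a}" by blast
  then have "a = x" using inj_onD[OF assms(1) x(1) assms(2)] assms(2) by simp
  then show False using x by simp
qed

text \<open>Count the pairs \<open>x\<close>, \<open>bar n x\<close> with \<open>x \<in> M\<close>.
  Every pair occurs as a starting value, so at least \<open>card M\<close> positions start in them.
  Those outside \<open>R\<close> are assigned to distinct pairs, because the target is a
  transversal, and to none of the pairs of \<open>Z\<close>. Hence \<open>card M - card R\<close> is
  at most \<open>card M - card Z\<close>.\<close>

lemma pigeonhole_transversal:
  fixes v h :: "nat \<Rightarrow> nat" and m n :: nat
  assumes A: "transversal n A" and h: "inj_on h {1..<m}" "h ` {1..<m} \<subseteq> A"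
    and M: "M \<subseteq> letters n" "M \<inter> bar n ` M = {}"
    and cover: "\<And>x. x \<in> M \<Longrightarrow> \<exists>a\<in>{1..<m}. v a = x \<or> v a = bar n x"
    and land: "\<And>a. a \<in> {1..<m} - R \<Longrightarrow> v a \<in> M \<union> bar n ` M \<Longrightarrow>
      h a \<in> M \<union> bar n ` M \<and> (\<forall>x\<in>Z. h a \<noteq> x \<and> h a \<noteq> bar n x)"
    and Z: "Z \<subseteq> M" and R: "finite R"
  shows "card Z \<le> card R"
proof -
  define f where "f x = (if x \<in> M then x else bar n x)" for x
  define P where "P = {a \<in> {1..<m}. v a \<in> M \<union> bar n ` M}"
  have fin: "finite M" using M finite_letters by (rule_tac finite_subset)
  moreover have "finite P" unfolding P_def by (rule finite_subset[of _ "{1..<m}"]) auto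
  moreover have "finite Z" using Z fin by (rule finite_subset)
  ultimately have fin: "finite M" "finite P" "finite Z" by auto
  have fbar: "f (bar n x) = x" if "x \<in> M" for x
    using that M by (auto simp: f_def)
  have "M \<subseteq> (\<lambda>a. f (v a)) ` P"
  proof
    fix x assume x: "x \<in> M"
    then obtain a where a: "a \<in> {1..<m}" "v a = x \<or> v a = bar n x" using cover by blast
    have "f (v a) = x" using a(2)
    proof
      assume "v a = x"
      then show ?thesis using x by (simp add: f_def)
    next
      assume "v a = bar n x"
      then show ?thesis using fbar[OF x] by simp
    qed
    moreover have "a \<in> P" using a x by (auto simp: P_def)
    ultimately have "a \<in> P" "f (v a) = x" by auto
    then show "x \<in> (\<lambda>a. f (v a)) ` P" by blast
  qed
  then have "card M \<le> card P" using fin by (meson surj_card_le)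
  moreover have "card P \<le> card (P - R) + card R"
    using card_Un_le[of "P - R" R] card_mono[of "(P - R) \<union> R" P] fin R by auto
  moreover have "card (P - R) \<le> card (M - Z)"
  proof (rule card_inj_on_le)
    show "(\<lambda>a. f (h a)) ` (P - R) \<subseteq> M - Z"
    proof
      fix y assume "y \<in> (\<lambda>a. f (h a)) ` (P - R)"
      then obtain a where a: "a \<in> P - R" "y = f (h a)" by blast
      have l: "h a \<in> M \<union> bar n ` M" "\<forall>x\<in>Z. h a \<noteq> x \<and> h a \<noteq> bar n x"
        using land[of a] a(1) by (auto simp: P_def)
      show "y \<in> M - Z"
      proof (cases "h a \<in> M")
        case True
        then show ?thesis using l a by (auto simp: f_def)
      next
        case False
        then obtain x where "x \<in> M" "h a = bar n x" using l by blast
        then show ?thesis using l a fbar by auto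
      qed
    qed
    show "inj_on (\<lambda>a. f (h a)) (P - R)"
    proof (rule inj_onI)
      fix a b assume ab: "a \<in> P - R" "b \<in> P - R" "f (h a) = f (h b)"
      have hA: "h a \<in> A" "h b \<in> A" using ab h by (auto simp: P_def)
      then have "h a \<noteq> bar n (h b)" "h b \<noteq> bar n (h a)" using A by (auto simp: transversal_def)
      moreover have "h a \<in> letters n" "h b \<in> letters n" using hA A by (auto simp: transversal_def)
      ultimately have "h a = h b" using ab(3) by (auto simp: f_def bar_inj split: if_splits)
      then show "a = b" using h(1) ab by (auto simp: P_def inj_on_def)
    qed
  qed (use fin in auto)
  moreover have "card (M - Z) = card M - card Z" "card Z \<le> card M"
    using Z fin by (auto simp: card_Diff_subset card_mono)
  ultimately show ?thesis by linarith
qed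

lemma not_cyc_in_le: "\<not> cyc_in x z h \<Longrightarrow> x \<le> z \<Longrightarrow> h \<noteq> z \<Longrightarrow> x \<le> h \<and> h < z"
  by (auto simp: cyc_in_def cyc_def)

text \<open>The conclusion of \<open>walk_bump\<close> for a complete upper segment, whose mirror
  positions are \<open>1, ..., i - 1\<close>; \<open>z\<close> is the final value at
  \<open>i\<close>.\<close>

definition bumped :: "nat \<Rightarrow> nat \<Rightarrow> nat \<Rightarrow> (nat \<Rightarrow> nat) \<Rightarrow> (nat \<Rightarrow> nat) \<Rightarrow> bool" where
  "bumped n i z v v' \<longleftrightarrow> (\<forall>a\<in>{1..<i}. v' a \<noteq> v a \<longrightarrow>
     bar n z \<le> v a \<and> v a < v' a \<and> v' a \<le> bar n (v i) \<and>
     (\<forall>b. a < b \<and> b < i \<longrightarrow> \<not> (bar n z \<le> v b \<and> v b < v' a)))"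

text \<open>
  Otherwise every position other than \<open>a\<close> whose value lies in \<open>[bar w, z]\<close> or in \<open>[bar z, w]\<close> is
  assigned a letter of these two intervals, but \<open>w\<close>, \<open>z\<close> and their bars are not available, so there
  are too few letters.
\<close>

lemma bumped_skips_taken:
  assumes i: "1 \<le> i" "i \<le> n" and v: "v \<in> signed_perms n"
    and hl: "half_less n (v i) z" and z: "z \<in> letters n"
    and gap: "\<And>c. i \<le> c \<Longrightarrow> c \<le> bar n i \<Longrightarrow> \<not> (v i < v c \<and> v c \<le> z)"
    and bump: "bumped n i z v v'"
    and A: "transversal n A" "z \<in> A"
    and h: "greedy A x i h" "x = v \<or> x = v'" "z \<notin> h ` {1..<i}"
    and a: "a \<in> {1..<i}" "v' a \<noteq> v a" and w: "w \<in> A" "v a \<le> w" "w < v' a"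
  shows "w \<in> h ` {1..<a}"
proof (rule ccontr)
  assume wn: "w \<notin> h ` {1..<a}"
  let ?y = "v i" and ?M = "{bar n w..z}"
  have L: "w \<in> letters n" "?y \<in> letters n"
    using w A signed_permD(3)[OF v] i by (auto simp: transversal_def letters_def)
  note bmp = bump[unfolded bumped_def, rule_format]
  have b1: "bar n z \<le> v a" "v a < v' a" "v' a \<le> bar n ?y" using bmp[OF a] by auto
  have yw: "?y < bar n w" "bar n w \<le> z" "w < bar n ?y" "bar n z \<le> w"
    using b1 w L z bar_less_iff[of w n ?y] bar_less_iff[of ?y n w] bar_less_iff[of z n w]
      bar_less_iff[of w n z] by auto
  have M: "?M \<subseteq> letters n" using L z yw by (auto simp: letters_def)
  have barM: "bar n ` ?M = {bar n z..w}"
  proof (intro set_eqI iffI)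
    fix c assume "c \<in> bar n ` ?M"
    then show "c \<in> {bar n z..w}"
      using M L z by (auto simp: bar_def letters_def)
  next
    fix c assume c: "c \<in> {bar n z..w}"
    then have "c = bar n (bar n c)" "bar n c \<in> ?M" using L z by (auto simp: bar_def letters_def)
    then show "c \<in> bar n ` ?M" by blast
  qed
  have halves: "(c \<le> n \<longleftrightarrow> ?y \<le> n)" if "c \<in> ?M" for c
    using that yw hl by (auto simp: half_less_def)
  have halves': "\<not> (c \<le> n \<longleftrightarrow> ?y \<le> n)" if "bar n z \<le> c" "c < bar n ?y" for c
    using that hl z L by (auto simp: half_less_def bar_def letters_def)
  have half_bar: "\<not> (c \<le> n \<longleftrightarrow> ?y \<le> n)" if "c \<in> bar n ` ?M" for c
    using that halves' yw unfolding barM by auto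
  have disj: "?M \<inter> bar n ` ?M = {}" using halves half_bar by blast
  have hx: "\<not> cyc_in (x b) c (h b)" if "b \<in> {1..<i}" "c \<in> A" "c \<notin> h ` {1..<b}" for b c
    using h(1) that unfolding greedy_def by blast
  have hA: "h b \<in> A" if "b \<in> {1..<i}" for b using h(1) that unfolding greedy_def by blast
  have tr: "c \<in> A \<Longrightarrow> bar n c \<notin> A" for c using A(1) by (auto simp: transversal_def)
  have "card {bar n w, z} \<le> card {a}"
  proof (rule pigeonhole_transversal[where M = ?M and v = v, OF A(1)])
    show "inj_on h {1..<i}" "h ` {1..<i} \<subseteq> A" using h(1) by (auto simp: greedy_def)
    show "\<exists>b\<in>{1..<i}. v b = c \<or> v b = bar n c" if c: "c \<in> ?M" for c
    proof -
      obtain d where d: "d \<in> letters n" "v d = c"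
        using c M permutes_image[OF signed_permD(1)[OF v]] by (metis imageE subsetD)
      show ?thesis
      proof (cases "d < i")
        case True
        then show ?thesis using d by (auto simp: letters_def)
      next
        case False
        have "\<not> d \<le> bar n i" using gap[of d] False c d yw by auto
        then have "bar n d \<in> {1..<i}" using d by (auto simp: letters_def bar_def)
        then show ?thesis using signed_permD(4)[OF v d(1)] d(2) by metis
      qed
    qed
    show "h b \<in> ?M \<union> bar n ` ?M \<and> (\<forall>x\<in>{bar n w, z}. h b \<noteq> x \<and> h b \<noteq> bar n x)"
      if b: "b \<in> {1..<i} - {a}" and vb: "v b \<in> ?M \<union> bar n ` ?M" for b
    proof -
      have bi: "b \<in> {1..<i}" using b by auto
      have hb: "h b \<noteq> z" "h b \<noteq> bar n z" "h b \<noteq> bar n w"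
        using h(3) bi hA[OF bi] tr A(2) w(1) by auto
      show ?thesis
      proof (cases "v b \<in> ?M")
        case True
        \<comment> \<open>A bumped position starts in the half opposite to \<open>?M\<close>. So
          this one is unchanged, and \<open>x b = v b\<close> for either choice of
          \<open>x\<close>.\<close>
        have "v' b = v b"
        proof (rule ccontr)
          assume "v' b \<noteq> v b"
          then have "bar n z \<le> v b" "v b < bar n ?y" using bmp[OF bi] by auto
          then show False using halves[OF True] halves' by blast
        qed
        then have "x b = v b" using h(2) by auto
        moreover have "z \<notin> h ` {1..<b}" using h(3) bi by auto
        ultimately have "v b \<le> h b" "h b < z"
          using not_cyc_in_le[of "v b" z "h b"] hx[OF bi A(2)] True hb by auto
        then have "h b \<in> ?M" using True by auto
        moreover have "w \<in> bar n ` ?M" unfolding barM using yw by auto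
        ultimately have "h b \<in> ?M" "h b \<noteq> w" using disj by blast+
        then show ?thesis using hb L by simp
      next
        case False
        then have vb': "bar n z \<le> v b" "v b \<le> w" using vb unfolding barM by auto
        \<comment> \<open>The last clause of \<open>bumped\<close> at \<open>a\<close>: no position
          between \<open>a\<close> and \<open>i\<close> starts in \<open>[bar n z, v' a)\<close>,
          which contains \<open>v b\<close> because \<open>v b \<le> w < v' a\<close>.\<close>
        have "\<not> a < b" using bmp[OF a] vb' w bi by (meson atLeastLessThan_iff le_less_trans)
        then have ba: "b < a" using b by auto
        have xb: "bar n z \<le> x b" "x b \<le> w"
        proof -
          have "bar n z \<le> v' b \<and> v' b \<le> w"
          proof (cases "v' b = v b")
            case False
            then have "v b < v' b" "\<not> (bar n z \<le> v a \<and> v a < v' b)"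
              using bmp[OF bi False] ba a by auto
            then show ?thesis using b1 vb' w by auto
          qed (use vb' in auto)
          then show "bar n z \<le> x b" "x b \<le> w" using h(2) vb' by auto
        qed
        have wb: "w \<notin> h ` {1..<b}" "h b \<noteq> w" using wn ba b by auto
        then have "x b \<le> h b" "h b < w"
          using not_cyc_in_le[of "x b" w "h b"] hx[OF bi w(1)] xb by auto
        then have "h b \<in> bar n ` ?M" using xb unfolding barM by auto
        then show ?thesis using hb wb L by auto
      qed
    qed
  qed (use M disj yw in auto)
  moreover have "bar n w \<noteq> z" using tr w(1) A(2) by auto
  ultimately show False by simp
qed

text \<open>Raising a start from \<open>v a\<close> to \<open>v' a\<close> affects the search only
  through letters of \<open>A\<close> in \<open>[v a, v' a)\<close>. These are already taken by
  \<open>bumped_skips_taken\<close>, which holds for an assignment that is greedy for either of the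
  two starting configurations.\<close>

lemma greedy_bumped:
  assumes i: "1 \<le> i" "i \<le> n" and v: "v \<in> signed_perms n"
    and hl: "z = v i \<or> half_less n (v i) z" and z: "z \<in> letters n"
    and gap: "\<And>c. i \<le> c \<Longrightarrow> c \<le> bar n i \<Longrightarrow> \<not> (v i < v c \<and> v c \<le> z)"
    and bump: "bumped n i z v v'"
    and A: "transversal n A" "z \<in> A" and zh: "z \<notin> h ` {1..<i}"
  shows "greedy A v i h \<longleftrightarrow> greedy A v' i h"
proof (cases "z = v i")
  case True
  have "v' a = v a" if "a \<in> {1..<i}" for a
    using bump that True unfolding bumped_def by force
  then show ?thesis unfolding greedy_def by auto
next
  case False
  then have hl: "half_less n (v i) z" using hl by simp
  have skip: "w \<in> h ` {1..<a}"
    if "greedy A x i h" "x = v \<or> x = v'" "a \<in> {1..<i}" "v' a \<noteq> v a" "w \<in> A" "v a \<le> w" "w < v' a"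
    for x a w
    by (rule bumped_skips_taken[OF i v hl z gap bump A that(1,2) zh that(3-7)])
  have lt: "v a < v' a" if "a \<in> {1..<i}" "v' a \<noteq> v a" for a
    using bump that unfolding bumped_def by blast
  show ?thesis
  proof
    assume g: "greedy A v i h"
    have inj: "inj_on h {1..<i}" and im: "h ` {1..<i} \<subseteq> A" using g by (auto simp: greedy_def)
    have "w \<in> h ` {1..<a}" if a: "a \<in> {1..<i}" and w: "w \<in> A" "cyc_in (v' a) w (h a)" for a w
    proof (cases "v' a = v a")
      case True
      then show ?thesis using g a w unfolding greedy_def by auto
    next
      case False
      have "h a \<notin> h ` {1..<a}" using inj_on_not_before[OF inj a] .
      then have "\<not> (v a \<le> h a \<and> h a < v' a)" using skip[OF g _ a False, of "h a"] im a by blast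
      then have "cyc_in (v a) w (h a)" using w(2) lt[OF a False] by (auto simp: cyc_in_def cyc_def)
      then show ?thesis using g a w unfolding greedy_def by auto
    qed
    then show "greedy A v' i h" using inj im by (auto simp: greedy_def)
  next
    assume g: "greedy A v' i h"
    have inj: "inj_on h {1..<i}" and im: "h ` {1..<i} \<subseteq> A" using g by (auto simp: greedy_def)
    have "w \<in> h ` {1..<a}" if a: "a \<in> {1..<i}" and w: "w \<in> A" "cyc_in (v a) w (h a)" for a w
    proof (cases "v' a = v a")
      case True
      then show ?thesis using g a w unfolding greedy_def by auto
    next
      case False
      show ?thesis
      proof (cases "v a \<le> w \<and> w < v' a")
        case True
        then show ?thesis using skip[OF g _ a False w(1)] by blast
      next
        case nin: False
        then have "cyc_in (v' a) w (h a)" using w(2) lt[OF a False] by (auto simp: cyc_in_def cyc_def)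
        then show ?thesis using g a w unfolding greedy_def by auto
      qed
    qed
    then show "greedy A v i h" using inj im by (auto simp: greedy_def)
  qed
qed

text \<open>By induction the same letters are free at \<open>a\<close>, and of two different free
  letters one is met strictly first.\<close>

lemma greedy_unique:
  assumes "greedy A x m h" "greedy A x m g" "a \<in> {1..<m}"
  shows "h a = g a"
  using assms(3)
proof (induction a rule: less_induct)
  case (less a)
  have eq: "h ` {1..<a} = g ` {1..<a}"
    using less by (auto intro!: image_cong)
  have nin: "h a \<notin> h ` {1..<a}" "g a \<notin> g ` {1..<a}"
    using assms(1,2) inj_on_not_before[of h m a] inj_on_not_before[of g m a] less.prems
    by (simp_all add: greedy_def)
  have "h a \<in> A" "g a \<in> A" using assms(1,2) less.prems by (auto simp: greedy_def)
  moreover have "cyc_in (x a) w (h a) \<longrightarrow> w \<in> h ` {1..<a}" "cyc_in (x a) w (g a) \<longrightarrow> w \<in> g ` {1..<a}"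
    if "w \<in> A" for w
    using assms(1,2) less.prems that unfolding greedy_def by blast+
  ultimately have "\<not> cyc_in (x a) (h a) (g a)" "\<not> cyc_in (x a) (g a) (h a)"
    using nin eq by auto
  then show ?case by (auto simp: cyc_in_def cyc_def)
qed

lemma cyc_first:
  assumes "finite S" "S \<noteq> {}"
  shows "\<exists>y\<in>S. \<forall>w\<in>S. \<not> cyc_in x w (y :: nat)"
proof (cases "\<exists>w\<in>S. x \<le> w")
  case True
  let ?T = "{w \<in> S. x \<le> w}"
  have T: "finite ?T" "?T \<noteq> {}" using assms True by auto
  have "Min ?T \<in> ?T" using Min_in[OF T] .
  moreover have "Min ?T \<le> w" if "w \<in> ?T" for w using Min_le[OF T(1) that] .
  ultimately have "\<forall>w\<in>S. \<not> cyc_in x w (Min ?T)"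
    by (fastforce simp: cyc_in_def cyc_def)
  then show ?thesis using \<open>Min ?T \<in> ?T\<close> by blast
next
  case False
  have "Min S \<in> S" "\<And>w. w \<in> S \<Longrightarrow> Min S \<le> w" using assms by auto
  then have "\<forall>w\<in>S. \<not> cyc_in x w (Min S)"
    using False by (fastforce simp: cyc_in_def cyc_def)
  then show ?thesis using \<open>Min S \<in> S\<close> by blast
qed

lemma greedy_exists:
  assumes "finite A" "m \<le> card A + 1"
  shows "\<exists>h. greedy A x m h"
  using assms(2)
proof (induction m)
  case 0
  then show ?case by (auto simp: greedy_def)
next
  case (Suc m)
  then obtain h where h: "greedy A x m h" by auto
  show ?case
  proof (cases "m = 0")
    case True
    then show ?thesis by (auto simp: greedy_def)
  next
    case False
    have "card (h ` {1..<m}) = m - 1" using h by (simp add: greedy_def card_image)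
    then have "card (A - h ` {1..<m}) > 0"
      using Suc.prems False h assms(1) by (subst card_Diff_subset) (auto simp: greedy_def)
    then have "finite (A - h ` {1..<m})" "A - h ` {1..<m} \<noteq> {}" by (auto simp: card_gt_0_iff)
    from cyc_first[OF this, of "x m"] obtain y where
      y: "y \<in> A - h ` {1..<m}" "\<forall>w\<in>A - h ` {1..<m}. \<not> cyc_in (x m) w y" by blast
    define g where "g = h(m := y)"
    have gh: "g a = h a" if "a < m" for a using that by (simp add: g_def)
    have img: "g ` {1..<a} = h ` {1..<a}" if "a \<le> m" for a
      using that gh by (auto intro!: image_cong)
    have ins: "{1..<Suc m} = insert m {1..<m}" using False by auto
    have "inj_on g {1..<Suc m}"
      unfolding ins using h y img[of m] by (auto simp: greedy_def g_def inj_on_def)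
    moreover have "g ` {1..<Suc m} \<subseteq> A"
      unfolding ins image_insert img[OF order.refl] using h y by (auto simp: greedy_def g_def)
    moreover have "w \<in> g ` {1..<a}" if "a \<in> {1..<Suc m}" "w \<in> A" "cyc_in (x a) w (g a)" for a w
    proof (cases "a = m")
      case True
      then show ?thesis using y that img[of m] by (auto simp: g_def)
    next
      case ne: False
      then have "a \<in> {1..<m}" using that by auto
      then show ?thesis using h that gh[of a] img[of a] unfolding greedy_def by auto
    qed
    ultimately show ?thesis unfolding greedy_def by blast
  qed
qed

section \<open>The stages of a block\<close>

text \<open>As \<open>x\<close> is not strictly between \<open>a\<close> and \<open>y\<close>, going
  from \<open>x\<close> to \<open>a\<close> and on to \<open>y\<close> does not pass
  \<open>x\<close> again, so the two parts and \<open>a\<close> cover the interval from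
  \<open>x\<close> to \<open>y\<close>.\<close>

lemma cyc_compose:
  assumes "\<not> cyc x w a" "\<not> cyc a w y" "\<not> cyc a x y" "w \<noteq> a"
  shows "\<not> cyc x w y"
  using assms unfolding cyc_def by linarith

lemma cyc_extend:
  assumes "cyc x w a \<or> cyc a w y" "\<not> cyc a x y" "a \<noteq> y" "x \<noteq> y"
  shows "cyc x w y"
  using assms unfolding cyc_def by linarith

text \<open>
  The values occurring in the first three segments of stage \<open>i\<close>: \<open>X\<close> is the set of values at the
  positions \<open>i, k+1, \<dots>, n\<close>, \<open>F\<close> the set of values at \<open>i+1, \<dots>, k\<close>, \<open>x\<close> the initial value at
  \<open>i\<close>, \<open>y\<^sub>1\<close> its value after the first segment, and \<open>b\<close> tells whether the sign change at
  \<open>i\<close> is performed.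
\<close>

definition tail_reach :: "nat \<Rightarrow> nat set \<Rightarrow> nat set \<Rightarrow> nat \<Rightarrow> nat \<Rightarrow> bool" where
  "tail_reach n F E y2 y \<longleftrightarrow> (y = y2 \<or> y \<in> bar n ` E \<and> half_less n y2 y) \<and> (\<forall>w\<in>F \<union> E. \<not> cyc y2 w y)"

definition lower_reach ::
  "nat \<Rightarrow> nat set \<Rightarrow> nat set \<Rightarrow> nat \<Rightarrow> bool \<Rightarrow> nat \<Rightarrow> nat \<Rightarrow> bool" where
  "lower_reach n F X x b y1 y \<longleftrightarrow> y1 \<in> X \<and> (\<forall>w\<in>F. \<not> cyc x w y1) \<and>
    (if b then (\<forall>w\<in>F \<union> bar n ` F \<union> (X - {y1}) \<union> bar n ` (X - {y1}). \<not> cyc y1 w (bar n y1)) \<and>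
        tail_reach n F (X - {y1}) (bar n y1) y
     else tail_reach n F (X - {y1}) y1 y)"

context
  fixes n :: nat and F X :: "nat set" and x :: nat
  assumes X: "transversal n X" "x \<in> X" and F: "F \<subseteq> letters n" "F \<inter> (X \<union> bar n ` X) = {}"
begin

lemma transversal_X: "a \<in> X \<Longrightarrow> a \<in> letters n" "a \<in> X \<Longrightarrow> bar n a \<notin> X" "a \<in> X \<Longrightarrow> b \<in> X \<Longrightarrow> a \<noteq> bar n b"
  using X(1) by (auto simp: transversal_def)

lemma bar_half: "a \<in> letters n \<Longrightarrow> bar n a \<le> n \<longleftrightarrow> \<not> a \<le> n"
  by (auto simp: bar_def letters_def)

text \<open>No segment passes a letter of \<open>F\<close>. The segments are joined by
  \<open>cyc_compose\<close>, where it has to be checked that neither the sign change nor the tail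
  passes the start \<open>x\<close>; this holds because \<open>x\<close> is an element of
  \<open>X\<close> and so itself occurs among the obstacles, unless it equals
  \<open>y1\<close>.\<close>

lemma lower_reach_sound:
  assumes "lower_reach n F X x b y1 y"
  shows "y \<in> X \<union> bar n ` X" "w \<in> F \<Longrightarrow> \<not> cyc x w y"
proof -
  define y2 where "y2 = (if b then bar n y1 else y1)"
  have y1: "y1 \<in> X" "\<And>w. w \<in> F \<Longrightarrow> \<not> cyc x w y1" and t: "tail_reach n F (X - {y1}) y2 y"
    using assms by (auto simp: lower_reach_def y2_def split: if_splits)
  show "y \<in> X \<union> bar n ` X" using t y1(1) by (auto simp: tail_reach_def y2_def split: if_splits)
  show "\<not> cyc x w y" if w: "w \<in> F"
  proof -
    have wn: "w \<noteq> y1" "w \<noteq> bar n y1" using F(2) w y1(1) by auto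
    have 2: "\<not> cyc x w y2"
    proof (cases b)
      case True
      have "\<not> cyc y1 x (bar n y1)"
        using True assms X(2) by (cases "x = y1") (auto simp: lower_reach_def cyc_def)
      moreover have "\<not> cyc y1 w (bar n y1)" using True assms w by (auto simp: lower_reach_def)
      ultimately show ?thesis using cyc_compose[OF y1(2)[OF w]] wn True by (auto simp: y2_def)
    qed (use y1 w in \<open>auto simp: y2_def\<close>)
    show ?thesis
    proof (cases "y = y2")
      case False
      then have hl: "half_less n y2 y" using t by (auto simp: tail_reach_def)
      have "\<not> cyc y2 x y"
      proof (cases "x = y1")
        case True
        then show ?thesis using hl bar_half[OF transversal_X(1)[OF y1(1)]]
          by (auto simp: y2_def cyc_def half_less_def split: if_splits)
      next
        case False
        then show ?thesis using t X(2) by (auto simp: tail_reach_def)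
      qed
      moreover have "\<not> cyc y2 w y" using t w by (auto simp: tail_reach_def)
      moreover have "w \<noteq> y2" using wn by (auto simp: y2_def)
      ultimately show ?thesis using cyc_compose[OF 2] by blast
    qed (use 2 in simp)
  qed
qed

text \<open>A letter of \<open>X\<close> is reached in the first segment. Any other \<open>y\<close>
  is the bar of an element of \<open>X\<close>, and the tail climbs within one half only, so it is
  entered from the largest element of \<open>X\<close> below \<open>y\<close> in that half. If there
  is none, the sign is changed at the largest letter of the other half that occurs, up to bars, in
  \<open>X\<close>; this letter lies in \<open>X\<close>, since otherwise its bar would be an
  element of \<open>C\<close>.\<close>

lemma lower_reach_complete:
  assumes y: "y \<in> X \<union> bar n ` X" and nc: "\<And>w. w \<in> F \<Longrightarrow> \<not> cyc x w y"
  shows "\<exists>b y1. lower_reach n F X x b y1 y"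
proof (cases "y \<in> X")
  case True
  then have "lower_reach n F X x False y y"
    using nc by (auto simp: lower_reach_def tail_reach_def cyc_def)
  then show ?thesis by blast
next
  case yX: False
  then obtain e where e: "e \<in> X" "y = bar n e" using y by blast
  have eL: "e \<in> letters n" "y \<in> letters n" "bar n y = e" using e transversal_X bar_letters by auto
  have xy: "x \<noteq> y" using yX X(2) by blast
  have ext: False if "cyc x w a \<or> cyc a w y" "\<not> cyc a x y" "a \<noteq> y" "w \<in> F" for a w
    using cyc_extend[OF that(1-3) xy] nc[OF that(4)] by blast
  have finX: "finite X" using X(1) finite_letters by (auto simp: transversal_def intro: finite_subset)
  define C where "C = {c \<in> X. half_less n c y}"
  show ?thesis
  proof (cases "C = {}")
    case False
    define y1 where "y1 = Max C"
    have finC: "finite C" using finX by (simp add: C_def)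
    have y1: "y1 \<in> X" "y1 < y" "y1 \<le> n \<longleftrightarrow> y \<le> n"
      using Max_in[OF finC False] by (auto simp: y1_def C_def half_less_def)
    have top: "c \<le> y1 \<or> y \<le> c" if "c \<in> X" for c
    proof (rule ccontr)
      assume H: "\<not> (c \<le> y1 \<or> y \<le> c)"
      then have "c \<in> C" using that y1 by (auto simp: C_def half_less_def)
      then show False using Max_ge[OF finC] H by (auto simp: y1_def)
    qed
    have nx: "\<not> cyc y1 c y" if "c \<in> X" for c using top[OF that] y1(2) by (auto simp: cyc_def)
    have "e \<noteq> y1" using y1 e bar_half[OF eL(1)] by auto
    then have "lower_reach n F X x False y1 y"
      using y1 ext[of _ y1] nx nx[OF X(2)] e
      by (auto simp: lower_reach_def tail_reach_def half_less_def)
    then show ?thesis by blast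
  next
    case True
    define D where "D = {d \<in> X \<union> bar n ` X. \<not> (d \<le> n \<longleftrightarrow> y \<le> n)}"
    have finD: "finite D" using finX by (simp add: D_def)
    have eD: "e \<in> D" using e bar_half[OF eL(1)] by (auto simp: D_def)
    define y1 where "y1 = Max D"
    have y1D: "y1 \<in> D" using Max_in[OF finD] eD by (auto simp: y1_def)
    have top: "d \<le> y1" if "d \<in> D" for d using Max_ge[OF finD that] by (simp add: y1_def)
    have y1L: "y1 \<in> letters n" using y1D transversal_X(1) bar_letters by (auto simp: D_def)
    have h1: "y1 \<le> n \<longleftrightarrow> \<not> y \<le> n" using y1D by (auto simp: D_def)
    have b1: "bar n y1 \<le> y" "bar n y1 \<le> n \<longleftrightarrow> y \<le> n"
      using top[OF eD] eL y1L e h1 bar_less_iff[of y1 n e] bar_half[OF y1L] by auto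
    have y1X: "y1 \<in> X"
    proof (rule ccontr)
      assume "y1 \<notin> X"
      then obtain f where f: "f \<in> X" "y1 = bar n f" using y1D by (auto simp: D_def)
      then have "bar n y1 = f" using transversal_X by auto
      then have "f \<in> C" using f b1 yX by (auto simp: C_def half_less_def le_less)
      then show False using True by simp
    qed
    have nx: "\<not> cyc y1 c y" if "c \<in> X" for c
    proof
      assume H: "cyc y1 c y"
      have "c \<notin> C" "c \<in> D \<Longrightarrow> c \<le> y1" using True top by auto
      then show False using H that h1 by (auto simp: cyc_def C_def D_def half_less_def)
    qed
    have ny: "y1 \<noteq> y" using h1 by auto
    have flipF: "\<not> cyc y1 w (bar n y1)" if "w \<in> F" for w
    proof
      assume "cyc y1 w (bar n y1)"
      then have "cyc y1 w y" using b1 h1 by (auto simp: cyc_def)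
      then show False using ext[of w y1] nx[OF X(2)] ny that by blast
    qed
    have barcyc: "cyc y1 (bar n w) (bar n y1) \<longleftrightarrow> cyc y1 w (bar n y1)" if "w \<in> letters n" for w
      using that y1L by (auto simp: cyc_def bar_less_iff)
    have flipX: "\<not> cyc y1 w (bar n y1)" if "w \<in> X" for w
    proof
      assume H: "cyc y1 w (bar n y1)"
      have wL: "w \<in> letters n" using transversal_X(1)[OF that] .
      have "(w \<le> n \<longleftrightarrow> y \<le> n) \<or> w \<le> y1"
        using top[of w] that by (auto simp: D_def)
      moreover have "\<not> (w \<le> n \<longleftrightarrow> y \<le> n) \<or> bar n w \<le> y1"
        using top[of "bar n w"] that bar_half[OF wL] by (auto simp: D_def)
      then have "\<not> (w \<le> n \<longleftrightarrow> y \<le> n) \<or> bar n y1 \<le> w"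
        using bar_less_iff(4)[OF y1L wL] by (auto simp: not_less[symmetric])
      ultimately show False using H h1 b1(2) unfolding cyc_def by linarith
    qed
    have "\<not> cyc y1 w (bar n y1)"
      if w: "w \<in> F \<union> bar n ` F \<union> (X - {y1}) \<union> bar n ` (X - {y1})" for w
      using w
    proof (elim UnE)
      assume "w \<in> bar n ` F"
      then obtain f where "f \<in> F" "w = bar n f" by blast
      then show ?thesis using flipF[of f] barcyc[of f] F(1) by auto
    next
      assume "w \<in> bar n ` (X - {y1})"
      then obtain f where "f \<in> X" "w = bar n f" by blast
      then show ?thesis using flipX[of f] barcyc[of f] transversal_X(1)[of f] by auto
    qed (use flipF flipX in auto)
    moreover have "\<not> cyc (bar n y1) w y" if "w \<in> F" for w
    proof
      assume H: "cyc (bar n y1) w y"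
      then have "cyc y1 w y" using b1 h1 by (auto simp: cyc_def)
      then show False using ext[of w y1] nx[OF X(2)] ny that by blast
    qed
    moreover have "\<not> cyc (bar n y1) w y" if "w \<in> X" for w
    proof
      assume H: "cyc (bar n y1) w y"
      then have "w \<in> C" using that b1 by (auto simp: C_def half_less_def cyc_def)
      then show False using True by simp
    qed
    moreover have "y = bar n y1 \<or> y \<in> bar n ` (X - {y1}) \<and> half_less n (bar n y1) y"
    proof (cases "e = y1")
      case False
      then have "bar n y1 \<noteq> y" using e eL y1L bar_inj by auto
      then show ?thesis using e b1 False by (auto simp: half_less_def)
    qed (use e in simp)
    moreover have "\<not> cyc x w y1" if "w \<in> F" for w
      using ext[of w y1] nx[OF X(2)] ny that by blast
    ultimately have "lower_reach n F X x True y1 y"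
      using y1X by (simp add: lower_reach_def tail_reach_def) blast
    then show ?thesis by blast
  qed
qed

text \<open>A sign change occurs iff \<open>y\<close> is outside \<open>X\<close> and no element of
  \<open>X\<close> lies below it in its half. In either case \<open>y1\<close> is then
  \<open>y\<close> itself or the largest admissible element of \<open>X\<close> in a fixed
  half.\<close>

lemma lower_reach_unique:
  assumes "lower_reach n F X x b y1 y" "lower_reach n F X x b' y1' y"
  shows "b = b' \<and> y1 = y1'"
proof -
  have noflip: "y = a \<or> y \<notin> X \<and> half_less n a y \<and> a \<in> X \<and> (\<forall>w\<in>X. \<not> (a < w \<and> w < y))"
    if "lower_reach n F X x False a y" for a
    using that transversal_X by (auto simp: lower_reach_def tail_reach_def half_less_def cyc_def)
  have flip: "y \<notin> X \<and> (\<forall>c\<in>X. \<not> half_less n c y) \<and> (a \<le> n \<longleftrightarrow> \<not> y \<le> n) \<and> a \<in> X \<and>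
      (\<forall>w\<in>X. w \<noteq> a \<longrightarrow> \<not> cyc a w (bar n a))"
    if r: "lower_reach n F X x True a y" for a
  proof -
    have a: "a \<in> X" "\<forall>w\<in>X. w \<noteq> a \<longrightarrow> \<not> cyc a w (bar n a)" and t: "tail_reach n F (X - {a}) (bar n a) y"
      using r by (auto simp: lower_reach_def)
    have "y \<notin> X" using t transversal_X a(1) by (auto simp: tail_reach_def)
    moreover have half: "a \<le> n \<longleftrightarrow> \<not> y \<le> n" "bar n a \<le> y"
      using t bar_half[OF transversal_X(1)[OF a(1)]] by (auto simp: tail_reach_def half_less_def)
    moreover have "\<not> half_less n c y" if c: "c \<in> X" for c
    proof
      assume H: "half_less n c y"
      then have ca: "c \<noteq> a" "c \<noteq> bar n a" using half transversal_X(3)[OF c a(1)] by (auto simp: half_less_def)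
      have "\<not> cyc a c (bar n a)" using a(2) c ca by blast
      moreover have "\<not> cyc (bar n a) c y" using t c ca by (auto simp: tail_reach_def)
      ultimately show False using H ca half bar_half[OF transversal_X(1)[OF a(1)]]
        by (auto simp: cyc_def half_less_def)
    qed
    ultimately show ?thesis using a by blast
  qed
  show ?thesis
  proof (cases b; cases b')
    assume b: b b'
    have f: "y1 \<in> X" "y1' \<in> X" "y1 \<le> n \<longleftrightarrow> y1' \<le> n" "y1' \<noteq> y1 \<longrightarrow> \<not> cyc y1 y1' (bar n y1)"
      "y1 \<noteq> y1' \<longrightarrow> \<not> cyc y1' y1 (bar n y1')"
      using flip assms b by auto
    have "y1 = y1'"
      using f bar_half[OF transversal_X(1)[OF f(1)]] bar_half[OF transversal_X(1)[OF f(2)]]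
      by (auto simp: cyc_def)
    then show ?thesis using b by simp
  next
    assume b: b "\<not> b'"
    then show ?thesis using flip[of y1] noflip[of y1'] assms by (auto simp: lower_reach_def)
  next
    assume b: "\<not> b" b'
    then show ?thesis using flip[of y1'] noflip[of y1] assms by (auto simp: lower_reach_def)
  next
    assume b: "\<not> b" "\<not> b'"
    have "y1 = y1'"
      using noflip[of y1] noflip[of y1'] assms b
      by (auto simp: lower_reach_def half_less_def) (metis linorder_neqE_nat)+
    then show ?thesis using b by simp
  qed
qed

end

text \<open>The positions exchanged with \<open>i\<close> when \<open>Gamma_row_l\<close> is read
  backwards: \<open>k + 1, ..., n\<close>, then \<open>bar n i\<close> for the sign change, then the
  bars of \<open>n, ..., k + 1\<close>. Still to come are the bars of \<open>i - 1, ..., 1\<close>,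
  split off because right blocks consist of them alone.\<close>

definition stage_lower :: "nat \<Rightarrow> nat \<Rightarrow> nat \<Rightarrow> nat list" where
  "stage_lower n k i = [k + 1..<n + 1] @ [bar n i] @ [n + 1..<2 * n + 1 - k]"

definition stage_upper :: "nat \<Rightarrow> nat \<Rightarrow> nat list" where
  "stage_upper n i = [2 * n + 2 - i..<2 * n + 1]"

definition stage_X :: "nat \<Rightarrow> nat \<Rightarrow> nat \<Rightarrow> (nat \<Rightarrow> nat) \<Rightarrow> nat set" where
  "stage_X n k i v = v ` insert i {k<..n}"

definition stage_F :: "nat \<Rightarrow> nat \<Rightarrow> (nat \<Rightarrow> nat) \<Rightarrow> nat set" where
  "stage_F k i v = v ` {i<..k}"

context
  fixes n k i :: nat and v :: "nat \<Rightarrow> nat"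
  assumes i: "1 \<le> i" "i \<le> k" "k \<le> n" and v: "v \<in> signed_perms n"
begin

lemma stage_index: "1 \<le> i" "i \<le> n" using i by auto

lemma signed_bar: "c \<in> letters n \<Longrightarrow> v (bar n c) = bar n (v c)"
  using signed_permD(4)[OF v] .

lemma stage_sets:
  "transversal n (stage_X n k i v)" "v i \<in> (stage_X n k i v)" "stage_F k i v \<subseteq> letters n"
  "stage_F k i v \<inter> ((stage_X n k i v) \<union> bar n ` (stage_X n k i v)) = {}"
proof -
  have L: "insert i {k<..n} \<subseteq> letters n" "{i<..k} \<subseteq> letters n" using i by (auto simp: letters_def)
  have vL: "v c \<in> letters n" if "c \<in> letters n" for c using signed_permD(3)[OF v that] .
  have ne: "v a \<noteq> bar n (v b)" if "a \<in> {1..n}" "b \<in> {1..n}" for a b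
  proof
    assume "v a = bar n (v b)"
    then have "v a = v (bar n b)" using signed_bar that by (auto simp: letters_def)
    then have "a = bar n b" using signed_permD(2)[OF v] by (auto dest: injD)
    then show False using that by (auto simp: bar_def)
  qed
  show "transversal n (stage_X n k i v)" unfolding transversal_def
  proof
    show "(stage_X n k i v) \<subseteq> letters n" unfolding stage_X_def using L(1) vL by blast
    have "bar n (v a) \<noteq> v b" if "a \<in> insert i {k<..n}" "b \<in> insert i {k<..n}" for a b
      using ne[of b a] that i by auto
    then show "\<forall>w\<in>(stage_X n k i v). bar n w \<notin> (stage_X n k i v)" unfolding stage_X_def by blast
  qed
  show "v i \<in> (stage_X n k i v)" by (simp add: stage_X_def)
  show "stage_F k i v \<subseteq> letters n" using L(2) vL by (auto simp: stage_F_def)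
  have "v a \<noteq> v b" if "a \<noteq> b" for a b using that signed_permD(2)[OF v] by (auto dest: injD)
  then have "v a \<notin> (stage_X n k i v)" if "a \<in> {i<..k}" for a
    using that i unfolding stage_X_def by fastforce
  moreover have "v a \<notin> bar n ` (stage_X n k i v)" if a: "a \<in> {i<..k}" for a
  proof
    assume "v a \<in> bar n ` (stage_X n k i v)"
    then obtain c where "c \<in> insert i {k<..n}" "v a = bar n (v c)" unfolding stage_X_def by blast
    then show False using ne[of a c] a i by auto
  qed
  ultimately have "v a \<notin> (stage_X n k i v) \<union> bar n ` (stage_X n k i v)" if "a \<in> {i<..k}" for a
    using that by blast
  then show "stage_F k i v \<inter> ((stage_X n k i v) \<union> bar n ` (stage_X n k i v)) = {}" unfolding stage_F_def by blast
qed

text \<open>The first segment only permutes the values \<open>X\<close> among the positions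
  \<open>i\<close> and \<open>k<..n\<close> and leaves \<open>F\<close> in place. So every set of
  values entering the later edge conditions is composed of \<open>F\<close>, \<open>X\<close>
  without the current value, and their bars; which position holds which value does not
  matter.\<close>

lemma lower_segments:
  assumes w: "stage_walk n i v [k + 1..<n + 1] bs1 v1"
  defines "v2 \<equiv> \<lambda>b. if b then v1 \<circ> reflection n (i, bar n i) else v1"
  shows "v1 \<in> signed_perms n" "v2 b \<in> signed_perms n"
    "v1 i \<in> (stage_X n k i v)" "\<forall>w\<in>(stage_F k i v). \<not> cyc (v i) w (v1 i)"
    "v2 b i = (if b then bar n (v1 i) else v1 i)"
    "qedge n v1 (stage_root n i (bar n i)) \<longleftrightarrow>
      (\<forall>w\<in>(stage_F k i v) \<union> bar n ` (stage_F k i v) \<union> ((stage_X n k i v) - {v1 i}) \<union> bar n ` ((stage_X n k i v) - {v1 i}).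
        \<not> cyc (v1 i) w (bar n (v1 i)))"
    "chain_reach n True i (n + 1) (2 * n + 1 - k) (v2 b) y \<longleftrightarrow>
      tail_reach n (stage_F k i v) ((stage_X n k i v) - {v1 i}) (v2 b i) y"
proof -
  have rng: "chain_range n i (n + 1) False (k + 1)" using i by (auto simp: chain_range_def)
  have ls: "\<And>l. l \<in> set [k + 1..<n + 1] \<Longrightarrow> i < l \<and> l \<le> 2 * n" using i by auto
  show v1: "v1 \<in> signed_perms n" using stage_walk_signed[OF stage_index v w ls] .
  have bi: "i < bar n i" "bar n i \<le> 2 * n" using stage_index by (auto simp: bar_def)
  note st = stage_step[OF stage_index bi v1]
  show v2: "v2 b \<in> signed_perms n" using st(1) v1 by (auto simp: v2_def)
  have iL: "i \<in> letters n" using stage_index by (auto simp: letters_def)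
  have v1b: "v1 (bar n c) = bar n (v1 c)" if "c \<in> letters n" for c
    using signed_permD(4)[OF v1 that] .
  have v2b: "v2 b (bar n c) = bar n (v2 b c)" if "c \<in> letters n" for c
    using signed_permD(4)[OF v2 that] .
  have set1: "set [k + 1..<n + 1] = {k<..n}" by auto
  have r: "chain_reach n False i (k + 1) (n + 1) v (v1 i)"
    using chain_walk(1)[OF stage_index v rng] w by blast
  have r': "v1 i = v i \<or> v1 i \<in> v ` {k + 1..<n + 1}" "\<And>c. i < c \<Longrightarrow> c < k + 1 \<Longrightarrow> \<not> cyc (v i) (v c) (v1 i)"
    using r unfolding chain_reach_def by auto
  then show "v1 i \<in> (stage_X n k i v)" unfolding stage_X_def by (auto simp: less_Suc_eq_le)
  show "\<forall>w\<in>(stage_F k i v). \<not> cyc (v i) w (v1 i)" using r'(2) by (auto simp: stage_F_def)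
  show v2i: "v2 b i = (if b then bar n (v1 i) else v1 i)"
    unfolding v2_def using st(2) v1b[OF iL] by auto
  have fixF: "v1 c = v c" if "c \<in> {i<..k}" for c
    by (rule stage_walk_fixed[OF stage_index v w ls]) (use that i in \<open>auto simp: bar_def\<close>)
  have F: "v1 ` {i<..k} = (stage_F k i v)" unfolding stage_F_def using fixF by (auto intro!: image_cong)
  have X: "v1 ` insert i {k<..n} = (stage_X n k i v)" unfolding stage_X_def
    by (rule stage_walk_image[OF stage_index v w ls])
      (use i in \<open>auto simp: bar_def\<close>)
  have E: "v1 ` {k<..n} = (stage_X n k i v) - {v1 i}"
    unfolding X[symmetric] using signed_permD(2)[OF v1] i by (auto simp: inj_eq)
  have rng12: "{i<..n} = {i<..k} \<union> {k<..n}" using i by auto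
  have FE: "v1 ` {i<..n} = (stage_F k i v) \<union> ((stage_X n k i v) - {v1 i})"
    unfolding rng12 image_Un F E ..
  have barimg: "v1 ` bar n ` A = bar n ` v1 ` A" if "A \<subseteq> letters n" for A
    unfolding image_image using v1b that by (auto intro!: image_cong)
  have mid: "{i<..<bar n i} = {i<..n} \<union> bar n ` {i<..n}"
  proof (intro set_eqI iffI)
    fix c assume "c \<in> {i<..<bar n i}"
    then have "c \<in> {i<..n} \<or> bar n c \<in> {i<..n} \<and> c = bar n (bar n c)" by (auto simp: bar_def)
    then show "c \<in> {i<..n} \<union> bar n ` {i<..n}" by blast
  qed (auto simp: bar_def)
  have sub: "{i<..n} \<subseteq> letters n" by (auto simp: letters_def)
  have "v1 ` {i<..<bar n i} = (stage_F k i v) \<union> bar n ` (stage_F k i v) \<union> ((stage_X n k i v) - {v1 i}) \<union> bar n ` ((stage_X n k i v) - {v1 i})"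
    unfolding mid image_Un barimg[OF sub] FE by blast
  moreover have "qedge n v1 (stage_root n i (bar n i)) \<longleftrightarrow>
      (\<forall>w\<in>v1 ` {i<..<bar n i}. \<not> cyc (v1 i) w (bar n (v1 i)))"
    unfolding qedge_stage_root(1)[OF v1 stage_index bi] v1b[OF iL] by auto
  ultimately show "qedge n v1 (stage_root n i (bar n i)) \<longleftrightarrow>
      (\<forall>w\<in>(stage_F k i v) \<union> bar n ` (stage_F k i v) \<union> ((stage_X n k i v) - {v1 i}) \<union> bar n ` ((stage_X n k i v) - {v1 i}).
        \<not> cyc (v1 i) w (bar n (v1 i)))" by simp
  have v2c: "v2 b c = v1 c" if "c \<noteq> i" "c \<noteq> bar n i" for c
    using st(6)[of c] that iL by (auto simp: v2_def)
  have FE2: "v2 b ` {i<..n} = (stage_F k i v) \<union> ((stage_X n k i v) - {v1 i})"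
    unfolding FE[symmetric] using v2c by (intro image_cong) (auto simp: bar_def)
  have E2: "v2 b ` {k<..n} = (stage_X n k i v) - {v1 i}"
    unfolding E[symmetric] using v2c i by (intro image_cong) (auto simp: bar_def)
  have seg: "{n + 1..<2 * n + 1 - k} = bar n ` {k<..n}"
  proof (intro set_eqI iffI)
    fix c assume "c \<in> {n + 1..<2 * n + 1 - k}"
    then have "bar n c \<in> {k<..n} \<and> c = bar n (bar n c)" by (auto simp: bar_def)
    then show "c \<in> bar n ` {k<..n}" by blast
  qed (use i in \<open>auto simp: bar_def\<close>)
  have "v2 b ` {n + 1..<2 * n + 1 - k} = bar n ` v2 b ` {k<..n}"
    unfolding seg image_image using v2b by (intro image_cong) (auto simp: letters_def)
  then have T: "v2 b ` {n + 1..<2 * n + 1 - k} = bar n ` ((stage_X n k i v) - {v1 i})" unfolding E2 .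
  have "(\<forall>c. i < c \<and> c < n + 1 \<longrightarrow> \<not> cyc (v2 b i) (v2 b c) y) \<longleftrightarrow>
      (\<forall>w\<in>v2 b ` {i<..n}. \<not> cyc (v2 b i) w y)" by auto
  then show "chain_reach n True i (n + 1) (2 * n + 1 - k) (v2 b) y \<longleftrightarrow>
      tail_reach n (stage_F k i v) ((stage_X n k i v) - {v1 i}) (v2 b i) y"
    unfolding chain_reach_def tail_reach_def T FE2 chain_ok_def by simp
qed

lemma stage_lower_split:
  "stage_walk n i v (stage_lower n k i) bs u \<longleftrightarrow> (\<exists>bs1 b bs3 v1. bs = bs1 @ b # bs3 \<and>
     stage_walk n i v [k + 1..<n + 1] bs1 v1 \<and> (b \<longrightarrow> qedge n v1 (stage_root n i (bar n i))) \<and>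
     stage_walk n i (if b then v1 \<circ> reflection n (i, bar n i) else v1) [n + 1..<2 * n + 1 - k] bs3 u)"
    (is "?L \<longleftrightarrow> ?R")
proof -
  have bi: "i < bar n i" "bar n i \<le> 2 * n" using stage_index by (auto simp: bar_def)
  have mid: "stage_walk n i v1 (bar n i # ls) bs u \<longleftrightarrow> (\<exists>b cs. bs = b # cs \<and>
     (b \<longrightarrow> qedge n v1 (stage_root n i (bar n i))) \<and>
     stage_walk n i (if b then v1 \<circ> reflection n (i, bar n i) else v1) ls cs u)" for v1 ls bs
    by (simp only: list.map qwalk.simps(2) reflection_stage_root[OF stage_index bi])
  have sp: "?L \<longleftrightarrow> (\<exists>bs1 cs v1. bs = bs1 @ cs \<and> stage_walk n i v [k + 1..<n + 1] bs1 v1 \<and>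
      stage_walk n i v1 (bar n i # [n + 1..<2 * n + 1 - k]) cs u)"
    unfolding stage_lower_def append_Cons append_Nil by (rule stage_walk_append)
  show ?thesis
  proof
    assume ?L
    then obtain bs1 cs v1 where 1: "bs = bs1 @ cs" "stage_walk n i v [k + 1..<n + 1] bs1 v1"
      "stage_walk n i v1 (bar n i # [n + 1..<2 * n + 1 - k]) cs u"
      unfolding sp by (elim exE conjE)
    from 1(3) obtain b bs3 where "cs = b # bs3" "b \<longrightarrow> qedge n v1 (stage_root n i (bar n i))"
      "stage_walk n i (if b then v1 \<circ> reflection n (i, bar n i) else v1) [n + 1..<2 * n + 1 - k] bs3 u"
      unfolding mid by (elim exE conjE)
    with 1(1,2) show ?R by (intro exI conjI) auto
  next
    assume ?R
    then obtain bs1 b bs3 v1 where 1: "bs = bs1 @ b # bs3" "stage_walk n i v [k + 1..<n + 1] bs1 v1"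
      "b \<longrightarrow> qedge n v1 (stage_root n i (bar n i))"
      "stage_walk n i (if b then v1 \<circ> reflection n (i, bar n i) else v1) [n + 1..<2 * n + 1 - k] bs3 u"
      by (elim exE conjE)
    have "stage_walk n i v1 (bar n i # [n + 1..<2 * n + 1 - k]) (b # bs3) u"
      unfolding mid by (rule exI[of _ b], rule exI[of _ bs3]) (intro conjI refl 1(3,4))
    then show ?L unfolding sp using 1(1,2) by (intro exI conjI)
  qed
qed

lemma stage_lower_reach:
  assumes "stage_walk n i v [k + 1..<n + 1] bs1 v1" "b \<longrightarrow> qedge n v1 (stage_root n i (bar n i))"
    "stage_walk n i (if b then v1 \<circ> reflection n (i, bar n i) else v1) [n + 1..<2 * n + 1 - k] bs3 u"
  shows "lower_reach n (stage_F k i v) (stage_X n k i v) (v i) b (v1 i) (u i)"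
proof -
  note seg = lower_segments[OF assms(1)]
  have rng: "chain_range n i (2 * n + 1 - k) True (n + 1)"
    using i by (auto simp: chain_range_def bar_def)
  have "chain_reach n True i (n + 1) (2 * n + 1 - k)
      (if b then v1 \<circ> reflection n (i, bar n i) else v1) (u i)"
    using chain_walk(1)[OF stage_index seg(2) rng] assms(3) by blast
  then show ?thesis using seg(3-7) assms(2) unfolding lower_reach_def by auto
qed

text \<open>The abstract relation carried over to walks. The final value at \<open>i\<close>
  determines the sign bit and the value after the first segment, and \<open>chain_walk\<close> then
  determines the bits of both remaining pieces.\<close>

lemma stage_lower_walk:
  shows "stage_walk n i v (stage_lower n k i) bs u \<Longrightarrow>
      u i \<in> (stage_X n k i v) \<union> bar n ` (stage_X n k i v) \<and> (\<forall>w\<in>(stage_F k i v). \<not> cyc (v i) w (u i))"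
    and "y \<in> (stage_X n k i v) \<union> bar n ` (stage_X n k i v) \<Longrightarrow> \<forall>w\<in>(stage_F k i v). \<not> cyc (v i) w y \<Longrightarrow>
      \<exists>bs u. stage_walk n i v (stage_lower n k i) bs u \<and> u i = y"
    and "stage_walk n i v (stage_lower n k i) bs u \<Longrightarrow> stage_walk n i v (stage_lower n k i) bs' u' \<Longrightarrow>
      u i = u' i \<Longrightarrow> bs = bs'"
proof -
  have rng1: "chain_range n i (n + 1) False (k + 1)" using i by (auto simp: chain_range_def)
  have rng3: "chain_range n i (2 * n + 1 - k) True (n + 1)"
    using i by (auto simp: chain_range_def bar_def)
  show "u i \<in> (stage_X n k i v) \<union> bar n ` (stage_X n k i v) \<and> (\<forall>w\<in>(stage_F k i v). \<not> cyc (v i) w (u i))"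
    if "stage_walk n i v (stage_lower n k i) bs u"
    using that lower_reach_sound[OF stage_sets] stage_lower_reach unfolding stage_lower_split by blast
  show "\<exists>bs u. stage_walk n i v (stage_lower n k i) bs u \<and> u i = y"
    if y: "y \<in> (stage_X n k i v) \<union> bar n ` (stage_X n k i v)" "\<forall>w\<in>(stage_F k i v). \<not> cyc (v i) w y"
  proof -
    obtain b y1 where r: "lower_reach n (stage_F k i v) (stage_X n k i v) (v i) b y1 y"
      using lower_reach_complete[OF stage_sets y(1)] y(2) by blast
    have "y1 = v i \<or> y1 \<in> v ` {k + 1..<n + 1}"
      using r unfolding lower_reach_def stage_X_def by (auto simp: less_Suc_eq_le)
    moreover have "\<not> cyc (v i) (v c) y1" if "i < c" "c < k + 1" for c
      using r that unfolding lower_reach_def stage_F_def by auto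
    ultimately have "chain_reach n False i (k + 1) (n + 1) v y1"
      unfolding chain_reach_def chain_ok_def by blast
    then obtain bs1 v1 where w1: "stage_walk n i v [k + 1..<n + 1] bs1 v1" "v1 i = y1"
      using chain_walk(1)[OF stage_index v rng1] by blast
    note seg = lower_segments[OF w1(1)]
    have e: "b \<longrightarrow> qedge n v1 (stage_root n i (bar n i))"
      unfolding seg(6) w1(2) using r by (auto simp: lower_reach_def)
    have "chain_reach n True i (n + 1) (2 * n + 1 - k)
        (if b then v1 \<circ> reflection n (i, bar n i) else v1) y"
      unfolding seg(7) seg(5) w1(2) using r by (auto simp: lower_reach_def)
    then obtain bs3 u where "stage_walk n i (if b then v1 \<circ> reflection n (i, bar n i) else v1)
        [n + 1..<2 * n + 1 - k] bs3 u" "u i = y"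
      using chain_walk(1)[OF stage_index seg(2) rng3] by blast
    then show ?thesis using w1 e unfolding stage_lower_split by blast
  qed
  show "bs = bs'" if W: "stage_walk n i v (stage_lower n k i) bs u"
    "stage_walk n i v (stage_lower n k i) bs' u'" and eq: "u i = u' i"
  proof -
    obtain bs1 b bs3 v1 where d: "bs = bs1 @ b # bs3" "stage_walk n i v [k + 1..<n + 1] bs1 v1"
      "b \<longrightarrow> qedge n v1 (stage_root n i (bar n i))"
      "stage_walk n i (if b then v1 \<circ> reflection n (i, bar n i) else v1) [n + 1..<2 * n + 1 - k] bs3 u"
      using W(1) unfolding stage_lower_split by blast
    obtain bs1' b' bs3' v1' where d': "bs' = bs1' @ b' # bs3'" "stage_walk n i v [k + 1..<n + 1] bs1' v1'"
      "b' \<longrightarrow> qedge n v1' (stage_root n i (bar n i))"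
      "stage_walk n i (if b' then v1' \<circ> reflection n (i, bar n i) else v1') [n + 1..<2 * n + 1 - k] bs3' u'"
      using W(2) unfolding stage_lower_split by blast
    have e: "b = b'" "v1 i = v1' i"
      using lower_reach_unique[OF stage_sets stage_lower_reach[OF d(2-4)]] stage_lower_reach[OF d'(2-4)]
      unfolding eq by blast+
    have b1: "bs1 = bs1'" by (rule chain_walk(2)[OF stage_index v rng1 d(2) d'(2) e(2)])
    then have v1: "v1 = v1'" using qwalk_determ d(2) d'(2) by blast
    have "bs3 = bs3'"
      by (rule chain_walk(2)[OF stage_index lower_segments(2)[OF d(2)] rng3 d(4)]) (use d'(4) e v1 eq in auto)
    then show ?thesis using d d' e b1 by simp
  qed
qed

end

lemma signed_perm_surj:
  assumes "v \<in> signed_perms n" "x \<in> letters n"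
  obtains d where "d \<in> letters n" "v d = x"
  using assms(2) permutes_image[OF signed_permD(1)[OF assms(1)]] by (metis imageE)

lemma upper_range:
  assumes "1 \<le> i" "i \<le> n"
  shows "chain_range n i (2 * n + 1) True (2 * n + 2 - i)"
  using assms by (auto simp: chain_range_def bar_def)

text \<open>For the third fact: a new value at \<open>i\<close> comes from beyond
  \<open>bar n i\<close>, so no position of the window \<open>{i..bar n i}\<close> carries it, and
  values strictly below it are excluded by the cyclic condition.\<close>

lemma stage_upper_walk:
  assumes i: "1 \<le> i" "i \<le> n" and v: "v \<in> signed_perms n"
    and w: "stage_walk n i v (stage_upper n i) bs v'"
  shows "v' \<in> signed_perms n" "v' i = v i \<or> half_less n (v i) (v' i)"
    "\<And>c. i \<le> c \<Longrightarrow> c \<le> bar n i \<Longrightarrow> \<not> (v i < v c \<and> v c \<le> v' i)"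
    "\<And>c. i < c \<Longrightarrow> c \<le> bar n i \<Longrightarrow> \<not> cyc (v i) (v c) (v' i)"
    "\<And>c. i < c \<Longrightarrow> c \<le> n \<Longrightarrow> v' c = v c" "bumped n i (v' i) v v'"
proof -
  have ls: "\<And>l. l \<in> set (stage_upper n i) \<Longrightarrow> i < l \<and> l \<le> 2 * n"
    using i by (auto simp: stage_upper_def)
  show "v' \<in> signed_perms n" using stage_walk_signed[OF i v w ls] .
  have r: "chain_reach n True i (2 * n + 2 - i) (2 * n + 1) v (v' i)"
    using chain_walk(1)[OF i v upper_range[OF i]] w unfolding stage_upper_def by blast
  then show hl: "v' i = v i \<or> half_less n (v i) (v' i)"
    by (auto simp: chain_reach_def chain_ok_def)
  show nc: "\<not> cyc (v i) (v c) (v' i)" if "i < c" "c \<le> bar n i" for c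
    using r that i unfolding chain_reach_def by (auto simp: bar_def)
  show "\<not> (v i < v c \<and> v c \<le> v' i)" if "i \<le> c" "c \<le> bar n i" for c
  proof
    assume H: "v i < v c \<and> v c \<le> v' i"
    then have "v' i \<in> v ` {2 * n + 2 - i..<2 * n + 1}" using r by (auto simp: chain_reach_def)
    then obtain d where "v' i = v d" "2 * n + 2 - i \<le> d" by auto
    then have "v c \<noteq> v' i" using that i signed_permD(2)[OF v] by (auto simp: inj_eq bar_def)
    then have "cyc (v i) (v c) (v' i)" using H by (auto simp: cyc_def)
    moreover have "i < c" using H that by (cases "c = i") auto
    ultimately show False using nc that by blast
  qed
  show "v' c = v c" if "i < c" "c \<le> n" for c
  proof (rule stage_walk_fixed[OF i v w ls])
    show "c \<notin> {i, bar n i}" using that i by (auto simp: bar_def)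
    show "c \<notin> set (stage_upper n i)" using that i by (auto simp: stage_upper_def)
    show "c \<notin> bar n ` set (stage_upper n i)" using that i by (auto simp: stage_upper_def bar_def)
  qed
  show "bumped n i (v' i) v v'"
    unfolding bumped_def
  proof (intro ballI impI)
    fix a assume a: "a \<in> {1..<i}" "v' a \<noteq> v a"
    have b: "bar n (2 * n + 2 - i) = i - 1" using i by (auto simp: bar_def)
    have "bar n (v' i) \<le> v a \<and> v a < v' a \<and> v' a \<le> bar n (v i) \<and>
        (\<forall>b. a < b \<and> b \<le> bar n (2 * n + 2 - i) \<longrightarrow> \<not> (bar n (v' i) \<le> v b \<and> v b < v' a))"
      by (rule walk_bump[OF i v _ _ w[unfolded stage_upper_def]]) (use a i in \<open>auto simp: bar_def\<close>)
    then show "bar n (v' i) \<le> v a \<and> v a < v' a \<and> v' a \<le> bar n (v i) \<and>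
        (\<forall>b. a < b \<and> b < i \<longrightarrow> \<not> (bar n (v' i) \<le> v b \<and> v b < v' a))"
      unfolding b by auto
  qed
qed

lemma stage_upper_exists:
  assumes i: "1 \<le> i" "i \<le> n" and v: "v \<in> signed_perms n"
    and z: "z = v i \<or> z \<in> v ` {bar n i<..2 * n} \<and> half_less n (v i) z"
    and nc: "\<And>c. i < c \<Longrightarrow> c \<le> bar n i \<Longrightarrow> \<not> cyc (v i) (v c) z"
  shows "\<exists>bs v'. stage_walk n i v (stage_upper n i) bs v' \<and> v' i = z"
proof -
  have "{bar n i<..2 * n} = {2 * n + 2 - i..<2 * n + 1}" using i by (auto simp: bar_def)
  then have "chain_reach n True i (2 * n + 2 - i) (2 * n + 1) v z"
    using z nc i unfolding chain_reach_def by (auto simp: chain_ok_def bar_def)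
  then show ?thesis
    using chain_walk(1)[OF i v upper_range[OF i]] unfolding stage_upper_def by blast
qed

lemma stage_upper_unique:
  assumes i: "1 \<le> i" "i \<le> n" and v: "v \<in> signed_perms n"
    and "stage_walk n i v (stage_upper n i) bs v1" "stage_walk n i v (stage_upper n i) bs' v2" "v1 i = v2 i"
  shows "bs = bs'"
  using chain_walk(2)[OF i v upper_range[OF i]] assms(4-6) unfolding stage_upper_def by blast

text \<open>The window \<open>{i..bar n i}\<close> is its own mirror image, so
  \<open>stage_walk_image\<close> does not apply to it; instead all positions outside are fixed, and
  bijectivity preserves the set of values inside.\<close>

lemma stage_lower_fixed:
  assumes i: "1 \<le> i" "i \<le> k" "k \<le> n" and v: "v \<in> signed_perms n"
    and w: "stage_walk n i v (stage_lower n k i) bs u"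
  shows "u \<in> signed_perms n" "c \<in> {1..k} \<Longrightarrow> c \<noteq> i \<Longrightarrow> u c = v c" "u ` {i..bar n i} = v ` {i..bar n i}"
proof -
  have il: "1 \<le> i" "i \<le> n" using i by auto
  have ls: "\<And>l. l \<in> set (stage_lower n k i) \<Longrightarrow> i < l \<and> l \<le> 2 * n"
    using i by (auto simp: stage_lower_def bar_def)
  show u: "u \<in> signed_perms n" using stage_walk_signed[OF il v w ls] .
  show fx: "u c = v c" if "c \<in> {1..k}" "c \<noteq> i" for c
  proof (rule stage_walk_fixed[OF il v w ls])
    show "c \<notin> {i, bar n i}" using that i by (auto simp: bar_def)
    show "c \<notin> set (stage_lower n k i)" using that i by (auto simp: stage_lower_def bar_def)
    show "c \<notin> bar n ` set (stage_lower n k i)" using that i by (auto simp: stage_lower_def bar_def)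
  qed
  have fx': "u d = v d" if d: "d \<in> letters n" "d \<notin> {i..bar n i}" for d
  proof (cases "d < i")
    case True
    then show ?thesis using fx[of d] d i by (auto simp: letters_def)
  next
    case False
    then have b: "bar n d \<in> {1..k}" "bar n d \<noteq> i" "bar n d \<in> letters n"
      using d i bar_letters[OF d(1)] by (auto simp: letters_def bar_def)
    then have "u (bar n (bar n d)) = v (bar n (bar n d))"
      using fx[OF b(1,2)] signed_permD(4)[OF u b(3)] signed_permD(4)[OF v b(3)] by simp
    then show ?thesis using d by simp
  qed
  have sub: "{i..bar n i} \<subseteq> letters n" using il by (auto simp: letters_def bar_def)
  have "w ` {i..bar n i} = letters n - w ` (letters n - {i..bar n i})" if "w \<in> signed_perms n" for w
  proof -
    have "w ` letters n = letters n" by (rule permutes_image[OF signed_permD(1)[OF that]])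
    moreover have "w ` (letters n - (letters n - {i..bar n i})) =
        w ` letters n - w ` (letters n - {i..bar n i})"
      by (rule image_set_diff[OF signed_permD(2)[OF that]])
    moreover have "letters n - (letters n - {i..bar n i}) = {i..bar n i}" using sub by blast
    ultimately show ?thesis by simp
  qed
  from this[OF u] this[OF v] show "u ` {i..bar n i} = v ` {i..bar n i}"
    using fx' by (metis (no_types, lifting) DiffE image_cong)
qed

lemma greedy_cong:
  assumes "\<And>a. a \<in> {1..<m} \<Longrightarrow> x a = x' a"
  shows "greedy A x m h \<longleftrightarrow> greedy A x' m h"
  using assms by (auto simp: greedy_def)

abbreviation full_stage :: "nat \<Rightarrow> nat \<Rightarrow> nat \<Rightarrow> nat list" where
  "full_stage n k i \<equiv> stage_lower n k i @ stage_upper n i"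

text \<open>The upper segment changes values at positions before \<open>i\<close>, and the fourth
  fact is what carries over to the next stage: the greedy problem of these positions has the same
  solutions, provided the value now placed at \<open>i\<close> belongs to the target and is not
  assigned to one of them.\<close>

lemma full_stage_walk:
  assumes i: "1 \<le> i" "i \<le> k" "k \<le> n" and v: "v \<in> signed_perms n"
    and w: "stage_walk n i v (full_stage n k i) bs v'"
  shows "v' \<in> signed_perms n" "\<And>c. i < c \<Longrightarrow> c \<le> k \<Longrightarrow> v' c = v c"
    "\<And>c. i < c \<Longrightarrow> c \<le> k \<Longrightarrow> \<not> cyc (v i) (v c) (v' i)"
    "\<And>A h. transversal n A \<Longrightarrow> v' i \<in> A \<Longrightarrow> v' i \<notin> h ` {1..<i} \<Longrightarrow> greedy A v i h \<longleftrightarrow> greedy A v' i h"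
proof -
  have il: "1 \<le> i" "i \<le> n" using i by auto
  obtain bs1 bs2 u where u: "stage_walk n i v (stage_lower n k i) bs1 u"
    "stage_walk n i u (stage_upper n i) bs2 v'"
    using w unfolding stage_walk_append by blast
  note lo = stage_lower_fixed[OF i v u(1)]
  note up = stage_upper_walk[OF il lo(1) u(2)]
  show v': "v' \<in> signed_perms n" by (fact up(1))
  show "v' c = v c" if "i < c" "c \<le> k" for c using lo(2)[of c] up(5)[of c] that i by auto
  show "\<not> cyc (v i) (v c) (v' i)" if c: "i < c" "c \<le> k" for c
  proof (rule cyc_compose[where a = "u i"])
    show "\<not> cyc (v i) (v c) (u i)"
      using stage_lower_walk(1)[OF i v u(1)] c unfolding stage_F_def by auto
    have uc: "u c = v c" using lo(2)[of c] c i by auto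
    show "\<not> cyc (u i) (v c) (v' i)" using up(4)[of c] c i uc by (auto simp: bar_def)
    show "v c \<noteq> u i" using uc c signed_permD(2)[OF lo(1)] by (metis injD less_irrefl)
    \<comment> \<open>The initial value survives somewhere in the window, and the upper segment
      passes no window value; so it does not pass \<open>v i\<close>, as \<open>cyc_compose\<close>
      requires.\<close>
    have "v i \<in> u ` {i..bar n i}" unfolding lo(3) using il by (auto simp: bar_def)
    then obtain d where d: "v i = u d" "i \<le> d" "d \<le> bar n i" by auto
    show "\<not> cyc (u i) (v i) (v' i)"
    proof (cases "d = i")
      case True
      then show ?thesis using d by (auto simp: cyc_def)
    next
      case False
      then show ?thesis using d up(4)[of d] by auto
    qed
  qed
  show "greedy A v i h \<longleftrightarrow> greedy A v' i h"
    if "transversal n A" "v' i \<in> A" "v' i \<notin> h ` {1..<i}" for A h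
  proof -
    have "greedy A v i h \<longleftrightarrow> greedy A u i h"
      by (rule greedy_cong) (use lo(2) i in auto)
    also have "\<dots> \<longleftrightarrow> greedy A v' i h"
    proof (rule greedy_bumped[OF il lo(1) up(2) _ up(3) up(6) that])
      show "v' i \<in> letters n" using that by (auto simp: transversal_def)
    qed
    finally show ?thesis .
  qed
qed

text \<open>The value entering the upper segment is forced: it is the largest value of the window
  \<open>{i..bar n i}\<close> not exceeding the final value, and the set of window values is the
  same for both walks.\<close>

lemma full_stage_unique:
  assumes i: "1 \<le> i" "i \<le> k" "k \<le> n" and v: "v \<in> signed_perms n"
    and w: "stage_walk n i v (full_stage n k i) bs v1" "stage_walk n i v (full_stage n k i) bs' v2"
    and eq: "v1 i = v2 i"
  shows "bs = bs'"
proof -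
  have il: "1 \<le> i" "i \<le> n" using i by auto
  obtain cs1 cs2 u where u: "bs = cs1 @ cs2" "stage_walk n i v (stage_lower n k i) cs1 u"
    "stage_walk n i u (stage_upper n i) cs2 v1"
    using w(1) unfolding stage_walk_append by blast
  obtain cs1' cs2' u' where u': "bs' = cs1' @ cs2'" "stage_walk n i v (stage_lower n k i) cs1' u'"
    "stage_walk n i u' (stage_upper n i) cs2' v2"
    using w(2) unfolding stage_walk_append by blast
  note lo = stage_lower_fixed[OF i v u(2)] and lo' = stage_lower_fixed[OF i v u'(2)]
  note up = stage_upper_walk[OF il lo(1) u(3)] and up' = stage_upper_walk[OF il lo'(1) u'(3)]
  have "u i \<in> u' ` {i..bar n i}" "u' i \<in> u ` {i..bar n i}"
    using lo(3) lo'(3) il by (auto simp: bar_def)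
  then obtain d d' where d: "u i = u' d" "i \<le> d" "d \<le> bar n i" "u' i = u d'" "i \<le> d'" "d' \<le> bar n i"
    by auto
  have "u i \<le> v1 i" "u' i \<le> v1 i" using up(2) up'(2) eq by (auto simp: half_less_def)
  then have "u i = u' i"
    using up(3)[OF d(5,6)] up'(3)[OF d(2,3)] d(1,4) eq by auto
  then have c1: "cs1 = cs1'" using stage_lower_walk(3)[OF i v u(2) u'(2)] by blast
  then have "u = u'" using qwalk_determ u(2) u'(2) by blast
  then have "cs2 = cs2'" using stage_upper_unique[OF il lo(1) u(3)] u'(3) eq by blast
  then show ?thesis using u(1) u'(1) c1 by simp
qed

text \<open>If the greedy letter \<open>?z\<close> is a window value, the lower segments reach it
  and the upper segment stays put. Otherwise it sits beyond \<open>bar n i\<close> and has to be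
  entered from the largest window value \<open>y\<close> below it in its half. Two pigeonhole counts
  show that such a \<open>y\<close> exists and that it is not the bar of a value waiting at
  \<open>i<..k\<close>; the letter \<open>?z\<close>, reserved for \<open>i\<close>, is the one
  lacking to the earlier positions.\<close>

lemma full_stage_exists:
  assumes i: "1 \<le> i" "i \<le> k" "k \<le> n" and v: "v \<in> signed_perms n"
    and A: "transversal n A" and F: "v ` {i<..k} \<subseteq> A" "h ` {1..<Suc i} \<inter> v ` {i<..k} = {}"
    and h: "greedy A v (Suc i) h"
  shows "\<exists>bs v'. stage_walk n i v (full_stage n k i) bs v' \<and> v' i = h i"
proof -
  have il: "1 \<le> i" "i \<le> n" using i by auto
  let ?z = "h i" and ?F = "v ` {i<..k}" and ?X = "v ` insert i {k<..n}"
  define N where "N = v ` {i..bar n i}"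
  have hA: "h a \<in> A" if "a \<in> {1..i}" for a using h that i by (auto simp: greedy_def)
  have inj: "inj_on h {1..<Suc i}" using h by (simp add: greedy_def)
  have zA: "?z \<in> A" using hA i by auto
  have zL: "?z \<in> letters n" using zA A by (auto simp: transversal_def)
  have "?z \<in> h ` {1..<Suc i}" using i by auto
  then have zF: "?z \<notin> ?F" using F(2) by blast
  have tr: "w \<in> A \<Longrightarrow> bar n w \<notin> A" for w using A by (auto simp: transversal_def)
  have hz: "h a \<noteq> ?z" if "a \<in> {1..<i}" for a using inj that i by (auto dest: inj_onD)
  have hx: "\<not> cyc_in (v a) w (h a)" if "a \<in> {1..i}" "w \<in> A" "w \<notin> h ` {1..<a}" for a w
    using h that unfolding greedy_def by auto
  have zna: "?z \<notin> h ` {1..<a}" if "a \<le> i" for a using hz that by fastforce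
  have Fh: "w \<notin> h ` {1..<a}" if "w \<in> ?F" "a \<le> i" for w a
  proof -
    have "h ` {1..<a} \<subseteq> h ` {1..<Suc i}" using that by (intro image_mono) auto
    then show ?thesis using F(2) that by blast
  qed
  have Fz: "\<not> cyc (v i) w ?z" if "w \<in> ?F" for w
    using hx[of i w] F(1) Fh[OF that] that i by (auto simp: cyc_in_def)
  have XF: "transversal n ?X" "?F \<inter> (?X \<union> bar n ` ?X) = {}" "v i \<in> ?X"
    using stage_sets[OF i v] unfolding stage_X_def stage_F_def by auto
  have N: "N = ?X \<union> bar n ` ?X \<union> ?F \<union> bar n ` ?F"
  proof -
    have "{i..bar n i} = insert i {k<..n} \<union> bar n ` insert i {k<..n} \<union> {i<..k} \<union> bar n ` {i<..k}"
    proof (intro set_eqI iffI)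
      fix c assume "c \<in> {i..bar n i}"
      then have "c \<in> insert i {k<..n} \<union> {i<..k} \<or>
          bar n c \<in> insert i {k<..n} \<union> {i<..k} \<and> c = bar n (bar n c)"
        using i by (auto simp: bar_def)
      then show "c \<in> insert i {k<..n} \<union> bar n ` insert i {k<..n} \<union> {i<..k} \<union> bar n ` {i<..k}" by blast
    qed (use i in \<open>auto simp: bar_def\<close>)
    moreover have "v ` bar n ` S = bar n ` v ` S" if "S \<subseteq> letters n" for S
      unfolding image_image using signed_permD(4)[OF v] that by (intro image_cong) auto
    moreover have "insert i {k<..n} \<subseteq> letters n" "{i<..k} \<subseteq> letters n"
      using i by (auto simp: letters_def)
    ultimately show ?thesis unfolding N_def by (simp only: image_Un)
  qed
  have nN: "c \<notin> {i..bar n i}" if "v c \<notin> N" for c using that unfolding N_def by blast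
  have iN: "v i \<in> N" using XF N by blast
  have lower: "\<exists>bs u. stage_walk n i v (stage_lower n k i) bs u \<and> u i = y"
    if "y \<in> ?X \<union> bar n ` ?X" "\<forall>w\<in>?F. \<not> cyc (v i) w y" for y
    using stage_lower_walk(2)[OF i v] that unfolding stage_X_def stage_F_def by blast
  show ?thesis
  proof (cases "?z \<in> N")
    case True
    have "?z \<notin> bar n ` ?F"
    proof
      assume "?z \<in> bar n ` ?F"
      then obtain f where "f \<in> A" "?z = bar n f" using F(1) by blast
      then show False using tr zA by auto
    qed
    then have "?z \<in> ?X \<union> bar n ` ?X" using True zF N by blast
    then obtain bs u where u: "stage_walk n i v (stage_lower n k i) bs u" "u i = ?z"
      using lower Fz by blast
    have "\<exists>bs v'. stage_walk n i u (stage_upper n i) bs v' \<and> v' i = ?z"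
      by (rule stage_upper_exists[OF il stage_lower_fixed(1)[OF i v u(1)]]) (use u in \<open>auto simp: cyc_def\<close>)
    then show ?thesis using u unfolding stage_walk_append by blast
  next
    case zN: False
    obtain d where d: "d \<in> letters n" "v d = ?z" using signed_perm_surj[OF v zL] .
    \<comment> \<open>A position before \<open>i\<close> that starts at \<open>?z\<close> would have
      been assigned \<open>?z\<close> itself, which is still free there.\<close>
    have "\<not> d < i"
    proof
      assume "d < i"
      then have "d \<in> {1..<i}" using d by (auto simp: letters_def)
      then have "cyc_in (v d) ?z (h d)" using hz[of d] d by (auto simp: cyc_in_def)
      then show False using hx[of d ?z] zA zna[of d] \<open>d \<in> {1..<i}\<close> by auto
    qed
    moreover have "d \<notin> {i..bar n i}" using zN d(2) nN[of d] by simp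
    ultimately have dbar: "d \<in> {bar n i<..2 * n}" using d by (auto simp: letters_def)
    have cov: "\<exists>a\<in>{1..<i}. v a = x \<or> v a = bar n x" if x: "x \<in> letters n" "x \<notin> N" for x
    proof -
      obtain c where c: "c \<in> letters n" "v c = x" using signed_perm_surj[OF v x(1)] .
      have "c \<notin> {i..bar n i}" using x(2) c(2) nN[of c] by simp
      then have "c < i \<or> bar n i < c" by auto
      then show ?thesis
      proof
        assume "c < i"
        then show ?thesis using c by (auto simp: letters_def)
      next
        assume "bar n i < c"
        then have "bar n c \<in> {1..<i}" using c il by (auto simp: letters_def bar_def)
        moreover have "v (bar n c) = bar n x" using signed_permD(4)[OF v c(1)] c(2) by simp
        ultimately show ?thesis by blast
      qed
    qed
    define S where "S = {y \<in> N. half_less n y ?z}"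
    have finS: "finite S" by (simp add: S_def N_def)
    have hin: "inj_on h {1..<i}" "h ` {1..<i} \<subseteq> A" using h inj_on_subset[of h "{1..<Suc i}" "{1..<i}"]
      by (auto simp: greedy_def)
    have zz: "h a \<noteq> ?z \<and> h a \<noteq> bar n ?z" if "a \<in> {1..<i}" for a
      using hz[OF that] hA[of a] tr[OF zA] that by auto
    have "S \<noteq> {}"
    proof
      assume S: "S = {}"
      \<comment> \<open>The half of \<open>?z\<close> up to \<open>?z\<close>. With \<open>S\<close>
        empty, all these pairs occur before \<open>i\<close>; and a search starting in
        \<open>?M\<close> or its bars cannot leave them without passing the free letter
        \<open>?z\<close>, also when it wraps around.\<close>
      let ?M = "{x \<in> letters n. (x \<le> n \<longleftrightarrow> ?z \<le> n) \<and> x \<le> ?z}"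
      have barM: "x \<in> bar n ` ?M \<longleftrightarrow> x \<in> letters n \<and> \<not> (x \<le> n \<longleftrightarrow> ?z \<le> n) \<and> bar n ?z \<le> x" for x
      proof
        assume "x \<in> bar n ` ?M"
        then show "x \<in> letters n \<and> \<not> (x \<le> n \<longleftrightarrow> ?z \<le> n) \<and> bar n ?z \<le> x"
          using zL by (auto simp: bar_less_iff bar_letters)
      next
        assume x: "x \<in> letters n \<and> \<not> (x \<le> n \<longleftrightarrow> ?z \<le> n) \<and> bar n ?z \<le> x"
        then have "bar n x \<in> ?M" "x = bar n (bar n x)"
          using zL by (auto simp: bar_def letters_def)
        then show "x \<in> bar n ` ?M" by blast
      qed
      have "card {?z} \<le> card ({} :: nat set)"
      proof (rule pigeonhole_transversal[where M = ?M and v = v, OF A hin])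
        show "?M \<inter> bar n ` ?M = {}" using barM by blast
        show "\<exists>a\<in>{1..<i}. v a = x \<or> v a = bar n x" if x: "x \<in> ?M" for x
        proof (rule cov)
          show "x \<notin> N"
          proof
            assume "x \<in> N"
            then have "x \<in> S" using x zN by (auto simp: S_def half_less_def le_less)
            then show False using S by simp
          qed
        qed (use x in auto)
        show "h a \<in> ?M \<union> bar n ` ?M \<and> (\<forall>x\<in>{?z}. h a \<noteq> x \<and> h a \<noteq> bar n x)"
          if a: "a \<in> {1..<i} - {}" "v a \<in> ?M \<union> bar n ` ?M" for a
        proof -
          have "h a \<in> letters n" using hA[of a] a A by (auto simp: transversal_def)
          moreover have "\<not> cyc_in (v a) ?z (h a)" using hx[of a ?z] zA zna[of a] a by auto
          ultimately have "h a \<in> ?M \<or> h a \<in> bar n ` ?M"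
            using a(2) zz[of a] a(1) unfolding Un_iff barM
            by (auto simp: cyc_in_def cyc_def)
          then show ?thesis using zz[of a] a(1) by blast
        qed
      qed (use zL in auto)
      then show False by simp
    qed
    define y where "y = Max S"
    have yS: "y \<in> S" using Max_in[OF finS \<open>S \<noteq> {}\<close>] by (simp add: y_def)
    have top: "\<not> (y < x \<and> x < ?z)" if "x \<in> N" for x
    proof
      assume H: "y < x \<and> x < ?z"
      then have "x \<in> S" using yS that by (auto simp: S_def half_less_def)
      then have "x \<le> y" unfolding y_def by (rule Max_ge[OF finS])
      then show False using H by simp
    qed
    have yz: "y < ?z" "half_less n y ?z" "y \<in> N" using yS by (auto simp: S_def half_less_def)
    have iz: "v i \<noteq> ?z" using iN zN by metis
    have nyi: "\<not> cyc y (v i) ?z" using top[OF iN] yz by (auto simp: cyc_def)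
    have Fy: "\<not> cyc (v i) w y" if "w \<in> ?F" for w
      using cyc_extend[of "v i" w y ?z] nyi iz yz Fz[OF that] by blast
    have "y \<notin> ?F"
    proof
      assume yF: "y \<in> ?F"
      then have "y \<noteq> v i" using XF(2,3) by (metis IntI UnI1 empty_iff)
      then have "cyc (v i) y ?z" using nyi iz yz(1) by (auto simp: cyc_def)
      then show False using Fz[OF yF] by blast
    qed
    moreover have "y \<notin> bar n ` ?F"
    proof
      assume "y \<in> bar n ` ?F"
      then obtain f where f: "f \<in> ?F" "y = bar n f" by blast
      have fA: "f \<in> A" "f \<in> letters n" using f F(1) A by (auto simp: transversal_def)
      have yf: "bar n y = f" "y \<in> letters n" using f fA bar_letters by auto
      \<comment> \<open>By the choice of \<open>y\<close> these letters are outside the window.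
        Searches starting in them stop before \<open>?z\<close>; searches starting in their bars,
        the interval from \<open>bar n ?z\<close> up to but excluding \<open>f\<close>, stop before
        \<open>f\<close>, which is a target letter held by a position after
        \<open>i\<close>.\<close>
      let ?M = "{y<..?z}"
      have M_sub: "?M \<subseteq> letters n" using zL yf by (auto simp: letters_def)
      have barM: "x \<in> bar n ` ?M \<longleftrightarrow> bar n ?z \<le> x \<and> x < f" for x
      proof
        assume "x \<in> bar n ` ?M"
        then show "bar n ?z \<le> x \<and> x < f" using zL yf M_sub bar_less_iff[of _ n y] bar_less_iff[of ?z n _]
          by (auto simp: bar_less_iff)
      next
        assume x: "bar n ?z \<le> x \<and> x < f"
        then have "bar n x \<in> ?M" "x = bar n (bar n x)"
          using zL yf fA by (auto simp: bar_def letters_def)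
        then show "x \<in> bar n ` ?M" by blast
      qed
      have "card {?z} \<le> card ({} :: nat set)"
      proof (rule pigeonhole_transversal[where M = ?M and v = v, OF A hin])
        have halves: "f \<le> n \<longleftrightarrow> \<not> y \<le> n" "bar n ?z \<le> n \<longleftrightarrow> \<not> ?z \<le> n"
          using f fA zL by (auto simp: bar_less_iff)
        show "?M \<inter> bar n ` ?M = {}"
        proof (rule ccontr)
          assume "?M \<inter> bar n ` ?M \<noteq> {}"
          then obtain c where "c \<in> ?M" "c \<in> bar n ` ?M" by blast
          then have "y < c" "c \<le> ?z" "bar n ?z \<le> c" "c < f" using barM[of c] by auto
          then show False using halves yz(2) by (auto simp: half_less_def)
        qed
        show "\<exists>a\<in>{1..<i}. v a = x \<or> v a = bar n x" if x: "x \<in> ?M" for x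
        proof (rule cov)
          show "x \<notin> N" using top[of x] zN x by (cases "x = ?z") auto
        qed (use x M_sub in auto)
        show "h a \<in> ?M \<union> bar n ` ?M \<and> (\<forall>x\<in>{?z}. h a \<noteq> x \<and> h a \<noteq> bar n x)"
          if a: "a \<in> {1..<i} - {}" "v a \<in> ?M \<union> bar n ` ?M" for a
        proof (cases "v a \<in> ?M")
          case True
          have "\<not> cyc_in (v a) ?z (h a)" using hx[of a ?z] zA zna[of a] a by auto
          then have "v a \<le> h a \<and> h a < ?z" using not_cyc_in_le zz[of a] a(1) True by auto
          then show ?thesis using True zz[of a] a(1) by auto
        next
          case False
          then have va: "bar n ?z \<le> v a" "v a < f" using a(2) barM by auto
          have nf: "f \<notin> h ` {1..<a}" "h a \<noteq> f" using Fh[OF f(1), of a] Fh[OF f(1), of i] a(1) by auto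
          have "\<not> cyc_in (v a) f (h a)" using hx[of a f] fA nf a by auto
          then have "v a \<le> h a \<and> h a < f" using not_cyc_in_le nf va by auto
          then have "h a \<in> bar n ` ?M" using barM va by auto
          then show ?thesis using zz[of a] a(1) by blast
        qed
      qed (use M_sub yz in auto)
      then show False by simp
    qed
    ultimately have "y \<in> ?X \<union> bar n ` ?X" using yz(3) N by blast
    then obtain bs u where u: "stage_walk n i v (stage_lower n k i) bs u" "u i = y"
      using lower Fy by blast
    note lo = stage_lower_fixed[OF i v u(1)]
    have "u d = ?z"
    proof -
      have "bar n d \<in> {1..k}" "bar n d \<noteq> i" "bar n d \<in> letters n"
        using dbar i bar_letters[OF d(1)] by (auto simp: bar_def)
      then have "u (bar n (bar n d)) = v (bar n (bar n d))"
        using lo(2)[of "bar n d"] signed_permD(4)[OF lo(1), of "bar n d"] signed_permD(4)[OF v, of "bar n d"]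
        by simp
      then show ?thesis using d by simp
    qed
    then have "?z \<in> u ` {bar n i<..2 * n}" using dbar imageI by metis
    moreover have "\<not> cyc (u i) (u c) ?z" if "i < c" "c \<le> bar n i" for c
    proof -
      have "u c \<in> N" unfolding N_def lo(3)[symmetric] using that by auto
      then show ?thesis using top yz(1) u(2) by (auto simp: cyc_def)
    qed
    ultimately have "\<exists>bs v'. stage_walk n i u (stage_upper n i) bs v' \<and> v' i = ?z"
      using stage_upper_exists[OF il lo(1)] yz(2) u(2) by blast
    then show ?thesis using u unfolding stage_walk_append by blast
  qed
qed

section \<open>Walks along a left block\<close>

primrec stages :: "nat \<Rightarrow> (nat \<Rightarrow> nat list) \<Rightarrow> nat \<Rightarrow> root list" where
  "stages n f 0 = []"
| "stages n f (Suc i) = map (stage_root n (Suc i)) (f (Suc i)) @ stages n f i"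

lemma transversal_finite: "transversal n A \<Longrightarrow> finite A"
  using finite_subset[OF _ finite_letters] by (auto simp: transversal_def)

lemma transversal_image:
  assumes v: "v \<in> signed_perms n" and "k \<le> n"
  shows "transversal n (v ` {1..k})"
proof -
  have "v a \<in> letters n" if "a \<in> {1..k}" for a
    using that assms signed_permD(3)[OF v] by (auto simp: letters_def)
  moreover have "bar n (v a) \<noteq> v b" if "a \<in> {1..k}" "b \<in> {1..k}" for a b
  proof
    assume "bar n (v a) = v b"
    then have "v (bar n a) = v b" using signed_permD(4)[OF v] that assms by (auto simp: letters_def)
    then have "bar n a = b" using signed_permD(2)[OF v] by (auto dest: injD)
    then show False using that assms by (auto simp: bar_def)
  qed
  ultimately show ?thesis unfolding transversal_def by blast
qed

lemma card_signed_image: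
  assumes "v \<in> signed_perms n"
  shows "card (v ` {1..k}) = k"
  using card_image[OF inj_on_signed[OF assms]] by simp

lemma greedy_split:
  assumes A: "finite A" "card A = k" and v: "v \<in> signed_perms n" and i: "i \<le> k"
    and h: "inj_on h {1..<Suc i}" "h ` {1..<Suc i} \<subseteq> A"
    and F: "v ` {i<..k} \<subseteq> A" "h ` {1..<Suc i} \<inter> v ` {i<..k} = {}"
  shows "A = h ` {1..<Suc i} \<union> v ` {i<..k}"
proof -
  have "card (h ` {1..<Suc i} \<union> v ` {i<..k}) = card (h ` {1..<Suc i}) + card (v ` {i<..k})"
    using F(2) by (intro card_Un_disjoint) auto
  also have "\<dots> = k"
    using card_image[OF h(1)] card_image[OF inj_on_signed[OF v, of "{i<..k}"]] i by simp
  finally have "card (h ` {1..<Suc i} \<union> v ` {i<..k}) = card A" using A by simp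
  then show ?thesis using card_subset_eq[OF A(1)] h(2) F(1) by (metis Un_least)
qed

text \<open>The greedy assignment towards the final set is recovered by induction: a solution for
  the remaining stages also solves the problem before the current stage, and it is extended by the
  value placed at \<open>Suc i\<close>. The extension is greedy because the target consists of the
  earlier images, this value and the values waiting at later positions, and the last are not
  passed.\<close>

lemma stages_full_sound:
  assumes "i \<le> k" "k \<le> n" "v \<in> signed_perms n" "qwalk n v (stages n (full_stage n k) i) bs v'"
  shows "v' \<in> signed_perms n \<and> (\<forall>c. i < c \<and> c \<le> k \<longrightarrow> v' c = v c) \<and>
    (\<exists>h. greedy (v' ` {1..k}) v (Suc i) h \<and> h ` {1..<Suc i} \<inter> v ` {i<..k} = {})"
  using assms
proof (induction i arbitrary: v bs)
  case 0
  then show ?case by (auto simp: greedy_def)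
next
  case (Suc i)
  have si: "1 \<le> Suc i" "Suc i \<le> k" "k \<le> n" using Suc.prems by auto
  obtain bs1 bs2 v1 where w: "stage_walk n (Suc i) v (full_stage n k (Suc i)) bs1 v1"
    "qwalk n v1 (stages n (full_stage n k) i) bs2 v'"
    using Suc.prems(4) unfolding stages.simps qwalk_append by blast
  note st = full_stage_walk[OF si Suc.prems(3) w(1)]
  let ?A = "v' ` {1..k}" and ?z = "v1 (Suc i)"
  from Suc.IH[OF _ Suc.prems(2) st(1) w(2)] si obtain h where
    v': "v' \<in> signed_perms n" "\<And>c. i < c \<Longrightarrow> c \<le> k \<Longrightarrow> v' c = v1 c" and
    h: "greedy ?A v1 (Suc i) h" "h ` {1..<Suc i} \<inter> v1 ` {i<..k} = {}" by auto
  have F1: "v1 ` {i<..k} = insert ?z (v ` {Suc i<..k})"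
  proof -
    have "{i<..k} = insert (Suc i) {Suc i<..k}" using si by auto
    then show ?thesis using st(2) by auto
  qed
  have v1v: "v1 c = v c" if "c \<in> {Suc i<..k}" for c using st(2) that by auto
  have zA: "?z \<in> ?A" using v'(2)[of "Suc i"] si by (metis atLeastAtMost_iff imageI lessI)
  have zh: "?z \<notin> h ` {1..<Suc i}" using h(2) F1 by blast
  have tA: "transversal n ?A" by (rule transversal_image[OF v'(1) si(3)])
  have g: "greedy ?A v (Suc i) h" using st(4)[OF tA zA zh] h(1) by simp
  have FA: "v1 ` {i<..k} \<subseteq> ?A"
  proof
    fix x assume "x \<in> v1 ` {i<..k}"
    then obtain c where c: "x = v1 c" "i < c" "c \<le> k" by auto
    then have "x = v' c" using v'(2) by simp
    then show "x \<in> ?A" using c by auto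
  qed
  have Aeq: "?A = h ` {1..<Suc i} \<union> v1 ` {i<..k}"
    by (rule greedy_split[OF _ card_signed_image[OF v'(1)] st(1)]) (use g FA h(2) si in \<open>auto simp: greedy_def\<close>)
  define g' where "g' = h(Suc i := ?z)"
  have img: "g' ` {1..<a} = h ` {1..<a}" if "a \<le> Suc i" for a
    unfolding g'_def using that by (intro image_cong) auto
  have ins: "{1..<Suc (Suc i)} = insert (Suc i) {1..<Suc i}" by auto
  have gimg: "g' ` {1..<Suc (Suc i)} = insert ?z (h ` {1..<Suc i})"
    unfolding ins image_insert img[OF order.refl] by (simp add: g'_def)
  have inj: "inj_on g' {1..<Suc (Suc i)}"
    unfolding ins inj_on_insert img[OF order.refl]
  proof
    have "inj_on h {1..<Suc i}" using g by (simp add: greedy_def)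
    then show "inj_on g' {1..<Suc i}" by (rule inj_on_cong[THEN iffD1, rotated]) (auto simp: g'_def)
    have "{1..<Suc i} - {Suc i} = {1..<Suc i}" by auto
    then show "g' (Suc i) \<notin> g' ` ({1..<Suc i} - {Suc i})"
      using zh img[OF order.refl] by (simp add: g'_def)
  qed
  have zF: "?z \<notin> v ` {Suc i<..k}"
  proof
    assume "?z \<in> v ` {Suc i<..k}"
    then obtain c where "?z = v c" "c \<in> {Suc i<..k}" by blast
    then have "v1 (Suc i) = v1 c" "c \<noteq> Suc i" using v1v by auto
    then show False using signed_permD(2)[OF st(1)] by (auto dest: injD)
  qed
  have "w \<in> g' ` {1..<a}" if a: "a \<in> {1..<Suc (Suc i)}" and w: "w \<in> ?A" "cyc_in (v a) w (g' a)" for a w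
  proof (cases "a = Suc i")
    case True
    have "w \<noteq> ?z" using w(2) True by (auto simp: g'_def cyc_in_def cyc_def)
    moreover have "w \<notin> v ` {Suc i<..k}"
    proof
      assume "w \<in> v ` {Suc i<..k}"
      then obtain c where c: "w = v c" "Suc i < c" "c \<le> k" by auto
      then have "w \<noteq> v (Suc i)" using signed_permD(2)[OF Suc.prems(3)] by (auto dest: injD)
      then show False using w(2) True st(3)[OF c(2,3)] c(1) by (auto simp: g'_def cyc_in_def)
    qed
    ultimately have "w \<in> h ` {1..<Suc i}" using w(1) Aeq F1 by blast
    then show ?thesis using True img[of a] by simp
  next
    case False
    then have a': "a \<in> {1..<Suc i}" using a by auto
    then have "w \<in> h ` {1..<a}" using g w False unfolding greedy_def g'_def by auto
    then show ?thesis using img[of a] a' by auto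
  qed
  moreover have "g' ` {1..<Suc (Suc i)} \<subseteq> ?A" unfolding gimg using zA g by (auto simp: greedy_def)
  ultimately have "greedy ?A v (Suc (Suc i)) g'" using inj unfolding greedy_def by blast
  moreover have "g' ` {1..<Suc (Suc i)} \<inter> v ` {Suc i<..k} = {}"
    unfolding gimg using zF h(2) F1 by blast
  moreover have "v' c = v c" if "Suc i < c" "c \<le> k" for c using v'(2) st(2) that by simp
  ultimately show ?case using v'(1) by blast
qed

text \<open>One assignment \<open>h\<close> serves all stages: each stage realizes
  \<open>h (Suc i)\<close>, and the rest of \<open>h\<close> stays greedy for the values so
  altered.\<close>

lemma stages_full_exists:
  assumes "i \<le> k" "k \<le> n" "v \<in> signed_perms n" "transversal n A" "card A = k"
    "v ` {i<..k} \<subseteq> A" "greedy A v (Suc i) h" "h ` {1..<Suc i} \<inter> v ` {i<..k} = {}"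
  shows "\<exists>bs v'. qwalk n v (stages n (full_stage n k) i) bs v' \<and> v' ` {1..k} = A"
  using assms(1-3,6-8)
proof (induction i arbitrary: v)
  case 0
  have "finite A" by (rule transversal_finite[OF assms(4)])
  moreover have "{0<..k} = {1..k}" by auto
  ultimately have "v ` {1..k} = A"
    using 0 assms(5) card_subset_eq[of A "v ` {1..k}"] card_signed_image[OF 0(3), of k] by auto
  then show ?case by auto
next
  case (Suc i)
  have si: "1 \<le> Suc i" "Suc i \<le> k" "k \<le> n" using Suc.prems by auto
  obtain bs1 v1 where w: "stage_walk n (Suc i) v (full_stage n k (Suc i)) bs1 v1" "v1 (Suc i) = h (Suc i)"
    using full_stage_exists[OF si Suc.prems(3) assms(4) Suc.prems(4,6,5)] by blast
  note st = full_stage_walk[OF si Suc.prems(3) w(1)]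
  have inj: "inj_on h {1..<Suc (Suc i)}" and hA: "h ` {1..<Suc (Suc i)} \<subseteq> A"
    using Suc.prems(5) by (auto simp: greedy_def)
  have F1: "v1 ` {i<..k} = insert (h (Suc i)) (v ` {Suc i<..k})"
  proof -
    have "{i<..k} = insert (Suc i) {Suc i<..k}" using si by auto
    then show ?thesis using st(2) w(2) by auto
  qed
  have hz: "h (Suc i) \<notin> h ` {1..<Suc i}" using inj_on_not_before[OF inj] by simp
  have sub: "h ` {1..<Suc i} \<subseteq> h ` {1..<Suc (Suc i)}" by (intro image_mono) auto
  have hm: "h (Suc i) \<in> h ` {1..<Suc (Suc i)}" by simp
  have "greedy A v (Suc i) h"
    using Suc.prems(5) inj_on_subset[OF inj, of "{1..<Suc i}"] sub by (auto simp: greedy_def)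
  then have "greedy A v1 (Suc i) h" using st(4)[OF assms(4), of h] w(2) subsetD[OF hA hm] hz by auto
  moreover have "v1 ` {i<..k} \<subseteq> A" unfolding F1 using Suc.prems(4) hA hm by blast
  moreover have "h ` {1..<Suc i} \<inter> v1 ` {i<..k} = {}"
  proof -
    have "h ` {1..<Suc i} \<inter> v ` {Suc i<..k} = {}"
      using Int_mono[OF sub order.refl] Suc.prems(6) by (metis subset_empty)
    then show ?thesis unfolding F1 using hz by simp
  qed
  ultimately obtain bs2 v' where "qwalk n v1 (stages n (full_stage n k) i) bs2 v'" "v' ` {1..k} = A"
    using Suc.IH[OF _ si(3) st(1)] si by auto
  then show ?case using w(1) unfolding stages.simps qwalk_append by blast
qed

text \<open>The final set splits into the greedy images of the earlier positions, the values waiting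
  at later positions, and the value placed at \<open>Suc i\<close>. The first two parts depend only
  on \<open>v\<close> and the set, so the third does as well, and \<open>full_stage_unique\<close>
  yields the bits.\<close>

lemma stages_full_unique:
  assumes "i \<le> k" "k \<le> n" "v \<in> signed_perms n"
    "qwalk n v (stages n (full_stage n k) i) bs v'" "qwalk n v (stages n (full_stage n k) i) bs' v''"
    "v' ` {1..k} = v'' ` {1..k}"
  shows "bs = bs'"
  using assms
proof (induction i arbitrary: v bs bs')
  case (Suc i)
  have si: "1 \<le> Suc i" "Suc i \<le> k" "k \<le> n" "i \<le> k" using Suc.prems by auto
  obtain bs1 bs2 v1 where w: "bs = bs1 @ bs2" "stage_walk n (Suc i) v (full_stage n k (Suc i)) bs1 v1"
    "qwalk n v1 (stages n (full_stage n k) i) bs2 v'"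
    using Suc.prems(4) unfolding stages.simps qwalk_append by blast
  obtain cs1 cs2 w1 where w': "bs' = cs1 @ cs2" "stage_walk n (Suc i) v (full_stage n k (Suc i)) cs1 w1"
    "qwalk n w1 (stages n (full_stage n k) i) cs2 v''"
    using Suc.prems(5) unfolding stages.simps qwalk_append by blast
  let ?A = "v' ` {1..k}"
  have key: "\<exists>h. greedy ?A v (Suc i) h \<and> u (Suc i) \<notin> v ` {Suc i<..k} \<and>
      ?A = h ` {1..<Suc i} \<union> insert (u (Suc i)) (v ` {Suc i<..k}) \<and> u (Suc i) \<notin> h ` {1..<Suc i}"
    if u: "stage_walk n (Suc i) v (full_stage n k (Suc i)) ds u"
      "qwalk n u (stages n (full_stage n k) i) es u'" "u' ` {1..k} = ?A" for ds es u u'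
  proof -
    note st = full_stage_walk[OF si(1-3) Suc.prems(3) u(1)]
    obtain h where u': "u' \<in> signed_perms n" "\<And>c. i < c \<Longrightarrow> c \<le> k \<Longrightarrow> u' c = u c" and
      h: "greedy ?A u (Suc i) h" "h ` {1..<Suc i} \<inter> u ` {i<..k} = {}"
      using stages_full_sound[OF si(4,3) st(1) u(2)] u(3) by auto
    have F1: "u ` {i<..k} = insert (u (Suc i)) (v ` {Suc i<..k})"
    proof -
      have "{i<..k} = insert (Suc i) {Suc i<..k}" using si by auto
      then show ?thesis using st(2) by auto
    qed
    have FA: "u ` {i<..k} \<subseteq> ?A"
    proof
      fix x assume "x \<in> u ` {i<..k}"
      then obtain c where c: "x = u c" "i < c" "c \<le> k" by auto
      then have "x = u' c" using u'(2) by simp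
      then show "x \<in> ?A" unfolding u(3)[symmetric] using c by auto
    qed
    have A: "?A = h ` {1..<Suc i} \<union> u ` {i<..k}"
      by (rule greedy_split[OF _ _ st(1) si(4)])
        (use card_signed_image[OF u'(1), of k] u(3) h FA in \<open>auto simp: greedy_def\<close>)
    have nh: "u (Suc i) \<notin> h ` {1..<Suc i}" using h(2) F1 by blast
    have "transversal n ?A" using transversal_image[OF u'(1) si(3)] u(3) by simp
    then have "greedy ?A v (Suc i) h" using st(4)[of ?A h] FA F1 nh h(1) by blast
    moreover have "u (Suc i) \<notin> v ` {Suc i<..k}"
    proof
      assume "u (Suc i) \<in> v ` {Suc i<..k}"
      then obtain c where "u (Suc i) = v c" "Suc i < c" "c \<le> k" by auto
      then have "u (Suc i) = u c" "c \<noteq> Suc i" using st(2) by auto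
      then show False using signed_permD(2)[OF st(1)] by (auto dest: injD)
    qed
    ultimately show ?thesis using A[unfolded F1] nh by blast
  qed
  obtain h where h: "greedy ?A v (Suc i) h" "v1 (Suc i) \<notin> v ` {Suc i<..k}"
    "?A = h ` {1..<Suc i} \<union> insert (v1 (Suc i)) (v ` {Suc i<..k})" "v1 (Suc i) \<notin> h ` {1..<Suc i}"
    using key[OF w(2,3) refl] by blast
  obtain g where g: "greedy ?A v (Suc i) g" "w1 (Suc i) \<notin> v ` {Suc i<..k}"
    "?A = g ` {1..<Suc i} \<union> insert (w1 (Suc i)) (v ` {Suc i<..k})" "w1 (Suc i) \<notin> g ` {1..<Suc i}"
    using key[OF w'(2,3) Suc.prems(6)[symmetric]] by blast
  have "h ` {1..<Suc i} = g ` {1..<Suc i}"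
    using greedy_unique[OF h(1) g(1)] by (intro image_cong) auto
  moreover have "v1 (Suc i) \<in> ?A" by (subst h(3)) simp
  ultimately have "v1 (Suc i) = w1 (Suc i)" using h(2,4) by (subst (asm) g(3)) auto
  then have b1: "bs1 = cs1" using full_stage_unique[OF si(1-3) Suc.prems(3) w(2) w'(2)] by blast
  then have v1: "v1 = w1" using qwalk_determ w(2) w'(2) by blast
  have "bs2 = cs2"
    using Suc.IH[OF si(4,3) full_stage_walk(1)[OF si(1-3) Suc.prems(3) w(2)] w(3)] w'(3) v1 Suc.prems(6)
    by blast
  then show ?case using w(1) w'(1) b1 by simp
qed auto

section \<open>Reversed blocks as sequences of stages\<close>

lemma map_bar_rev_upt:
  assumes "b \<le> 2 * n + 1"
  shows "map (bar n) (rev [a..<b]) = [2 * n + 2 - b..<2 * n + 2 - a]"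
  using assms by (intro nth_equalityI) (auto simp: bar_def rev_nth)

lemma rev_Gamma_row_l:
  assumes "1 \<le> i" "i \<le> k" "k \<le> n"
  shows "rev (Gamma_row_l n k i) = map (stage_root n i) (full_stage n k i)"
proof -
  have 1: "map (\<lambda>j. (i, j)) [k + 1..<n + 1] = map (stage_root n i) [k + 1..<n + 1]"
    using assms by (auto simp: stage_root_def bar_def)
  have 2: "[(i, bar n i)] = map (stage_root n i) [bar n i]" by (simp add: stage_root_def)
  have u3: "[n + 1..<2 * n + 1 - k] = map (bar n) (rev [k + 1..<n + 1])"
    using map_bar_rev_upt[of "n + 1" n "k + 1"] assms by simp
  have 3: "map (\<lambda>j. (i, bar n j)) (rev [k + 1..<n + 1]) = map (stage_root n i) [n + 1..<2 * n + 1 - k]"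
    unfolding u3 using assms by (auto simp: stage_root_def bar_def)
  have u4: "stage_upper n i = map (bar n) (rev [1..<i])"
    using map_bar_rev_upt[of i n 1] assms by (simp add: stage_upper_def)
  have 4: "map (\<lambda>j. (j, bar n i)) (rev [1..<i]) = map (stage_root n i) (stage_upper n i)"
    unfolding u4 using assms by (auto simp: stage_root_def bar_def)
  show ?thesis
    unfolding Gamma_row_l_def stage_lower_def map_append rev_append 1[symmetric] 2[symmetric]
      3[symmetric] 4[symmetric] by (simp add: rev_map)
qed

lemma rev_Gamma_row:
  assumes "1 \<le> i" "i \<le> n"
  shows "rev (Gamma_row n i) = map (stage_root n i) (stage_upper n i)"
proof -
  have u4: "stage_upper n i = map (bar n) (rev [1..<i])"
    using map_bar_rev_upt[of i n 1] assms by (simp add: stage_upper_def)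
  show ?thesis
    unfolding u4 Gamma_row_def using assms by (auto simp: stage_root_def bar_def rev_map)
qed

lemma rev_Gamma_l:
  assumes "k \<le> n"
  shows "rev (Gamma_l n k) = stages n (full_stage n k) k"
proof -
  have "rev (concat (map (Gamma_row_l n k) [1..<i + 1])) = stages n (full_stage n k) i" if "i \<le> k" for i
    using that by (induction i) (use assms rev_Gamma_row_l in auto)
  then show ?thesis by (simp add: Gamma_l_def)
qed

lemma rev_Gamma_r:
  assumes "k \<le> n"
  shows "rev (Gamma_r n k) = stages n (stage_upper n) k"
proof -
  have "rev (concat (map (Gamma_row n) [2..<i + 1])) = stages n (stage_upper n) i" if "i \<le> k" for i
    using that
  proof (induction i)
    case (Suc i)
    show ?case
    \<comment> \<open>The right block starts with index 2; the stage of position 1, added here for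
      uniformity, is an empty segment.\<close>
    proof (cases "i = 0")
      case True
      then show ?thesis by (simp add: stage_upper_def)
    next
      case False
      then have "[2..<Suc i + 1] = [2..<i + 1] @ [Suc i]" by simp
      then show ?thesis using Suc assms rev_Gamma_row[of "Suc i" n] by simp
    qed
  qed simp
  then show ?thesis by (simp add: Gamma_r_def)
qed

lemma Gamma_l_walk:
  assumes "k \<le> n" "v \<in> signed_perms n"
  shows "qwalk n v (rev (Gamma_l n k)) bs v' \<Longrightarrow> v' \<in> signed_perms n"
    and "transversal n A \<Longrightarrow> card A = k \<Longrightarrow>
      \<exists>bs v'. qwalk n v (rev (Gamma_l n k)) bs v' \<and> v' ` {1..k} = A"
    and "qwalk n v (rev (Gamma_l n k)) bs v' \<Longrightarrow> qwalk n v (rev (Gamma_l n k)) bs' v'' \<Longrightarrow>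
      v' ` {1..k} = v'' ` {1..k} \<Longrightarrow> bs = bs'"
proof -
  show "v' \<in> signed_perms n" if "qwalk n v (rev (Gamma_l n k)) bs v'"
    using stages_full_sound[OF order.refl assms] that rev_Gamma_l[OF assms(1)] by simp
  show "\<exists>bs v'. qwalk n v (rev (Gamma_l n k)) bs v' \<and> v' ` {1..k} = A"
    if A: "transversal n A" "card A = k"
  proof -
    have "finite A" by (rule transversal_finite[OF A(1)])
    then obtain h where "greedy A v (Suc k) h" using greedy_exists[of A "Suc k" v] A by auto
    then show ?thesis
      using stages_full_exists[OF order.refl assms A] rev_Gamma_l[OF assms(1)] by simp
  qed
  show "bs = bs'" if "qwalk n v (rev (Gamma_l n k)) bs v'" "qwalk n v (rev (Gamma_l n k)) bs' v''"
      "v' ` {1..k} = v'' ` {1..k}"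
    using stages_full_unique[OF order.refl assms _ _ that(3)] that(1,2) rev_Gamma_l[OF assms(1)] by metis
qed

section \<open>Walks along a right block\<close>

text \<open>The positive signs at absolute values from \<open>s\<close> on; an integer, because
  differences of such counts are compared.\<close>

definition pos_count :: "nat \<Rightarrow> nat set \<Rightarrow> nat \<Rightarrow> int" where
  "pos_count n R s = int (card {r \<in> R. s \<le> r \<and> r \<le> n})"

definition abs_set :: "nat \<Rightarrow> nat set \<Rightarrow> nat set" where
  "abs_set n R = {r \<in> {1..n}. r \<in> R \<or> bar n r \<in> R}"

text \<open>
  \<open>R'\<close> arises from \<open>R\<close> by moving positive signs to larger absolute values within the blocks of
  consecutive absolute values; these blocks end at the numbers \<open>s\<close> in the last condition.
\<close>

definition sign_dom :: "nat \<Rightarrow> nat set \<Rightarrow> nat set \<Rightarrow> bool" where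
  "sign_dom n R R' \<longleftrightarrow> abs_set n R = abs_set n R' \<and>
     (\<forall>s. pos_count n R s \<le> pos_count n R' s \<and>
       (s \<notin> abs_set n R \<longrightarrow> pos_count n R s = pos_count n R' s))"

lemma pos_count_insert:
  assumes "finite R" "a \<notin> R"
  shows "pos_count n (insert a R) s = pos_count n R s + of_bool (s \<le> a \<and> a \<le> n)"
proof -
  have "{r \<in> insert a R. s \<le> r \<and> r \<le> n} =
      (if s \<le> a \<and> a \<le> n then insert a {r \<in> R. s \<le> r \<and> r \<le> n} else {r \<in> R. s \<le> r \<and> r \<le> n})"
    by auto
  then show ?thesis using assms by (auto simp: pos_count_def)
qed

lemma pos_count_Suc:
  assumes "finite R" "m \<le> n"
  shows "pos_count n R m = pos_count n R (Suc m) + of_bool (m \<in> R)"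
proof -
  have "{r \<in> R. m \<le> r \<and> r \<le> n} =
      (if m \<in> R then insert m {r \<in> R. Suc m \<le> r \<and> r \<le> n} else {r \<in> R. Suc m \<le> r \<and> r \<le> n})"
    using assms(2) by (auto simp: Suc_le_eq le_less)
  then show ?thesis using assms by (auto simp: pos_count_def)
qed

lemma pos_count_above: "n < s \<Longrightarrow> pos_count n R s = 0"
  by (auto simp: pos_count_def)

text \<open>The thresholds whose count rises by one in the swap: a positive sign moves from
  \<open>x\<close> to \<open>z\<close> if \<open>x\<close> is unbarred, and from
  \<open>bar n z\<close> to \<open>bar n x\<close> otherwise.\<close>

definition in_window :: "nat \<Rightarrow> nat \<Rightarrow> nat \<Rightarrow> nat \<Rightarrow> bool" where
  "in_window n x z s \<longleftrightarrow> (if x \<le> n then x < s \<and> s \<le> z else bar n z < s \<and> s \<le> bar n x)"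

text \<open>A right-block stage seen on sets: the current position holds \<open>x\<close>, the
  earlier ones hold \<open>G\<close>. It can take \<open>z\<close> in exchange at the mirror of an
  earlier position, and every letter passed must belong, up to bar, to \<open>G\<close>, since a
  pair held by a later position would block.\<close>

definition swap_ok :: "nat \<Rightarrow> nat \<Rightarrow> nat set \<Rightarrow> nat \<Rightarrow> bool" where
  "swap_ok n x G z \<longleftrightarrow> z = x \<or> half_less n x z \<and> bar n z \<in> G \<and>
     (\<forall>c. x < c \<and> c < z \<longrightarrow> c \<in> G \<or> bar n c \<in> G)"

definition swapped :: "nat \<Rightarrow> nat \<Rightarrow> nat set \<Rightarrow> nat \<Rightarrow> nat set" where
  "swapped n x G z = insert (bar n x) G - {bar n z}"

context
  fixes n x :: nat and G R' :: "nat set"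
  assumes R: "transversal n (insert x G)" "x \<notin> G" and R': "transversal n R'"
begin

lemma transversal_R: "a \<in> insert x G \<Longrightarrow> a \<in> letters n" "a \<in> insert x G \<Longrightarrow> bar n a \<notin> insert x G"
  "a \<in> R' \<Longrightarrow> a \<in> letters n" "a \<in> R' \<Longrightarrow> bar n a \<notin> R'"
  using R R' by (auto simp: transversal_def)

lemma finite_R: "finite G" "finite R'"
  using transversal_finite[OF R(1)] transversal_finite[OF R'] by auto

lemma swap_okD:
  assumes "swap_ok n x G z" "z \<in> letters n"
  shows "z \<notin> G" "bar n z \<noteq> x" "x \<le> n \<longleftrightarrow> z \<le> n" "x \<le> z"
proof -
  have xL: "x \<in> letters n" using transversal_R(1) by simp
  show "z \<notin> G"
  proof
    assume z: "z \<in> G"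
    then have "z \<noteq> x" using R(2) by blast
    then show False using assms(1) transversal_R(2)[of z] z unfolding swap_ok_def by blast
  qed
  show "bar n z \<noteq> x"
  proof
    assume "bar n z = x"
    moreover have "z \<noteq> x" using bar_neq[OF assms(2)] calculation by auto
    ultimately show False using assms(1) R(2) by (auto simp: swap_ok_def)
  qed
  show "x \<le> n \<longleftrightarrow> z \<le> n" "x \<le> z" using assms(1) by (auto simp: swap_ok_def half_less_def)
qed

text \<open>The signs of \<open>x\<close>, \<open>z\<close> and their bars are the only ones
  involved, and for unbarred and barred \<open>x\<close> alike the deficit towards \<open>R'\<close>
  shrinks by one exactly on the window.\<close>

lemma swapped_counts:
  assumes z: "swap_ok n x G z" "z \<in> R'"
  shows "pos_count n (R' - {z}) s - pos_count n (swapped n x G z) s =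
    pos_count n R' s - pos_count n (insert x G) s - of_bool (in_window n x z s)"
proof -
  have zL: "z \<in> letters n" and xL: "x \<in> letters n" using z transversal_R by auto
  note zo = swap_okD[OF z(1) zL]
  have bL: "bar n x \<in> letters n" "bar n z \<in> letters n" using xL zL bar_letters by auto
  have "pos_count n R' s = pos_count n (R' - {z}) s + of_bool (s \<le> z \<and> z \<le> n)"
    using pos_count_insert[of "R' - {z}" z n s] finite_R z(2) by (simp add: insert_absorb)
  moreover have "pos_count n (insert x G) s = pos_count n G s + of_bool (s \<le> x \<and> x \<le> n)"
    by (rule pos_count_insert[OF finite_R(1) R(2)])
  moreover have "pos_count n (swapped n x G z) s + of_bool (s \<le> bar n z \<and> bar n z \<le> n) =
      pos_count n G s + of_bool (s \<le> bar n x \<and> bar n x \<le> n)"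
  proof (cases "z = x")
    case True
    have "bar n x \<notin> G" using transversal_R(2)[of x] by blast
    then show ?thesis using True by (simp add: swapped_def)
  next
    case False
    then have zG: "bar n z \<in> G" using z(1) by (simp add: swap_ok_def)
    have bxG: "bar n x \<notin> G" using transversal_R(2)[of x] by blast
    have eq: "insert (bar n z) (swapped n x G z) = insert (bar n x) G"
      using zG by (auto simp: swapped_def)
    have "pos_count n (insert (bar n z) (swapped n x G z)) s =
        pos_count n (swapped n x G z) s + of_bool (s \<le> bar n z \<and> bar n z \<le> n)"
      by (rule pos_count_insert) (auto simp: swapped_def finite_R)
    moreover have "pos_count n (insert (bar n x) G) s =
        pos_count n G s + of_bool (s \<le> bar n x \<and> bar n x \<le> n)"
      by (rule pos_count_insert[OF finite_R(1) bxG])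
    ultimately show ?thesis using eq by simp
  qed
  moreover have "of_bool (s \<le> z \<and> z \<le> n) + of_bool (s \<le> bar n x \<and> bar n x \<le> n) =
      of_bool (s \<le> x \<and> x \<le> n) + of_bool (s \<le> bar n z \<and> bar n z \<le> n) + (of_bool (in_window n x z s) :: int)"
    using zo(3,4) xL zL bar_less_iff[of x n z] bar_less_iff[of z n x]
    by (cases "x \<le> n") (auto simp: in_window_def)
  ultimately show ?thesis by linarith
qed

lemma abs_set_swapped:
  assumes z: "swap_ok n x G z" "z \<in> R'"
  shows "abs_set n (swapped n x G z) = abs_set n (insert x G) - {m. m = z \<or> bar n m = z}"
    "abs_set n (R' - {z}) = abs_set n R' - {m. m = z \<or> bar n m = z}"
    "m \<in> {1..n} \<Longrightarrow> m = z \<or> bar n m = z \<Longrightarrow> m \<in> abs_set n (insert x G) \<and> m \<in> abs_set n R'"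
proof -
  have zL: "z \<in> letters n" and xL: "x \<in> letters n" using z transversal_R by auto
  note zo = swap_okD[OF z(1) zL]
  have mL: "m \<in> letters n" if "m \<in> {1..n}" for m using that by (auto simp: letters_def)
  show "abs_set n (swapped n x G z) = abs_set n (insert x G) - {m. m = z \<or> bar n m = z}"
  proof (intro set_eqI)
    fix m
    show "m \<in> abs_set n (swapped n x G z) \<longleftrightarrow> m \<in> abs_set n (insert x G) - {m. m = z \<or> bar n m = z}"
    proof (cases "m \<in> {1..n}")
      case True
      note m = mL[OF True]
      have "m = bar n x \<longleftrightarrow> bar n m = x" "bar n m = bar n x \<longleftrightarrow> m = x"
        "m = bar n z \<longleftrightarrow> bar n m = z" "bar n m = bar n z \<longleftrightarrow> m = z"
        using m xL zL bar_inj by auto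
      then have "m \<in> abs_set n (swapped n x G z) \<longleftrightarrow>
          (m \<in> G \<or> bar n m = x) \<and> bar n m \<noteq> z \<or> (bar n m \<in> G \<or> m = x) \<and> m \<noteq> z"
        using True unfolding abs_set_def swapped_def by auto
      moreover have "m = z \<Longrightarrow> m \<notin> G \<and> bar n m \<noteq> x" "bar n m = z \<Longrightarrow> bar n m \<notin> G \<and> m \<noteq> x"
        using zo(1,2) m by auto
      ultimately show ?thesis using True unfolding abs_set_def by blast
    qed (auto simp: abs_set_def)
  qed
  show "abs_set n (R' - {z}) = abs_set n R' - {m. m = z \<or> bar n m = z}"
    using transversal_R(4) z(2) mL unfolding abs_set_def by fastforce
  show "m \<in> abs_set n (insert x G) \<and> m \<in> abs_set n R'" if m: "m \<in> {1..n}" "m = z \<or> bar n m = z"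
  proof
    show "m \<in> abs_set n R'" using m z(2) by (auto simp: abs_set_def)
    have "z \<in> insert x G \<or> bar n z \<in> insert x G" using z(1) by (auto simp: swap_ok_def)
    then show "m \<in> abs_set n (insert x G)" using m mL[OF m(1)] by (auto simp: abs_set_def)
  qed
qed

text \<open>A sign never moves across a missing absolute value, so a swap preserves the equalities
  demanded by \<open>sign_dom\<close>.\<close>

lemma window_abs:
  assumes z: "swap_ok n x G z" "z \<in> letters n" and s: "in_window n x z s"
  shows "s \<in> abs_set n (insert x G)"
proof -
  have xL: "x \<in> letters n" using transversal_R by auto
  note zo = swap_okD[OF z]
  have ne: "z \<noteq> x" using s by (auto simp: in_window_def split: if_splits)
  then have zG: "bar n z \<in> G" using z(1) by (auto simp: swap_ok_def)
  have mid: "c \<in> G \<or> bar n c \<in> G" if "x < c" "c < z" for c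
    using z(1) that ne unfolding swap_ok_def by blast
  show ?thesis
  proof (cases "x \<le> n")
    case True
    then have sr: "x < s" "s \<le> z" using s by (auto simp: in_window_def)
    then have "s = z \<or> s \<in> G \<or> bar n s \<in> G" using mid[of s] by linarith
    then show ?thesis using zG sr True zo(3) xL by (auto simp: abs_set_def letters_def)
  next
    case False
    then have sr: "bar n z < s" "s \<le> bar n x" using s by (auto simp: in_window_def)
    have sn: "s \<in> {1..n}" using sr False xL by (auto simp: bar_def letters_def)
    then have sL: "s \<in> letters n" by (auto simp: letters_def)
    have "s = bar n x \<or> s \<in> G \<or> bar n s \<in> G"
    proof (cases "s = bar n x")
      case False
      then have "x < bar n s" "bar n s < z"
        using sr sL xL z(2) bar_less_iff(4)[of x n s] bar_less_iff(3)[of z n s] by (auto simp: bar_less_iff)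
      then show ?thesis using mid[of "bar n s"] sL by auto
    qed simp
    then show ?thesis using sn xL by (auto simp: abs_set_def)
  qed
qed

lemma sign_dom_swap_back:
  assumes z: "swap_ok n x G z" "z \<in> R'" and d: "sign_dom n (swapped n x G z) (R' - {z})"
  shows "sign_dom n (insert x G) R'"
proof -
  note c = swapped_counts[OF z] and a = abs_set_swapped[OF z]
  have A: "abs_set n (insert x G) = abs_set n R'"
  proof -
    have "abs_set n (insert x G) \<subseteq> {1..n}" "abs_set n R' \<subseteq> {1..n}" by (auto simp: abs_set_def)
    moreover have "abs_set n (insert x G) - {m. m = z \<or> bar n m = z} = abs_set n R' - {m. m = z \<or> bar n m = z}"
      using d a(1,2) by (simp add: sign_dom_def)
    ultimately show ?thesis using a(3) by blast
  qed
  have "pos_count n (insert x G) s \<le> pos_count n R' s" for s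
  proof -
    have "0 \<le> pos_count n (R' - {z}) s - pos_count n (swapped n x G z) s"
      using d by (simp add: sign_dom_def)
    then show ?thesis using c[of s] by (auto split: if_splits simp: of_bool_def)
  qed
  moreover have "pos_count n (insert x G) s = pos_count n R' s" if s: "s \<notin> abs_set n (insert x G)" for s
  proof -
    have "s \<notin> abs_set n (swapped n x G z)" using s a(1) by blast
    then have "0 = pos_count n (R' - {z}) s - pos_count n (swapped n x G z) s"
      using d by (simp add: sign_dom_def)
    moreover have "\<not> in_window n x z s" using window_abs[OF z(1)] s transversal_R(3)[OF z(2)] by blast
    ultimately show ?thesis using c[of s] by simp
  qed
  ultimately show ?thesis using A by (simp add: sign_dom_def)
qed

definition excess :: "nat \<Rightarrow> int" where
  "excess s = pos_count n R' s - pos_count n (insert x G) s"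

lemma excess_Suc:
  assumes "m \<le> n"
  shows "excess m = excess (Suc m) + of_bool (m \<in> R') - of_bool (m \<in> insert x G)"
  unfolding excess_def using pos_count_Suc[OF _ assms] finite_R by simp

text \<open>After the swap the absolute value of \<open>z\<close> is absent from the remaining sets,
  so the counts must agree at that threshold; in terms of the old sets this is a zero of
  \<open>excess\<close>. Within the window the excess has to pay for the moved sign.\<close>

lemma swap_target:
  assumes z: "swap_ok n x G z" "z \<in> R'" and d: "sign_dom n (swapped n x G z) (R' - {z})"
  shows "x \<le> n \<Longrightarrow> excess (Suc z) = 0" "\<not> x \<le> n \<Longrightarrow> excess (bar n z) = 0"
    "in_window n x z s \<Longrightarrow> 1 \<le> excess s"
proof -
  note c = swapped_counts[OF z] and a = abs_set_swapped[OF z]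
  have zL: "z \<in> letters n" and xL: "x \<in> letters n" using z transversal_R by auto
  note zo = swap_okD[OF z(1) zL]
  show "1 \<le> excess s" if "in_window n x z s" for s
  proof -
    have "0 \<le> pos_count n (R' - {z}) s - pos_count n (swapped n x G z) s"
      using d by (simp add: sign_dom_def)
    then show ?thesis using c[of s] that by (simp add: excess_def)
  qed
  have e: "excess m = of_bool (in_window n x z m)" if "m = z \<or> bar n m = z" for m
  proof -
    have "m \<notin> abs_set n (swapped n x G z)" using a(1) that by blast
    then show ?thesis using d c[of m] by (simp add: sign_dom_def excess_def)
  qed
  show "excess (Suc z) = 0" if "x \<le> n"
  proof -
    have "z \<in> insert x G \<longleftrightarrow> z = x" using zo(1) by auto
    then show ?thesis
      using excess_Suc[of z] e[of z] that zo(3,4) z(2) by (auto simp: in_window_def)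
  qed
  show "excess (bar n z) = 0" if "\<not> x \<le> n"
    using e[of "bar n z"] zL that by (auto simp: in_window_def)
qed

text \<open>Of two targets, the nearer one produces a zero of \<open>excess\<close> inside the
  window of the farther one, where \<open>excess\<close> is at least 1.\<close>

lemma swap_unique:
  assumes "swap_ok n x G z" "z \<in> R'" "sign_dom n (swapped n x G z) (R' - {z})"
    and "swap_ok n x G y" "y \<in> R'" "sign_dom n (swapped n x G y) (R' - {y})"
  shows "z = y"
proof -
  have no: False if z: "swap_ok n x G z" "z \<in> R'" "sign_dom n (swapped n x G z) (R' - {z})"
    and y: "swap_ok n x G y" "y \<in> R'" "sign_dom n (swapped n x G y) (R' - {y})" and lt: "z < y" for z y
  proof -
    have L: "z \<in> letters n" "y \<in> letters n" "x \<in> letters n" using z y transversal_R by auto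
    note zo = swap_okD[OF z(1) L(1)]
    note yo = swap_okD[OF y(1) L(2)]
    show False
    proof (cases "x \<le> n")
      case True
      then have "in_window n x y (Suc z)" using lt zo by (auto simp: in_window_def)
      then show False using swap_target(3)[OF y] swap_target(1)[OF z True] by force
    next
      case False
      have "bar n y < bar n z" "bar n z \<le> bar n x" using lt L zo(4) by (auto simp: bar_less_iff)
      then have "in_window n x y (bar n z)" using False by (auto simp: in_window_def)
      then show False using swap_target(3)[OF y] swap_target(2)[OF z False] by force
    qed
  qed
  then show ?thesis using assms by (metis linorder_neqE_nat)
qed

lemma swap_dom:
  assumes d: "sign_dom n (insert x G) R'" and z: "swap_ok n x G z" "z \<in> R'"
    and w: "\<And>s. in_window n x z s \<Longrightarrow> 1 \<le> excess s"
    and e: "\<And>m. m \<in> {1..n} \<Longrightarrow> m = z \<or> bar n m = z \<Longrightarrow> excess m = of_bool (in_window n x z m)"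
  shows "sign_dom n (swapped n x G z) (R' - {z})"
proof -
  note c = swapped_counts[OF z] and a = abs_set_swapped[OF z]
  have zL: "z \<in> letters n" using z transversal_R by auto
  have "abs_set n (swapped n x G z) = abs_set n (R' - {z})" using a d by (simp add: sign_dom_def)
  moreover have "pos_count n (swapped n x G z) s \<le> pos_count n (R' - {z}) s" for s
  proof -
    have "0 \<le> excess s" using d by (simp add: sign_dom_def excess_def)
    then show ?thesis using c[of s] w[of s] by (cases "in_window n x z s") (auto simp: excess_def)
  qed
  moreover have "pos_count n (swapped n x G z) s = pos_count n (R' - {z}) s"
    if s: "s \<notin> abs_set n (swapped n x G z)" for s
  proof (cases "s \<in> {1..n} \<and> (s = z \<or> bar n s = z)")
    case True
    then show ?thesis using c[of s] e[of s] by (simp add: excess_def)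
  next
    case False
    have sn: "s \<notin> abs_set n (insert x G)"
    proof
      assume H: "s \<in> abs_set n (insert x G)"
      then have "s \<in> {1..n}" by (simp add: abs_set_def)
      then show False using H s False unfolding a(1) by simp
    qed
    then have "excess s = 0" using d by (simp add: sign_dom_def excess_def)
    moreover have "\<not> in_window n x z s" using window_abs[OF z(1) zL] sn by blast
    ultimately show ?thesis using c[of s] by (simp add: excess_def)
  qed
  ultimately show ?thesis by (simp add: sign_dom_def)
qed

text \<open>The candidate is dictated by \<open>swap_target\<close>: for unbarred \<open>x\<close>
  the least \<open>z \<ge> x\<close> with \<open>excess (Suc z) = 0\<close>, for barred
  \<open>x\<close> the bar of the greatest \<open>q \<le> bar n x\<close> with
  \<open>excess q = 0\<close>. Positive excess in the window makes its absolute values present, and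
  the jump of the excess at the end of the window fixes the signs there.\<close>

lemma swap_exists:
  assumes d: "sign_dom n (insert x G) R'"
  shows "\<exists>z\<in>R'. swap_ok n x G z \<and> sign_dom n (swapped n x G z) (R' - {z})"
proof -
  have xL: "x \<in> letters n" using transversal_R by auto
  have nonneg: "0 \<le> excess s" for s using d by (simp add: sign_dom_def excess_def)
  have zero: "excess s = 0" if "s \<notin> abs_set n (insert x G)" for s
    using d that by (simp add: sign_dom_def excess_def)
  have posD: "s \<in> abs_set n (insert x G)" "s \<in> {1..n}" if "1 \<le> excess s" for s
    using zero[of s] that by (force simp: abs_set_def)+
  have abs: "m \<in> R' \<or> bar n m \<in> R'" if "m \<in> abs_set n (insert x G)" for m
    using d that by (auto simp: sign_dom_def abs_set_def)
  show ?thesis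
  proof (cases "x \<le> n")
    case True
    then have x: "x \<in> {1..n}" using xL by (auto simp: letters_def)
    define z where "z = (LEAST z. x \<le> z \<and> excess (Suc z) = 0)"
    have ex: "x \<le> n \<and> excess (Suc n) = 0" using True by (simp add: excess_def pos_count_above)
    have z: "x \<le> z" "excess (Suc z) = 0" "z \<le> n"
      using LeastI[of "\<lambda>z. x \<le> z \<and> excess (Suc z) = 0", OF ex]
        Least_le[of "\<lambda>z. x \<le> z \<and> excess (Suc z) = 0", OF ex] by (auto simp: z_def)
    have win: "1 \<le> excess s" if s: "x < s" "s \<le> z" for s
    proof -
      have "excess (Suc (s - 1)) \<noteq> 0"
        using not_less_Least[of "s - 1" "\<lambda>z. x \<le> z \<and> excess (Suc z) = 0"] s by (auto simp: z_def)
      then show ?thesis using nonneg[of s] s by auto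
    qed
    have "z \<in> R' \<and> swap_ok n x G z \<and> excess z = of_bool (x < z)"
    proof (cases "z = x")
      case True
      have "z \<in> R'"
      proof (rule ccontr)
        assume "z \<notin> R'"
        then have "excess z = - 1" using excess_Suc[OF z(3)] z(2) True by simp
        then show False using nonneg[of z] by simp
      qed
      then show ?thesis using excess_Suc[OF z(3)] z(2) True by (simp add: swap_ok_def)
    next
      case False
      then have xz: "x < z" using z by simp
      then have ez: "1 \<le> excess z" using win by simp
      then have zR: "z \<in> R'" "z \<notin> insert x G" "excess z = 1"
        using excess_Suc[OF z(3)] z(2) by (auto simp: of_bool_def split: if_splits)
      then have "bar n z \<in> G"
        using posD(1)[OF ez] z(3) True by (auto simp: abs_set_def bar_def)
      moreover have "c \<in> G \<or> bar n c \<in> G" if "x < c" "c < z" for c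
        using posD(1)[OF win[of c]] that z(3) True by (auto simp: abs_set_def bar_def)
      ultimately show ?thesis using zR xz z(3) True by (auto simp: swap_ok_def half_less_def)
    qed
    then have zz: "z \<in> R'" "swap_ok n x G z" "excess z = of_bool (x < z)" by auto
    have "sign_dom n (swapped n x G z) (R' - {z})"
    proof (rule swap_dom[OF d zz(2,1)])
      show "1 \<le> excess s" if "in_window n x z s" for s
        using that True win by (auto simp: in_window_def)
      show "excess m = of_bool (in_window n x z m)" if "m \<in> {1..n}" "m = z \<or> bar n m = z" for m
      proof -
        have "m = z" using that z(3) by (auto simp: bar_def)
        then show ?thesis using zz(3) True by (auto simp: in_window_def)
      qed
    qed
    then show ?thesis using zz by blast
  next
    case False
    define p where "p = bar n x"
    have p: "p \<in> {1..n}" "bar n p = x" using xL False by (auto simp: p_def bar_def letters_def)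
    have pR: "p \<notin> insert x G" using transversal_R(2)[of x] by (simp add: p_def)
    define q where "q = (GREATEST q. q \<le> p \<and> excess q = 0)"
    have ex: "1 \<le> p \<and> 0 \<le> p \<and> excess 0 = 0"
      using p zero[of 0] by (auto simp: abs_set_def)
    have "0 \<notin> letters n" by (simp add: letters_def)
    then have "0 \<notin> insert x G" "0 \<notin> R'" using transversal_R(1,3) by blast+
    \<comment> \<open>The greatest zero has to be a genuine absolute value, so a zero at 1 is needed
      and not only the one at 0.\<close>
    then have e1: "excess 1 = 0" using excess_Suc[of 0] ex by simp
    have gr: "q \<le> p \<and> excess q = 0" "1 \<le> q"
      using GreatestI_nat[of "\<lambda>q. q \<le> p \<and> excess q = 0" 1 p]
        Greatest_le_nat[of "\<lambda>q. q \<le> p \<and> excess q = 0" 1 p] e1 ex by (auto simp: q_def)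
    have win: "1 \<le> excess s" if s: "q < s" "s \<le> p" for s
    proof -
      have "excess s \<noteq> 0"
        using Greatest_le_nat[of "\<lambda>q. q \<le> p \<and> excess q = 0" s p] s by (auto simp: q_def)
      then show ?thesis using nonneg[of s] by simp
    qed
    have qn: "q \<le> n" "q \<in> {1..n}" "q \<in> letters n" using gr p by (auto simp: letters_def)
    define z where "z = bar n q"
    have zq: "bar n z = q" "z \<in> letters n" "n < z"
      using qn bar_letters by (auto simp: z_def) (auto simp: bar_def)
    have "z \<in> R' \<and> swap_ok n x G z"
    proof (cases "q = p")
      case True
      then have zx: "z = x" using p by (simp add: z_def)
      have "p \<notin> R'"
      proof
        assume "p \<in> R'"
        then have "excess q = excess (Suc q) + 1" using excess_Suc[OF qn(1)] True pR by simp
        then show False using gr nonneg[of "Suc q"] by simp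
      qed
      moreover have "p \<in> abs_set n (insert x G)" using p by (auto simp: abs_set_def)
      ultimately have "x \<in> R'" using abs[of p] p by simp
      then show ?thesis using zx by (simp add: swap_ok_def)
    next
      case ne: False
      then have qp: "q < p" using gr by simp
      then have "1 \<le> excess (Suc q)" using win[of "Suc q"] by simp
      then have qG: "q \<in> insert x G" "q \<notin> R'"
        using excess_Suc[OF qn(1)] gr by (auto simp: of_bool_def split: if_splits)
      then have qG': "q \<in> G" using False qn by auto
      have "q \<in> abs_set n (insert x G)" using qG qn by (auto simp: abs_set_def)
      then have "z \<in> R'" using abs qG z_def by auto
      moreover have "half_less n x z"
      proof -
        have "x < z" using qp p qn xL by (auto simp: z_def p_def bar_def letters_def)
        then show ?thesis using False zq by (auto simp: half_less_def)
      qed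
      moreover have "c \<in> G \<or> bar n c \<in> G" if c: "x < c" "c < z" for c
      proof -
        have cL: "c \<in> letters n" using c xL zq(2) by (auto simp: letters_def)
        have "q < bar n c" "bar n c < p"
          using c cL xL qn by (auto simp: z_def p_def bar_less_iff)
        then have "bar n c \<in> abs_set n (insert x G)" using posD(1)[OF win[of "bar n c"]] by simp
        then have "bar n c \<in> insert x G \<or> c \<in> insert x G" using cL by (auto simp: abs_set_def)
        moreover have "bar n c \<noteq> x" using \<open>bar n c < p\<close> p False by auto
        ultimately show ?thesis using c by auto
      qed
      ultimately show ?thesis using qG' zq by (auto simp: swap_ok_def)
    qed
    then have zz: "z \<in> R'" "swap_ok n x G z" by auto
    have "sign_dom n (swapped n x G z) (R' - {z})"
    proof (rule swap_dom[OF d zz(2,1)])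
      show "1 \<le> excess s" if "in_window n x z s" for s
        using that False win[of s] zq by (auto simp: in_window_def p_def)
      show "excess m = of_bool (in_window n x z m)" if m: "m \<in> {1..n}" "m = z \<or> bar n m = z" for m
      proof -
        have "m \<in> letters n" using m by (auto simp: letters_def)
        then have "m = q" using m zq by auto
        then show ?thesis using gr zq False by (auto simp: in_window_def)
      qed
    qed
    then show ?thesis using zz by blast
  qed
qed

end

section \<open>Right-block stages as swaps of signs\<close>

lemma stage_upper_values:
  assumes i: "1 \<le> i" "i \<le> n" and v: "v \<in> signed_perms n"
    and w: "stage_walk n i v (stage_upper n i) bs v'"
  shows "v' ` {1..<i} = swapped n (v i) (v ` {1..<i}) (v' i)"
proof -
  let ?S = "insert i {bar n i<..2 * n}"
  have v': "v' \<in> signed_perms n" by (rule stage_upper_walk(1)[OF i v w])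
  have S: "?S \<subseteq> letters n" "bar n ` ?S = insert (bar n i) {1..<i}"
  proof -
    show S: "?S \<subseteq> letters n" using i by (auto simp: letters_def)
    show "bar n ` ?S = insert (bar n i) {1..<i}"
    proof (intro set_eqI iffI)
      fix c assume "c \<in> insert (bar n i) {1..<i}"
      then have "c = bar n i \<or> bar n c \<in> {bar n i<..2 * n} \<and> c = bar n (bar n c)"
        using i by (auto simp: bar_def)
      then show "c \<in> bar n ` ?S" by blast
    qed (use i in \<open>auto simp: bar_def\<close>)
  qed
  have "v' ` ?S = v ` ?S"
  proof (rule stage_walk_image[OF i v w])
    show "?S \<inter> bar n ` ?S = {}" unfolding S(2) using i by (auto simp: bar_def)
  qed (use i in \<open>auto simp: stage_upper_def bar_def\<close>)
  moreover have "u ` bar n ` ?S = bar n ` u ` ?S" if "u \<in> signed_perms n" for u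
    unfolding image_image using signed_permD(4)[OF that] S(1) by (intro image_cong) auto
  ultimately have "v' ` insert (bar n i) {1..<i} = v ` insert (bar n i) {1..<i}"
    using v v' S(2) by metis
  moreover have iL: "i \<in> letters n" using i by (auto simp: letters_def)
  have "v' ` {1..<i} = v' ` insert (bar n i) {1..<i} - {v' (bar n i)}"
    using signed_permD(2)[OF v'] i by (auto simp: inj_eq bar_def)
  ultimately show ?thesis
    using signed_permD(4)[OF v iL] signed_permD(4)[OF v' iL] transversal_image[OF v i(2)]
    by (simp add: swapped_def)
qed

lemma transversal_at:
  assumes i: "1 \<le> i" "i \<le> n" and v: "v \<in> signed_perms n"
  shows "transversal n (insert (v i) (v ` {1..<i}))" "v i \<notin> v ` {1..<i}"
proof -
  have "{1..i} = insert i {1..<i}" using i by auto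
  then show "transversal n (insert (v i) (v ` {1..<i}))" using transversal_image[OF v i(2)] by simp
  show "v i \<notin> v ` {1..<i}" using signed_permD(2)[OF v] by (auto simp: inj_eq)
qed

text \<open>Letters above \<open>v i\<close> and up to the new value are not window values, so they
  or their bars sit before \<open>i\<close>. For the new value itself it must be the bar, because it
  is taken from beyond \<open>bar n i\<close>.\<close>

lemma stage_upper_swap_ok:
  assumes i: "1 \<le> i" "i \<le> n" and v: "v \<in> signed_perms n"
    and w: "stage_walk n i v (stage_upper n i) bs v'"
  shows "swap_ok n (v i) (v ` {1..<i}) (v' i)"
proof -
  note up = stage_upper_walk[OF i v w]
  let ?G = "v ` {1..<i}"
  have iL: "i \<in> letters n" using i by (auto simp: letters_def)
  have zL: "v' i \<in> letters n" using signed_permD(3)[OF up(1) iL] .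
  have mid: "c \<in> ?G \<or> bar n c \<in> ?G" if "v i < c" "c \<le> v' i" for c
  proof -
    have "c \<in> letters n" using that zL signed_permD(3)[OF v iL] by (auto simp: letters_def)
    then obtain d where d: "d \<in> letters n" "v d = c" using signed_perm_surj[OF v] by blast
    then have "d < i \<or> bar n i < d" using up(3)[of d] that by force
    then show ?thesis
    proof
      assume "d < i"
      then show ?thesis using d by (auto simp: letters_def)
    next
      assume "bar n i < d"
      then have "bar n d \<in> {1..<i}" using d i by (auto simp: letters_def bar_def)
      moreover have "v (bar n d) = bar n c" using signed_permD(4)[OF v d(1)] d(2) by simp
      ultimately show ?thesis by (metis imageI)
    qed
  qed
  show ?thesis
  proof (cases "v' i = v i")
    case False
    then have hl: "half_less n (v i) (v' i)" using up(2) by simp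
    have "v' i \<notin> ?G"
    proof
      assume "v' i \<in> ?G"
      then obtain a where a: "v' i = v a" "a \<in> {1..<i}" by blast
      have "chain_reach n True i (2 * n + 2 - i) (2 * n + 1) v (v' i)"
        using chain_walk(1)[OF i v upper_range[OF i]] w unfolding stage_upper_def by blast
      then have "v' i \<in> v ` {2 * n + 2 - i..<2 * n + 1}" using False by (auto simp: chain_reach_def)
      then obtain d where "v a = v d" "2 * n + 2 - i \<le> d" using a by auto
      then show False using a i signed_permD(2)[OF v] by (auto simp: inj_eq)
    qed
    then have "bar n (v' i) \<in> ?G" using mid[of "v' i"] hl by (auto simp: half_less_def)
    then show ?thesis using mid hl unfolding swap_ok_def by auto
  qed (simp add: swap_ok_def)
qed

lemma stage_upper_attains:
  assumes i: "1 \<le> i" "i \<le> n" and v: "v \<in> signed_perms n"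
    and z: "swap_ok n (v i) (v ` {1..<i}) z" "z \<in> letters n"
  shows "\<exists>bs v'. stage_walk n i v (stage_upper n i) bs v' \<and> v' i = z"
proof (cases "z = v i")
  case True
  then show ?thesis by (intro stage_upper_exists[OF i v]) (auto simp: cyc_def)
next
  case False
  let ?G = "v ` {1..<i}"
  have z': "half_less n (v i) z" "bar n z \<in> ?G" "\<And>c. v i < c \<Longrightarrow> c < z \<Longrightarrow> c \<in> ?G \<or> bar n c \<in> ?G"
    using z(1) False by (auto simp: swap_ok_def)
  show ?thesis
  proof (rule stage_upper_exists[OF i v])
    obtain a where a: "bar n z = v a" "a \<in> {1..<i}" using z'(2) by blast
    have aL: "a \<in> letters n" using a i by (auto simp: letters_def)
    have "z = v (bar n a)" using signed_permD(4)[OF v aL] a(1) z(2) by (metis bar_bar)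
    moreover have "bar n a \<in> {bar n i<..2 * n}" using a i by (auto simp: bar_def)
    ultimately show "z = v i \<or> z \<in> v ` {bar n i<..2 * n} \<and> half_less n (v i) z"
      using z'(1) by blast
    show "\<not> cyc (v i) (v c) z" if c: "i < c" "c \<le> bar n i" for c
    proof
      assume "cyc (v i) (v c) z"
      then have "v i < v c" "v c < z" using z'(1) by (auto simp: cyc_def half_less_def)
      then have "v c \<in> ?G \<or> bar n (v c) \<in> ?G" using z'(3) by blast
      moreover have cL: "c \<in> letters n" using c i by (auto simp: letters_def bar_def)
      ultimately obtain b where b: "b \<in> {1..<i}" "v b = v c \<or> v b = v (bar n c)"
        using signed_permD(4)[OF v cL] by (metis imageE)
      then have "b = c \<or> b = bar n c" using signed_permD(2)[OF v] by (auto simp: inj_eq)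
      then show False using b c i by (auto simp: bar_def)
    qed
  qed
qed

lemma ball_Suc_image: "v ` {1..Suc i} = insert (v (Suc i)) (v ` {1..<Suc i})"
proof -
  have "{1..Suc i} = insert (Suc i) {1..<Suc i}" by auto
  then show ?thesis by simp
qed

text \<open>The value placed at \<open>Suc i\<close> is final. Removing it from the final set leaves
  the set reached by the remaining stages, and dominance for these is lifted over the swap by
  \<open>sign_dom_swap_back\<close>.\<close>

lemma stages_upper_sound:
  assumes "i \<le> n" "v \<in> signed_perms n" "qwalk n v (stages n (stage_upper n) i) bs v'"
  shows "v' \<in> signed_perms n \<and> (\<forall>c. i < c \<and> c \<le> n \<longrightarrow> v' c = v c) \<and>
    sign_dom n (v ` {1..i}) (v' ` {1..i})"
  using assms
proof (induction i arbitrary: v bs)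
  case 0
  then show ?case by (auto simp: sign_dom_def)
next
  case (Suc i)
  have si: "1 \<le> Suc i" "Suc i \<le> n" "i \<le> n" using Suc.prems by auto
  obtain bs1 bs2 v1 where w: "stage_walk n (Suc i) v (stage_upper n (Suc i)) bs1 v1"
    "qwalk n v1 (stages n (stage_upper n) i) bs2 v'"
    using Suc.prems(3) unfolding stages.simps qwalk_append by blast
  note up = stage_upper_walk[OF si(1,2) Suc.prems(2) w(1)]
  note tr = transversal_at[OF si(1,2) Suc.prems(2)]
  have IH: "v' \<in> signed_perms n" "\<And>c. i < c \<Longrightarrow> c \<le> n \<Longrightarrow> v' c = v1 c"
    "sign_dom n (v1 ` {1..i}) (v' ` {1..i})"
    using Suc.IH[OF si(3) up(1) w(2)] by auto
  have z: "v' (Suc i) = v1 (Suc i)" using IH(2) si by simp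
  have T: "transversal n (v' ` {1..Suc i})" by (rule transversal_image[OF IH(1) si(2)])
  have E: "v' ` {1..Suc i} - {v1 (Suc i)} = v' ` {1..i}"
    unfolding ball_Suc_image z[symmetric] using signed_permD(2)[OF IH(1)] by (auto simp: inj_eq)
  have "sign_dom n (insert (v (Suc i)) (v ` {1..<Suc i})) (v' ` {1..Suc i})"
  proof (rule sign_dom_swap_back[OF tr T])
    show "swap_ok n (v (Suc i)) (v ` {1..<Suc i}) (v1 (Suc i))"
      by (rule stage_upper_swap_ok[OF si(1,2) Suc.prems(2) w(1)])
    show "v1 (Suc i) \<in> v' ` {1..Suc i}" using z by (metis atLeastAtMost_iff imageI order.refl si(1))
    show "sign_dom n (swapped n (v (Suc i)) (v ` {1..<Suc i}) (v1 (Suc i))) (v' ` {1..Suc i} - {v1 (Suc i)})"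
      unfolding E stage_upper_values[OF si(1,2) Suc.prems(2) w(1), symmetric]
      using IH(3) by (simp add: atLeastLessThanSuc_atLeastAtMost)
  qed
  then show ?case using IH(1,2) up(5) unfolding ball_Suc_image[symmetric] by simp
qed

lemma stages_upper_exists:
  assumes "i \<le> n" "v \<in> signed_perms n" "transversal n R'" "sign_dom n (v ` {1..i}) R'"
  shows "\<exists>bs v'. qwalk n v (stages n (stage_upper n) i) bs v' \<and> v' ` {1..i} = R'"
  using assms
proof (induction i arbitrary: v R')
  case 0
  have "r \<notin> R'" for r
  proof
    assume "r \<in> R'"
    then have "r \<in> letters n" using 0(3) by (auto simp: transversal_def)
    then have "r \<in> abs_set n R' \<or> bar n r \<in> abs_set n R'"
      using \<open>r \<in> R'\<close> by (auto simp: abs_set_def letters_def bar_def)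
    then show False using 0(4) by (auto simp: sign_dom_def abs_set_def)
  qed
  then show ?case by auto
next
  case (Suc i)
  have si: "1 \<le> Suc i" "Suc i \<le> n" "i \<le> n" using Suc.prems by auto
  note tr = transversal_at[OF si(1,2) Suc.prems(2)]
  obtain z where z: "z \<in> R'" "swap_ok n (v (Suc i)) (v ` {1..<Suc i}) z"
    "sign_dom n (swapped n (v (Suc i)) (v ` {1..<Suc i}) z) (R' - {z})"
    using swap_exists[OF tr Suc.prems(3)] Suc.prems(4) unfolding ball_Suc_image by blast
  have zL: "z \<in> letters n" using z(1) Suc.prems(3) by (auto simp: transversal_def)
  obtain bs1 v1 where w: "stage_walk n (Suc i) v (stage_upper n (Suc i)) bs1 v1" "v1 (Suc i) = z"
    using stage_upper_attains[OF si(1,2) Suc.prems(2) z(2) zL] by blast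
  note up = stage_upper_walk[OF si(1,2) Suc.prems(2) w(1)]
  have "sign_dom n (v1 ` {1..i}) (R' - {z})"
    using z(3) stage_upper_values[OF si(1,2) Suc.prems(2) w(1)] w(2)
    by (simp add: atLeastLessThanSuc_atLeastAtMost)
  moreover have "transversal n (R' - {z})" using Suc.prems(3) by (auto simp: transversal_def)
  ultimately obtain bs2 v' where v': "qwalk n v1 (stages n (stage_upper n) i) bs2 v'" "v' ` {1..i} = R' - {z}"
    using Suc.IH[OF si(3) up(1)] by blast
  have "v' (Suc i) = z" using stages_upper_sound[OF si(3) up(1) v'(1)] si w(2) by auto
  then have "v' ` {1..Suc i} = R'"
    unfolding ball_Suc_image using v'(2) z(1) by (auto simp: atLeastLessThanSuc_atLeastAtMost)
  then show ?case using w v'(1) unfolding stages.simps qwalk_append by blast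
qed

lemma stages_upper_unique:
  assumes "i \<le> n" "v \<in> signed_perms n"
    "qwalk n v (stages n (stage_upper n) i) bs v'" "qwalk n v (stages n (stage_upper n) i) bs' v''"
    "v' ` {1..i} = v'' ` {1..i}"
  shows "bs = bs'"
  using assms
proof (induction i arbitrary: v bs bs')
  case (Suc i)
  have si: "1 \<le> Suc i" "Suc i \<le> n" "i \<le> n" using Suc.prems by auto
  note tr = transversal_at[OF si(1,2) Suc.prems(2)]
  obtain bs1 bs2 v1 where w: "bs = bs1 @ bs2" "stage_walk n (Suc i) v (stage_upper n (Suc i)) bs1 v1"
    "qwalk n v1 (stages n (stage_upper n) i) bs2 v'"
    using Suc.prems(3) unfolding stages.simps qwalk_append by blast
  obtain cs1 cs2 w1 where w': "bs' = cs1 @ cs2" "stage_walk n (Suc i) v (stage_upper n (Suc i)) cs1 w1"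
    "qwalk n w1 (stages n (stage_upper n) i) cs2 v''"
    using Suc.prems(4) unfolding stages.simps qwalk_append by blast
  let ?R = "v' ` {1..Suc i}"
  have key: "swap_ok n (v (Suc i)) (v ` {1..<Suc i}) (u (Suc i)) \<and> u (Suc i) \<in> ?R \<and>
      sign_dom n (swapped n (v (Suc i)) (v ` {1..<Suc i}) (u (Suc i))) (?R - {u (Suc i)}) \<and>
      u' ` {1..i} = ?R - {u (Suc i)} \<and> transversal n ?R"
    if u: "stage_walk n (Suc i) v (stage_upper n (Suc i)) ds u"
      "qwalk n u (stages n (stage_upper n) i) es u'" "u' ` {1..Suc i} = ?R" for ds es u u'
  proof -
    note up = stage_upper_walk[OF si(1,2) Suc.prems(2) u(1)]
    have u': "u' \<in> signed_perms n" "u' (Suc i) = u (Suc i)" "sign_dom n (u ` {1..i}) (u' ` {1..i})"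
      using stages_upper_sound[OF si(3) up(1) u(2)] si by auto
    have "u (Suc i) \<in> u' ` {1..Suc i}" unfolding ball_Suc_image u'(2) by simp
    moreover have E: "u' ` {1..Suc i} - {u (Suc i)} = u' ` {1..i}"
      unfolding ball_Suc_image u'(2)[symmetric] using signed_permD(2)[OF u'(1)] by (auto simp: inj_eq)
    moreover have "transversal n (u' ` {1..Suc i})" by (rule transversal_image[OF u'(1) si(2)])
    moreover have "sign_dom n (swapped n (v (Suc i)) (v ` {1..<Suc i}) (u (Suc i))) (u' ` {1..i})"
      unfolding stage_upper_values[OF si(1,2) Suc.prems(2) u(1), symmetric]
      using u'(3) by (simp add: atLeastLessThanSuc_atLeastAtMost)
    ultimately show ?thesis
      unfolding u(3)[symmetric] using stage_upper_swap_ok[OF si(1,2) Suc.prems(2) u(1)] by simp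
  qed
  note k1 = key[OF w(2,3) refl] and k2 = key[OF w'(2,3) Suc.prems(5)[symmetric]]
  have eq: "v1 (Suc i) = w1 (Suc i)"
    by (rule swap_unique[OF tr]) (use k1 k2 in auto)
  then have b1: "bs1 = cs1" using stage_upper_unique[OF si(1,2) Suc.prems(2) w(2) w'(2)] by blast
  then have v1: "v1 = w1" using qwalk_determ w(2) w'(2) by blast
  have "v' ` {1..i} = v'' ` {1..i}" using k1 k2 eq by simp
  then have "bs2 = cs2"
    using Suc.IH[OF si(3) stage_upper_walk(1)[OF si(1,2) Suc.prems(2) w(2)] w(3)] w'(3) v1 by blast
  then show ?case using w(1) w'(1) b1 by simp
qed auto

lemma Gamma_r_walk:
  assumes "k \<le> n" "v \<in> signed_perms n"
  shows "qwalk n v (rev (Gamma_r n k)) bs v' \<Longrightarrow>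
      v' \<in> signed_perms n \<and> sign_dom n (v ` {1..k}) (v' ` {1..k})"
    and "transversal n R' \<Longrightarrow> sign_dom n (v ` {1..k}) R' \<Longrightarrow>
      \<exists>bs v'. qwalk n v (rev (Gamma_r n k)) bs v' \<and> v' ` {1..k} = R'"
    and "qwalk n v (rev (Gamma_r n k)) bs v' \<Longrightarrow> qwalk n v (rev (Gamma_r n k)) bs' v'' \<Longrightarrow>
      v' ` {1..k} = v'' ` {1..k} \<Longrightarrow> bs = bs'"
  unfolding rev_Gamma_r[OF assms(1)]
proof -
  show "v' \<in> signed_perms n \<and> sign_dom n (v ` {1..k}) (v' ` {1..k})"
    if "qwalk n v (stages n (stage_upper n) k) bs v'"
    using stages_upper_sound[OF assms that] by blast
  show "\<exists>bs v'. qwalk n v (stages n (stage_upper n) k) bs v' \<and> v' ` {1..k} = R'"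
    if "transversal n R'" "sign_dom n (v ` {1..k}) R'"
    by (rule stages_upper_exists[OF assms that])
  show "bs = bs'" if "qwalk n v (stages n (stage_upper n) k) bs v'"
    "qwalk n v (stages n (stage_upper n) k) bs' v''" "v' ` {1..k} = v'' ` {1..k}"
    by (rule stages_upper_unique[OF assms that])
qed

section \<open>Kashiwara-Nakashima columns\<close>

definition split_cands :: "nat \<Rightarrow> nat list \<Rightarrow> nat list \<Rightarrow> nat \<Rightarrow> nat set" where
  "split_cands n D ts i = {t \<in> {1..n}. t < paired_letters n D ! i \<and>
     (0 < i \<longrightarrow> t < ts ! (i - 1)) \<and> t \<notin> set D \<and> bar n t \<notin> set D}"

lemma is_splitting_iff:
  "is_splitting n D ts \<longleftrightarrow> length ts = length (paired_letters n D) \<and>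
     (\<forall>i<length ts. ts ! i \<in> split_cands n D ts i \<and> (\<forall>t\<in>split_cands n D ts i. t \<le> ts ! i))"
  unfolding is_splitting_def Let_def split_cands_def by (rule conj_cong[OF refl]) (simp only:)

lemma is_splitting_unique:
  assumes "is_splitting n D ts" "is_splitting n D us"
  shows "ts = us"
proof (rule nth_equalityI)
  show len: "length ts = length us" using assms by (simp add: is_splitting_iff)
  show "ts ! i = us ! i" if "i < length ts" for i
    using that
  proof (induction i rule: less_induct)
    case (less i)
    have "split_cands n D ts i = split_cands n D us i"
      using less by (cases i) (auto simp: split_cands_def)
    moreover have "ts ! i \<in> split_cands n D ts i \<and> (\<forall>t\<in>split_cands n D ts i. t \<le> ts ! i)"
      "us ! i \<in> split_cands n D us i \<and> (\<forall>t\<in>split_cands n D us i. t \<le> us ! i)"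
      using assms less.prems len by (simp_all add: is_splitting_iff)
    ultimately show ?case by (simp add: order.antisym)
  qed
qed

lemma splitting_eq: "is_splitting n D ts \<Longrightarrow> splitting n D = ts"
  unfolding splitting_def using is_splitting_unique by blast

lemma replace_letters_props:
  assumes xs: "distinct xs" "set xs \<subseteq> set D" and ys: "distinct ys" "set ys \<inter> set D = {}"
    and len: "length xs = length ys" and D: "distinct D"
  shows "distinct (replace_letters xs ys D)" "length (replace_letters xs ys D) = length D"
    "set (replace_letters xs ys D) = set D - set xs \<union> set ys"
proof -
  define f where "f x = (case map_of (zip xs ys) x of None \<Rightarrow> x | Some y \<Rightarrow> y)" for x
  have r: "replace_letters xs ys D = map f D" by (simp add: replace_letters_def f_def)
  show "length (replace_letters xs ys D) = length D" by (simp add: r)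
  have f1: "f x = x" if "x \<notin> set xs" for x
  proof -
    have "map_of (zip xs ys) x = None" using that len by (simp add: map_of_zip_is_None)
    then show ?thesis by (simp add: f_def)
  qed
  have f2: "f (xs ! i) = ys ! i" if "i < length xs" for i
    using that xs(1) len by (simp add: f_def map_of_zip_nth)
  have "inj_on f (set D)"
  proof (rule inj_onI)
    fix a b assume ab: "a \<in> set D" "b \<in> set D" "f a = f b"
    have ny: "ys ! i \<notin> set D" if "i < length xs" for i
      using ys(2) nth_mem[of i ys] that len by (metis disjoint_iff)
    show "a = b"
    proof (cases "a \<in> set xs"; cases "b \<in> set xs")
      assume "a \<in> set xs" "b \<in> set xs"
      then obtain i j where "i < length xs" "j < length xs" "a = xs ! i" "b = xs ! j"
        by (metis in_set_conv_nth)
      then show ?thesis using ab(3) f2 ys(1) len by (simp add: nth_eq_iff_index_eq)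
    next
      assume "a \<in> set xs" "b \<notin> set xs"
      then obtain i where "i < length xs" "a = xs ! i" by (metis in_set_conv_nth)
      then show ?thesis using ab f1[OF \<open>b \<notin> set xs\<close>] f2 ny by metis
    next
      assume "a \<notin> set xs" "b \<in> set xs"
      then obtain i where "i < length xs" "b = xs ! i" by (metis in_set_conv_nth)
      then show ?thesis using ab f1[OF \<open>a \<notin> set xs\<close>] f2 ny by metis
    qed (use ab f1 in auto)
  qed
  then show "distinct (replace_letters xs ys D)" using D by (simp add: r distinct_map)
  have "f ` (set D - set xs) = set D - set xs" using f1 by auto
  moreover have "f ` set xs = set ys"
    unfolding set_conv_nth using f2 len by (auto simp: image_iff) metis+
  moreover have "set D = (set D - set xs) \<union> set xs" using xs(2) by blast
  ultimately show "set (replace_letters xs ys D) = set D - set xs \<union> set ys"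
    unfolding r set_map by (metis image_Un)
qed

lemma paired_letters_set:
  "set (paired_letters n D) = {z \<in> {1..n}. z \<in> set D \<and> bar n z \<in> set D}"
  "distinct (paired_letters n D)"
  "i < j \<Longrightarrow> j < length (paired_letters n D) \<Longrightarrow> paired_letters n D ! j < paired_letters n D ! i"
proof -
  let ?S = "{z \<in> {1..n}. z \<in> set D \<and> bar n z \<in> set D}"
  show "set (paired_letters n D) = ?S" "distinct (paired_letters n D)" by (simp_all add: paired_letters_def)
  have "sorted_wrt (\<lambda>x y. y < x) (rev (sorted_list_of_set ?S))"
    by (simp add: sorted_wrt_rev strict_sorted_list_of_set)
  then show "paired_letters n D ! j < paired_letters n D ! i"
    if "i < j" "j < length (paired_letters n D)"
    using that sorted_wrt_nth_less unfolding paired_letters_def by fastforce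
qed

lemma is_splittingD:
  assumes "is_splitting n D ts" "i < length ts"
  shows "ts ! i \<in> {1..n}" "ts ! i < paired_letters n D ! i" "0 < i \<Longrightarrow> ts ! i < ts ! (i - 1)"
    "ts ! i \<notin> set D" "bar n (ts ! i) \<notin> set D"
    "t \<in> {1..n} \<Longrightarrow> t < paired_letters n D ! i \<Longrightarrow> (0 < i \<Longrightarrow> t < ts ! (i - 1)) \<Longrightarrow>
      t \<notin> set D \<Longrightarrow> bar n t \<notin> set D \<Longrightarrow> t \<le> ts ! i"
  using assms by (auto simp: is_splitting_iff split_cands_def)

lemma is_splitting_decreasing:
  assumes "is_splitting n D ts" "i < j" "j < length ts"
  shows "ts ! j < ts ! i"
  using assms(2,3)
proof (induction j)
  case (Suc j)
  then show ?case using is_splittingD(3)[OF assms(1), of "Suc j"] by (cases "i = j") auto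
qed simp

lemma is_splitting_distinct:
  assumes "is_splitting n D ts"
  shows "distinct ts"
  unfolding distinct_conv_nth
  using is_splitting_decreasing[OF assms] by (metis less_irrefl linorder_neqE_nat)

lemma KN_split_columns:
  assumes c: "is_column n D" and s: "is_splitting n D ts"
  defines "Z \<equiv> set (paired_letters n D)" and "T \<equiv> set ts"
  shows "set (l_col n D) = set D - Z \<union> T" "set (r_col n D) = set D - bar n ` Z \<union> bar n ` T"
    "distinct (l_col n D)" "distinct (r_col n D)" "length (l_col n D) = length D"
    "length (r_col n D) = length D"
proof -
  let ?zs = "paired_letters n D"
  have D: "distinct D" using c by (simp add: is_column_def strict_sorted_iff)
  have Z: "Z = {z \<in> {1..n}. z \<in> set D \<and> bar n z \<in> set D}" "distinct ?zs"
    unfolding Z_def using paired_letters_set by auto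
  have len: "length ?zs = length ts" using s by (simp add: is_splitting_iff)
  have T: "t \<in> {1..n} \<and> t \<notin> set D \<and> bar n t \<notin> set D" if "t \<in> T" for t
    using that is_splittingD[OF s] unfolding T_def by (metis in_set_conv_nth)
  have spl: "splitting n D = ts" by (rule splitting_eq[OF s])
  have "T \<subseteq> {1..n}" "Z \<subseteq> {1..n}" using Z T by auto
  then have L: "Z \<subseteq> letters n" "T \<subseteq> letters n" by (auto simp: letters_def)
  have binj: "inj_on (bar n) (letters n)" using bar_inj by (auto simp: inj_on_def)
  have d: "distinct (map (bar n) ?zs)" "distinct (map (bar n) ts)"
    unfolding distinct_map using Z(2) is_splitting_distinct[OF s] L
    by (auto simp: Z_def T_def intro: inj_on_subset[OF binj])
  note l = replace_letters_props[of ?zs D ts]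
  have l': "distinct (replace_letters ?zs ts D)" "length (replace_letters ?zs ts D) = length D"
    "set (replace_letters ?zs ts D) = set D - Z \<union> T"
    using l Z T is_splitting_distinct[OF s] len D unfolding Z_def T_def by blast+
  have r': "distinct (replace_letters (map (bar n) ?zs) (map (bar n) ts) D)"
    "length (replace_letters (map (bar n) ?zs) (map (bar n) ts) D) = length D"
    "set (replace_letters (map (bar n) ?zs) (map (bar n) ts) D) = set D - bar n ` Z \<union> bar n ` T"
  proof -
    have "set (map (bar n) ?zs) \<subseteq> set D" using Z by (auto simp: Z_def)
    moreover have "set (map (bar n) ts) \<inter> set D = {}" using T by (auto simp: T_def)
    ultimately show "distinct (replace_letters (map (bar n) ?zs) (map (bar n) ts) D)"
      "length (replace_letters (map (bar n) ?zs) (map (bar n) ts) D) = length D"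
      "set (replace_letters (map (bar n) ?zs) (map (bar n) ts) D) = set D - bar n ` Z \<union> bar n ` T"
      using replace_letters_props[of "map (bar n) ?zs" D "map (bar n) ts"] d len D
      by (simp_all add: Z_def T_def)
  qed
  show "set (l_col n D) = set D - Z \<union> T" "set (r_col n D) = set D - bar n ` Z \<union> bar n ` T"
    "distinct (l_col n D)" "distinct (r_col n D)" "length (l_col n D) = length D"
    "length (r_col n D) = length D"
    using l' r' by (simp_all add: l_col_def r_col_def spl)
qed

lemma card_ge_nth:
  assumes "distinct xs"
  shows "card {x \<in> set xs. s \<le> x} = card {j. j < length xs \<and> s \<le> xs ! j}"
proof -
  have "{x \<in> set xs. s \<le> x} = (\<lambda>j. xs ! j) ` {j. j < length xs \<and> s \<le> xs ! j}"
    by (auto simp: in_set_conv_nth)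
  moreover have "inj_on (\<lambda>j. xs ! j) {j. j < length xs \<and> s \<le> xs ! j}"
    using assms by (auto simp: inj_on_def nth_eq_iff_index_eq)
  ultimately show ?thesis by (simp add: card_image)
qed

lemma pos_count_diff:
  assumes fin: "finite A" "finite A'"
    and Z: "Z \<subseteq> {1..n}" "T \<subseteq> {1..n}"
    and sets: "\<And>r. 1 \<le> r \<Longrightarrow> r \<le> n \<Longrightarrow> r \<in> A' \<and> r \<notin> A \<longleftrightarrow> r \<in> Z"
      "\<And>r. 1 \<le> r \<Longrightarrow> r \<le> n \<Longrightarrow> r \<in> A \<and> r \<notin> A' \<longleftrightarrow> r \<in> T" "0 \<notin> A" "0 \<notin> A'"
  shows "pos_count n A' s - pos_count n A s = int (card {z \<in> Z. s \<le> z}) - int (card {t \<in> T. s \<le> t})"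
proof -
  let ?A = "{r \<in> A. s \<le> r \<and> r \<le> n}" and ?A' = "{r \<in> A'. s \<le> r \<and> r \<le> n}"
  let ?I = "{r \<in> A \<inter> A'. s \<le> r \<and> r \<le> n}"
  have r1: "1 \<le> r" if "r \<in> A \<or> r \<in> A'" for r using that sets(3,4) by (cases r) auto
  have ZT: "z \<in> Z \<Longrightarrow> 1 \<le> z \<and> z \<le> n" "z \<in> T \<Longrightarrow> 1 \<le> z \<and> z \<le> n" for z using Z by auto
  have A': "?A' = ?I \<union> {z \<in> Z. s \<le> z}" "?I \<inter> {z \<in> Z. s \<le> z} = {}"
    using sets(1) r1 ZT(1) by blast+
  have A: "?A = ?I \<union> {t \<in> T. s \<le> t}" "?I \<inter> {t \<in> T. s \<le> t} = {}"
    using sets(2) r1 ZT(2) by blast+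
  have "finite Z" "finite T" using finite_subset[OF Z(1)] finite_subset[OF Z(2)] by auto
  then have f: "finite ?I" "finite {z \<in> Z. s \<le> z}" "finite {t \<in> T. s \<le> t}" using fin by auto
  have "card ?A' = card ?I + card {z \<in> Z. s \<le> z}" "card ?A = card ?I + card {t \<in> T. s \<le> t}"
    using card_Un_disjoint[OF f(1,2) A'(2)] card_Un_disjoint[OF f(1,3) A(2)]
    unfolding A'(1)[symmetric] A(1)[symmetric] .
  then show ?thesis by (simp add: pos_count_def)
qed

lemma KN_columns_dominated:
  assumes c: "is_column n D" and s: "is_splitting n D ts"
  shows "transversal n (set (l_col n D))" "transversal n (set (r_col n D))"
    "sign_dom n (set (l_col n D)) (set (r_col n D))"
proof -
  let ?zs = "paired_letters n D"
  define Z where "Z = set ?zs"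
  define T where "T = set ts"
  define A where "A = set (l_col n D)"
  define A' where "A' = set (r_col n D)"
  have DL: "set D \<subseteq> letters n" using c by (simp add: is_column_def)
  have Z: "Z = {z \<in> {1..n}. z \<in> set D \<and> bar n z \<in> set D}"
    unfolding Z_def by (rule paired_letters_set(1))
  have len: "length ?zs = length ts" using s by (simp add: is_splitting_iff)
  have T: "t \<in> {1..n}" "t \<notin> set D" "bar n t \<notin> set D" if "t \<in> T" for t
    using that is_splittingD[OF s] unfolding T_def by (metis in_set_conv_nth)+
  have lr: "A = set D - Z \<union> T" "A' = set D - bar n ` Z \<union> bar n ` T"
    using KN_split_columns[OF c s] by (simp_all add: A_def A'_def Z_def T_def)
  have mL: "m \<in> letters n" "bar n (bar n m) = m" "n < bar n m" if "m \<in> {1..n}" for m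
    using that by (auto simp: letters_def bar_def)
  have neg: "m \<notin> bar n ` Z" "m \<notin> bar n ` T" if "m \<le> n" for m
    using that Z T(1) mL(3) by force+
  have Am: "m \<in> A \<longleftrightarrow> m \<in> set D \<and> bar n m \<notin> set D \<or> m \<in> T"
    "bar n m \<in> A \<longleftrightarrow> bar n m \<in> set D"
    "m \<in> A' \<longleftrightarrow> m \<in> set D"
    "bar n m \<in> A' \<longleftrightarrow> bar n m \<in> set D \<and> m \<notin> set D \<or> m \<in> T"
    if m: "m \<in> {1..n}" for m
  proof -
    have bb: "bar n m \<in> bar n ` S \<longleftrightarrow> m \<in> S" if "S \<subseteq> {1..n}" for S
      using that mL(2)[OF m] mL(2) by (metis image_iff subsetD)
    have sub: "Z \<subseteq> {1..n}" "T \<subseteq> {1..n}" using Z T(1) by auto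
    have bZ: "bar n m \<notin> Z" "bar n m \<notin> T" using mL(3)[OF m] sub by force+
    show "m \<in> A \<longleftrightarrow> m \<in> set D \<and> bar n m \<notin> set D \<or> m \<in> T" using m by (auto simp: lr(1) Z)
    show "bar n m \<in> A \<longleftrightarrow> bar n m \<in> set D" using bZ by (auto simp: lr(1))
    show "m \<in> A' \<longleftrightarrow> m \<in> set D" using neg m by (auto simp: lr(2))
    show "bar n m \<in> A' \<longleftrightarrow> bar n m \<in> set D \<and> m \<notin> set D \<or> m \<in> T"
      unfolding lr(2) using bb[OF sub(1)] bb[OF sub(2)] m by (auto simp: Z)
  qed
  have AL: "A \<subseteq> letters n" "A' \<subseteq> letters n"
    using DL T(1) mL(1) bar_letters unfolding lr by auto
  have half: "a \<in> {1..n} \<or> bar n a \<in> {1..n} \<and> a = bar n (bar n a)" if "a \<in> letters n" for a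
    using that by (auto simp: letters_def bar_def)
  have tr: "transversal n S" if "S \<subseteq> letters n" "\<And>m. m \<in> {1..n} \<Longrightarrow> \<not> (m \<in> S \<and> bar n m \<in> S)" for S
    unfolding transversal_def
  proof (intro conjI ballI notI)
    fix w assume w: "w \<in> S" "bar n w \<in> S"
    then have "w \<in> letters n" using that(1) by blast
    then show False using half[of w] that(2)[of w] that(2)[of "bar n w"] w by auto
  qed (fact that(1))
  show "transversal n (set (l_col n D))"
    unfolding A_def[symmetric] by (rule tr[OF AL(1)]) (use Am T in blast)
  show "transversal n (set (r_col n D))"
    unfolding A'_def[symmetric] by (rule tr[OF AL(2)]) (use Am T in blast)
  have abs: "abs_set n A = abs_set n A'"
    unfolding abs_set_def using Am T by blast
  let ?Iz = "\<lambda>s. {j. j < length ?zs \<and> s \<le> ?zs ! j}" and ?It = "\<lambda>s. {j. j < length ts \<and> s \<le> ts ! j}"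
  have cnt: "pos_count n A' s - pos_count n A s = int (card (?Iz s)) - int (card (?It s))" for s
  proof -
    have "pos_count n A' s - pos_count n A s = int (card {z \<in> Z. s \<le> z}) - int (card {t \<in> T. s \<le> t})"
    proof (rule pos_count_diff)
      show "finite A" "finite A'" by (simp_all add: A_def A'_def)
      show "Z \<subseteq> {1..n}" "T \<subseteq> {1..n}" using Z T(1) by auto
      show "r \<in> A' \<and> r \<notin> A \<longleftrightarrow> r \<in> Z" "r \<in> A \<and> r \<notin> A' \<longleftrightarrow> r \<in> T" if "1 \<le> r" "r \<le> n" for r
        using Am(1,3)[of r] that T[of r] by (auto simp: Z)
      show "0 \<notin> A" "0 \<notin> A'" using AL by (auto simp: letters_def)
    qed
    then show ?thesis
      using card_ge_nth[OF paired_letters_set(2)[of n D], of s] card_ge_nth[OF is_splitting_distinct[OF s], of s]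
      by (simp add: Z_def T_def)
  qed
  have sub: "?It s \<subseteq> ?Iz s" for s
    using is_splittingD(2)[OF s] len by fastforce
  have finI: "finite (?Iz s)" for s by simp
  have eq: "?Iz t = ?It t" if t: "t \<notin> abs_set n A" for t
  proof (rule ccontr)
    assume "?Iz t \<noteq> ?It t"
    then obtain i where i: "i < length ts" "t \<le> ?zs ! i" "ts ! i < t" using sub[of t] len by force
    define i0 where "i0 = (LEAST i. ts ! i < t)"
    have i0: "ts ! i0 < t" "i0 \<le> i" unfolding i0_def using i(3) by (auto intro: LeastI Least_le)
    have l0: "i0 < length ts" using i0 i by simp
    have "?zs ! i \<in> Z" unfolding Z_def using i len by simp
    then have zi: "?zs ! i \<in> {1..n}" "?zs ! i \<in> abs_set n A"
      using Am(2)[of "?zs ! i"] by (auto simp: Z abs_set_def)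
    have "?zs ! i \<le> ?zs ! i0"
      using i0(2) paired_letters_set(3)[of i0 i n D] i(1) len by (cases "i0 = i") auto
    moreover have "t \<noteq> ?zs ! i" using zi(2) t by metis
    ultimately have tz: "t < ?zs ! i0" using i(2) by simp
    have t1: "t \<in> {1..n}" using i0(1) zi(1) i(2) by auto
    have "t < ts ! (i0 - 1)" if "0 < i0"
    proof -
      have "\<not> ts ! (i0 - 1) < t" using not_less_Least[of "i0 - 1" "\<lambda>i. ts ! i < t"] that
        by (auto simp: i0_def)
      moreover have tT: "ts ! (i0 - 1) \<in> T" using l0 by (simp add: T_def)
      have "ts ! (i0 - 1) \<in> abs_set n A"
        using Am(1)[OF T(1)[OF tT]] tT T(1)[OF tT] by (simp add: abs_set_def)
      then have "ts ! (i0 - 1) \<noteq> t" using t by metis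
      ultimately show ?thesis by simp
    qed
    moreover have "t \<notin> set D" "bar n t \<notin> set D" using t t1 Am[OF t1] by (auto simp: abs_set_def)
    ultimately have "t \<le> ts ! i0" using is_splittingD(6)[OF s l0 t1 tz] by blast
    then show False using i0(1) by simp
  qed
  show "sign_dom n (set (l_col n D)) (set (r_col n D))"
    unfolding sign_dom_def A_def[symmetric] A'_def[symmetric]
  proof (intro conjI allI impI abs)
    fix t
    show "pos_count n A t \<le> pos_count n A' t" using cnt[of t] card_mono[OF finI sub, of t] by simp
    show "pos_count n A t = pos_count n A' t" if "t \<notin> abs_set n A"
      using cnt[of t] eq[OF that] by simp
  qed
qed

text \<open>Splitting leaves the unbarred letters in the right column and the barred ones in the
  left column untouched, so \<open>D\<close> is read off from these. The unbarred letters on which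
  the columns disagree are the paired letters \<open>Z\<close> and the inserted letters
  \<open>T\<close>; the inequalities of counts give t_i < z_i, the equalities give
  maximality.\<close>

lemma KN_column_exists:
  assumes A: "transversal n A" and A': "transversal n A'" and d: "sign_dom n A A'"
  shows "\<exists>D. KN_column n D \<and> length D = card A \<and> set (l_col n D) = A \<and> set (r_col n D) = A'"
proof -
  define S where "S = {r \<in> A'. r \<le> n} \<union> {r \<in> A. n < r}"
  define T where "T = {t \<in> {1..n}. t \<in> A \<and> bar n t \<in> A'}"
  define Z where "Z = {z \<in> {1..n}. z \<in> A' \<and> bar n z \<in> A}"
  define D where "D = sorted_list_of_set S"
  define ts where "ts = rev (sorted_list_of_set T)"
  have fin: "finite A" "finite A'" "finite S" "finite T" "finite Z"
    using transversal_finite A A' by (auto simp: S_def T_def Z_def)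
  have AL: "A \<subseteq> letters n" "A' \<subseteq> letters n" using A A' by (auto simp: transversal_def)
  have tr: "\<not> (m \<in> A \<and> bar n m \<in> A)" "\<not> (m \<in> A' \<and> bar n m \<in> A')" for m
    using A A' by (auto simp: transversal_def)
  have bn: "n < bar n m" if "m \<in> {1..n}" for m using that by (auto simp: bar_def)
  have abs: "m \<in> A \<or> bar n m \<in> A \<longleftrightarrow> m \<in> A' \<or> bar n m \<in> A'" if "m \<in> {1..n}" for m
    using d that unfolding sign_dom_def abs_set_def by blast
  have setD: "set D = S" using fin by (simp add: D_def)
  have Sm: "m \<in> S \<longleftrightarrow> m \<in> A'" "bar n m \<in> S \<longleftrightarrow> bar n m \<in> A" if "m \<in> {1..n}" for m
    using that bn[OF that] by (auto simp: S_def)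
  have col: "is_column n D"
    using fin AL by (auto simp: is_column_def setD S_def D_def strict_sorted_list_of_set)
  have zs: "paired_letters n D = rev (sorted_list_of_set Z)"
  proof -
    have "{z \<in> {1..n}. z \<in> set D \<and> bar n z \<in> set D} = Z" using Sm by (auto simp: setD Z_def)
    then show ?thesis by (simp add: paired_letters_def)
  qed
  let ?zs = "paired_letters n D"
  have sets: "set ts = T" "set ?zs = Z" "distinct ts" "distinct ?zs" using fin by (auto simp: ts_def zs)
  have dec: "ts ! j < ts ! i" if "i < j" "j < length ts" for i j
  proof -
    have "sorted_wrt (\<lambda>x y. y < x) ts"
      by (simp add: ts_def sorted_wrt_rev strict_sorted_list_of_set)
    then show ?thesis using that sorted_wrt_nth_less by fastforce
  qed
  note decz = paired_letters_set(3)[of _ _ n D]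
  have cnt: "pos_count n A' s - pos_count n A s =
      int (card {j. j < length ?zs \<and> s \<le> ?zs ! j}) - int (card {j. j < length ts \<and> s \<le> ts ! j})" for s
  proof -
    have "pos_count n A' s - pos_count n A s = int (card {z \<in> Z. s \<le> z}) - int (card {t \<in> T. s \<le> t})"
    proof (rule pos_count_diff)
      show "Z \<subseteq> {1..n}" "T \<subseteq> {1..n}" by (auto simp: Z_def T_def)
      show "r \<in> A' \<and> r \<notin> A \<longleftrightarrow> r \<in> Z" "r \<in> A \<and> r \<notin> A' \<longleftrightarrow> r \<in> T" if "1 \<le> r" "r \<le> n" for r
        using abs[of r] tr[of r] that by (auto simp: Z_def T_def)
      show "0 \<notin> A" "0 \<notin> A'" using AL by (auto simp: letters_def)
    qed (use fin in auto)
    then show ?thesis using card_ge_nth[OF sets(3), of s] card_ge_nth[OF sets(4), of s] sets(1,2) by simp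
  qed
  have ge: "card {j. j < length ts \<and> s \<le> ts ! j} \<le> card {j. j < length ?zs \<and> s \<le> ?zs ! j}" for s
  proof -
    have "pos_count n A s \<le> pos_count n A' s" using d unfolding sign_dom_def by blast
    then show ?thesis using cnt[of s] by linarith
  qed
  have eq: "card {j. j < length ts \<and> s \<le> ts ! j} = card {j. j < length ?zs \<and> s \<le> ?zs ! j}"
    if "s \<notin> abs_set n A" for s
  proof -
    have "pos_count n A s = pos_count n A' s" using d that unfolding sign_dom_def by blast
    then show ?thesis using cnt[of s] by linarith
  qed
  \<comment> \<open>The threshold 0 is no absolute value, so equality there compares the total
    numbers of letters.\<close>
  have len: "length ts = length ?zs" using eq[of 0] by (simp add: abs_set_def)
  have tT: "ts ! i \<in> T" if "i < length ts" for i using that sets(1) by (metis nth_mem)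
  have zZ: "?zs ! i \<in> Z" if "i < length ts" for i using that sets(2) len by (metis nth_mem)
  have TZ: "T \<inter> Z = {}" using tr(1) by (auto simp: T_def Z_def)
  have lt: "ts ! i < ?zs ! i" if i: "i < length ts" for i
  proof (rule ccontr)
    assume "\<not> ts ! i < ?zs ! i"
    moreover have "ts ! i \<noteq> ?zs ! i" using tT[OF i] zZ[OF i] TZ by (metis IntI empty_iff)
    ultimately have H: "?zs ! i < ts ! i" by simp
    \<comment> \<open>At threshold \<open>ts ! i\<close> at least \<open>i + 1\<close> letters of
      \<open>ts\<close> are counted, but at most \<open>i\<close> of \<open>?zs\<close>.\<close>
    have "{..i} \<subseteq> {j. j < length ts \<and> ts ! i \<le> ts ! j}"
      using dec i by (auto simp: le_less)
    then have "card {..i} \<le> card {j. j < length ts \<and> ts ! i \<le> ts ! j}" by (intro card_mono) auto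
    moreover have "{j. j < length ?zs \<and> ts ! i \<le> ?zs ! j} \<subseteq> {..<i}"
    proof
      fix j assume j: "j \<in> {j. j < length ?zs \<and> ts ! i \<le> ?zs ! j}"
      show "j \<in> {..<i}"
      proof (rule ccontr)
        assume "j \<notin> {..<i}"
        then have "?zs ! j \<le> ?zs ! i" using decz[of i j] j by (cases "j = i") auto
        then show False using H j by simp
      qed
    qed
    then have "card {j. j < length ?zs \<and> ts ! i \<le> ?zs ! j} \<le> card {..<i}" by (intro card_mono) auto
    ultimately show False using ge[of "ts ! i"] by simp
  qed
  have max: "t \<le> ts ! i" if i: "i < length ts" and t: "t \<in> {1..n}" "t < ?zs ! i" "0 < i \<longrightarrow> t < ts ! (i - 1)"
    "t \<notin> set D" "bar n t \<notin> set D" for i t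
  proof (rule ccontr)
    assume H: "\<not> t \<le> ts ! i"
    have below: "{j. j < length ts \<and> t \<le> ts ! j} \<subseteq> {..<i}"
    proof
      fix j assume j: "j \<in> {j. j < length ts \<and> t \<le> ts ! j}"
      show "j \<in> {..<i}"
      proof (rule ccontr)
        assume "j \<notin> {..<i}"
        then have "ts ! j \<le> ts ! i" using dec[of i j] j by (cases "j = i") auto
        then show False using H j by simp
      qed
    qed
    have "t \<notin> T"
    proof
      assume "t \<in> T"
      then obtain j where j: "j < length ts" "ts ! j = t" using sets(1) by (metis in_set_conv_nth)
      then have "j < i" using below by auto
      then have "j = i - 1 \<or> j < i - 1" by linarith
      moreover have "i - 1 < length ts" using i by linarith
      ultimately have "ts ! (i - 1) \<le> ts ! j" using dec[of j "i - 1"] by auto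
      then show False using t(3) j \<open>j < i\<close> by auto
    qed
    then have na: "t \<notin> abs_set n A"
      using t(1,4,5) Sm[OF t(1)] abs[OF t(1)] by (auto simp: abs_set_def setD T_def)
    have "card {j. j < length ts \<and> t \<le> ts ! j} \<le> card {..<i}"
      using below by (intro card_mono) auto
    moreover have "{..i} \<subseteq> {j. j < length ?zs \<and> t \<le> ?zs ! j}"
    proof
      fix j assume "j \<in> {..i}"
      then have "j < length ?zs" "?zs ! i \<le> ?zs ! j" using decz[of j i] i len by (cases "j = i"; auto)+
      then show "j \<in> {j. j < length ?zs \<and> t \<le> ?zs ! j}" using t(2) by auto
    qed
    then have "card {..i} \<le> card {j. j < length ?zs \<and> t \<le> ?zs ! j}" by (intro card_mono) auto
    ultimately show False using eq[OF na] by simp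
  qed
  have spl: "is_splitting n D ts"
    unfolding is_splitting_iff
  proof (intro conjI allI impI)
    show "length ts = length ?zs" by (fact len)
    fix i assume it: "i < length ts"
    have "ts ! i \<in> {1..n}" "ts ! i \<notin> set D" "bar n (ts ! i) \<notin> set D"
    proof -
      have t: "ts ! i \<in> {1..n}" "ts ! i \<in> A" "bar n (ts ! i) \<in> A'" using tT[OF it] by (auto simp: T_def)
      then show "ts ! i \<in> {1..n}" "ts ! i \<notin> set D" "bar n (ts ! i) \<notin> set D"
        using Sm[OF t(1)] tr by (auto simp: setD)
    qed
    moreover have "0 < i \<longrightarrow> ts ! i < ts ! (i - 1)" using dec[of "i - 1" i] it by auto
    ultimately show "ts ! i \<in> split_cands n D ts i" using lt[OF it] by (simp add: split_cands_def)
    show "\<forall>t\<in>split_cands n D ts i. t \<le> ts ! i" using max[OF it] by (simp add: split_cands_def)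
  qed
  note kn = KN_split_columns[OF col spl, unfolded setD sets]
  have half: "a \<in> {1..n} \<or> bar n a \<in> {1..n} \<and> a = bar n (bar n a)" if "a \<in> letters n" for a
    using that by (auto simp: letters_def bar_def)
  have bars: "bar n m \<in> bar n ` U \<longleftrightarrow> m \<in> U" if "m \<in> {1..n}" "U \<subseteq> {1..n}" for m U
  proof -
    have "x = m" if "x \<in> U" "bar n m = bar n x" for x
      using that \<open>m \<in> {1..n}\<close> \<open>U \<subseteq> {1..n}\<close> bar_inj[of m n x] by (auto simp: letters_def)
    then show ?thesis by blast
  qed
  have sub: "Z \<subseteq> {1..n}" "T \<subseteq> {1..n}" by (auto simp: Z_def T_def)
  have eqI: "U = V" if "U \<subseteq> letters n" "V \<subseteq> letters n"
    "\<And>m. m \<in> {1..n} \<Longrightarrow> (m \<in> U \<longleftrightarrow> m \<in> V) \<and> (bar n m \<in> U \<longleftrightarrow> bar n m \<in> V)" for U V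
  proof (intro set_eqI)
    fix a show "a \<in> U \<longleftrightarrow> a \<in> V"
    proof (cases "a \<in> letters n")
      case True
      then show ?thesis using half[OF True] that(3) by metis
    qed (use that in blast)
  qed
  have SL: "S \<subseteq> letters n" using AL by (auto simp: S_def)
  have bL: "bar n ` T \<subseteq> letters n" "T \<subseteq> letters n" using sub bar_letters by (auto simp: letters_def bar_def)
  have "S - Z \<union> T = A"
  proof (rule eqI)
    fix m assume m: "m \<in> {1..n}"
    have "bar n m \<notin> Z" "bar n m \<notin> T" using bn[OF m] sub by force+
    then show "(m \<in> S - Z \<union> T \<longleftrightarrow> m \<in> A) \<and> (bar n m \<in> S - Z \<union> T \<longleftrightarrow> bar n m \<in> A)"
      using Sm[OF m] m abs[OF m] tr[of m] by (auto simp: Z_def T_def)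
  qed (use SL bL AL in auto)
  moreover have "S - bar n ` Z \<union> bar n ` T = A'"
  proof (rule eqI)
    fix m assume m: "m \<in> {1..n}"
    have "m \<notin> bar n ` Z" "m \<notin> bar n ` T" using bn sub m by force+
    then show "(m \<in> S - bar n ` Z \<union> bar n ` T \<longleftrightarrow> m \<in> A') \<and>
        (bar n m \<in> S - bar n ` Z \<union> bar n ` T \<longleftrightarrow> bar n m \<in> A')"
      using Sm[OF m] m abs[OF m] tr[of m] bars[OF m sub(1)] bars[OF m sub(2)]
      by (auto simp: Z_def T_def)
  qed (use SL bL AL in auto)
  ultimately have "set (l_col n D) = A" "set (r_col n D) = A'" using kn(1,2) by simp_all
  moreover have "length D = card A" using calculation(1) kn(3,5) distinct_card by metis
  ultimately show ?thesis using col spl unfolding KN_column_def by blast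
qed

section \<open>Foldings and walks\<close>

definition stage_roots :: "nat \<Rightarrow> root set" where
  "stage_roots n = {stage_root n i l | i l. 1 \<le> i \<and> i \<le> n \<and> i < l \<and> l \<le> 2 * n}"

lemma stage_root_pos: "stage_roots n \<subseteq> pos_roots n"
proof
  fix \<beta> assume "\<beta> \<in> stage_roots n"
  then obtain i l where il: "\<beta> = stage_root n i l" "1 \<le> i" "i \<le> n" "i < l" "l \<le> 2 * n"
    by (auto simp: stage_roots_def)
  consider "l \<le> n" | "l = bar n i" | "n < l" "l < bar n i" | "bar n i < l" by linarith
  then show "\<beta> \<in> pos_roots n"
  proof cases
    case 1
    then have "\<beta> = (i, l)" using il by (auto simp: stage_root_def bar_def)
    then show ?thesis using 1 il by (auto simp: pos_roots_def)
  next
    case 2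
    then have "\<beta> = (i, bar n i)" using il by (auto simp: stage_root_def)
    then show ?thesis using il by (auto simp: pos_roots_def)
  next
    case 3
    then have "\<beta> = (i, bar n (bar n l))" "i < bar n l" "bar n l \<le> n"
      using il by (auto simp: stage_root_def bar_def)
    then show ?thesis using il unfolding pos_roots_def by blast
  next
    case 4
    then have "\<beta> = (bar n l, bar n i)" "1 \<le> bar n l" "bar n l < i"
      using il by (auto simp: stage_root_def bar_def)
    then show ?thesis using il unfolding pos_roots_def by blast
  qed
qed

lemma rho_pairing_pos: "\<beta> \<in> pos_roots n \<Longrightarrow> 1 \<le> rho_pairing n \<beta>"
  by (auto simp: pos_roots_def rho_pairing.simps bar_def)

lemma stage_roots_step:
  assumes "\<beta> \<in> stage_roots n" "v \<in> signed_perms n"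
  shows "v \<circ> reflection n \<beta> \<in> signed_perms n" "v \<circ> reflection n \<beta> \<circ> reflection n \<beta> = v"
    "len n (v \<circ> reflection n \<beta>) \<noteq> len n v"
    "len n (v \<circ> reflection n \<beta>) + 1 \<le> len n v + 2 * rho_pairing n \<beta>"
proof -
  obtain i l where il: "\<beta> = stage_root n i l" "1 \<le> i" "i \<le> n" "i < l" "l \<le> 2 * n"
    using assms(1) by (auto simp: stage_roots_def)
  show "v \<circ> reflection n \<beta> \<in> signed_perms n" "v \<circ> reflection n \<beta> \<circ> reflection n \<beta> = v"
    unfolding il(1) reflection_stage_root[OF il(2-5)]
    using reflection_signed_perm[OF il(2-5) assms(2)] reflection_invol[OF il(2-5)] by auto
  show "len n (v \<circ> reflection n \<beta>) \<noteq> len n v"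
    "len n (v \<circ> reflection n \<beta>) + 1 \<le> len n v + 2 * rho_pairing n \<beta>"
    using qedge_stage_root(2,3)[OF assms(2) il(2-5)] il(1) by auto
qed

lemma bruhat_less_len: "bruhat_less n u v \<Longrightarrow> len n u < len n v"
proof (induction rule: bruhat_less.induct)
  case (step u \<beta>)
  from step(3) show ?case .
next
  case (trans u v w)
  then show ?case by linarith
qed

text \<open>Lengths grow along Bruhat chains, so for a single reflection comparing lengths suffices;
  the sign of a folding is read off from them.\<close>

lemma bruhat_less_reflection:
  assumes "\<beta> \<in> stage_roots n" "v \<in> signed_perms n"
  shows "bruhat_less n v (v \<circ> reflection n \<beta>) \<longleftrightarrow> len n v < len n (v \<circ> reflection n \<beta>)"
  using bruhat_less_len bruhat_less.step[OF assms(2)] assms(1) stage_root_pos by blast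

lemma id_signed_perm: "id \<in> signed_perms n"
  by (auto simp: signed_perms_def permutes_id)

lemma len_id: "len n id = 0"
proof -
  have "{(k, l). k \<in> {1..n} \<and> l \<in> letters n \<and> k \<le> letter_abs n l \<and> id k > id l} = {}"
    by (auto simp: letter_abs_def split: if_splits)
  then show ?thesis by (simp only: len_def card.empty)
qed

lemma len_zero_id:
  assumes v: "v \<in> signed_perms n" and l: "len n v = 0"
  shows "v = id"
proof
  have "card (discord n v) = 0" using two_len[OF v] l by simp
  then have D: "discord n v = {}" by simp
  fix x
  show "v x = id x"
  proof (cases "x \<in> letters n")
    case True
    then show ?thesis
    proof (induction x rule: less_induct)
      case (less x)
      have vx: "v x \<in> letters n" using signed_permD(3)[OF v less.prems] .
      have "\<not> v x < x"
      proof
        assume lt: "v x < x"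
        then have "v (v x) = v x" using less.IH[OF lt vx] by simp
        then show False using lt signed_permD(2)[OF v] by (auto simp: inj_eq)
      qed
      moreover have "\<not> x < v x"
      proof
        assume lt: "x < v x"
        obtain z where z: "z \<in> letters n" "v z = x" using signed_perm_surj[OF v less.prems] .
        have "z \<noteq> x" using z lt by auto
        moreover have "\<not> z < x" using less.IH[of z] z by auto
        ultimately have "(x, z) \<in> discord n v" using z lt less.prems by (auto simp: discord_def)
        then show False using D by simp
      qed
      ultimately show ?case by simp
    qed
  next
    case False
    then show ?thesis using signed_permD(1)[OF v] by (auto simp: permutes_def)
  qed
qed

text \<open>The counterpart of \<open>fold_upto\<close> for an arbitrary list, which allows
  induction over the list.\<close>

definition fold_list :: "nat \<Rightarrow> (nat \<Rightarrow> nat) \<Rightarrow> root list \<Rightarrow> nat set \<Rightarrow> nat \<Rightarrow> nat \<Rightarrow> nat" where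
  "fold_list n w L J p = foldl (\<lambda>u \<beta>. u \<circ> reflection n \<beta>) w (nths (take p L) J)"

lemma fold_list_0: "fold_list n w L J 0 = w"
  by (simp add: fold_list_def)

lemma fold_list_Suc:
  assumes "p < length L"
  shows "fold_list n w L J (Suc p) =
    (if p \<in> J then fold_list n w L J p \<circ> reflection n (L ! p) else fold_list n w L J p)"
  using assms by (simp add: fold_list_def take_Suc_conv_app_nth nths_append)

lemma fold_list_signed:
  assumes "w \<in> signed_perms n" "set L \<subseteq> stage_roots n" "p \<le> length L"
  shows "fold_list n w L J p \<in> signed_perms n"
  using assms(3)
proof (induction p)
  case (Suc p)
  then have "L ! p \<in> stage_roots n" using assms(2) by (meson Suc_le_lessD nth_mem subsetD)
  then show ?case using Suc stage_roots_step(1) by (auto simp: fold_list_Suc)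
qed (simp add: fold_list_0 assms)

text \<open>Reflections are involutions, so a piece of a folding path is undone from its end by
  reversing roots and bits. The general bounds \<open>p\<close> and \<open>q\<close> let the same
  statement serve for single blocks.\<close>

lemma fold_list_walk:
  assumes w: "w \<in> signed_perms n" and L: "set L \<subseteq> stage_roots n" and pq: "p \<le> q" "q \<le> length L"
  shows "qwalk n (fold_list n w L J q) (rev (drop p (take q L))) (rev (map (\<lambda>r. r \<in> J) [p..<q]))
      (fold_list n w L J p) \<longleftrightarrow>
    (\<forall>r\<in>J. p \<le> r \<and> r < q \<longrightarrow> qedge n (fold_list n w L J (Suc r)) (L ! r))"
  using pq
proof (induction q rule: dec_induct)
  case base
  then show ?case by auto
next
  case (step q)
  let ?g = "fold_list n w L J"
  have q: "q < length L" using step.prems by simp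
  have Lq: "L ! q \<in> stage_roots n" using L q by auto
  have l: "rev (drop p (take (Suc q) L)) = L ! q # rev (drop p (take q L))"
    using step.hyps q by (simp add: take_Suc_conv_app_nth)
  have b: "rev (map (\<lambda>r. r \<in> J) [p..<Suc q]) = (q \<in> J) # rev (map (\<lambda>r. r \<in> J) [p..<q])"
    using step.hyps by simp
  have g: "(if q \<in> J then ?g (Suc q) \<circ> reflection n (L ! q) else ?g (Suc q)) = ?g q"
    using fold_list_Suc[OF q] stage_roots_step(2)[OF Lq fold_list_signed[OF w L]] q by auto
  have "qwalk n (?g (Suc q)) (rev (drop p (take (Suc q) L))) (rev (map (\<lambda>r. r \<in> J) [p..<Suc q])) (?g p) \<longleftrightarrow>
      (q \<in> J \<longrightarrow> qedge n (?g (Suc q)) (L ! q)) \<and>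
      qwalk n (?g q) (rev (drop p (take q L))) (rev (map (\<lambda>r. r \<in> J) [p..<q])) (?g p)"
    unfolding l b qwalk.simps(2) list.inject g[symmetric] by blast
  also have "\<dots> \<longleftrightarrow> (q \<in> J \<longrightarrow> qedge n (?g (Suc q)) (L ! q)) \<and>
      (\<forall>r\<in>J. p \<le> r \<and> r < q \<longrightarrow> qedge n (?g (Suc r)) (L ! r))"
    using step.IH q by simp
  also have "\<dots> \<longleftrightarrow> (\<forall>r\<in>J. p \<le> r \<and> r < Suc q \<longrightarrow> qedge n (?g (Suc r)) (L ! r))"
    using step.hyps by (auto simp: less_Suc_eq)
  finally show ?case .
qed

lemma walk_fold_list:
  assumes e: "e \<in> signed_perms n" and L: "set L \<subseteq> stage_roots n" and w: "qwalk n e (rev L) bs w"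
  defines "J \<equiv> {p. p < length bs \<and> rev bs ! p}"
  shows "fold_list n w L J (length L) = e \<and> w \<in> signed_perms n"
  using e L w unfolding J_def
proof (induction L arbitrary: e bs rule: rev_induct)
  case Nil
  then show ?case by (simp add: fold_list_def)
next
  case (snoc \<beta> L)
  obtain b cs where b: "bs = b # cs" "qwalk n (if b then e \<circ> reflection n \<beta> else e) (rev L) cs w"
    using snoc.prems(3) by (auto simp: qwalk.simps(2))
  have \<beta>: "\<beta> \<in> stage_roots n" using snoc.prems(2) by simp
  let ?e = "if b then e \<circ> reflection n \<beta> else e"
  have e': "?e \<in> signed_perms n" using stage_roots_step(1)[OF \<beta> snoc.prems(1)] snoc.prems(1) by simp
  have len: "length cs = length L" using qwalk_length[OF b(2)] by simp
  have IH: "fold_list n w L {p. p < length cs \<and> rev cs ! p} (length L) = ?e" "w \<in> signed_perms n"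
    using snoc.IH[OF e' _ b(2)] snoc.prems(2) by auto
  let ?J = "{p. p < length bs \<and> rev bs ! p}"
  have "nths L ?J = nths L {p. p < length cs \<and> rev cs ! p}"
    unfolding nths_def
    by (rule arg_cong[where f = "map fst"], rule filter_cong)
      (auto simp: b(1) len nth_append set_zip)
  then have "fold_list n w (L @ [\<beta>]) ?J (length L) = ?e" using IH by (simp add: fold_list_def)
  moreover have "length L \<in> ?J \<longleftrightarrow> b" using len by (simp add: b(1) nth_append)
  ultimately have "fold_list n w (L @ [\<beta>]) ?J (Suc (length L)) =
      (if b then ?e \<circ> reflection n \<beta> else ?e)"
    by (subst fold_list_Suc) auto
  also have "\<dots> = e" using stage_roots_step(2)[OF \<beta> snoc.prems(1)] by auto
  finally show ?case using IH(2) by simp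
qed

lemma stages_subset:
  assumes "i \<le> n" "\<And>j l. 1 \<le> j \<Longrightarrow> j \<le> i \<Longrightarrow> l \<in> set (f j) \<Longrightarrow> j < l \<and> l \<le> 2 * n"
  shows "set (stages n f i) \<subseteq> stage_roots n"
  using assms
proof (induction i)
  case (Suc i)
  have "set (stages n f i) \<subseteq> stage_roots n" using Suc by auto
  moreover have "stage_root n (Suc i) l \<in> stage_roots n" if "l \<in> set (f (Suc i))" for l
  proof -
    have "Suc i < l \<and> l \<le> 2 * n" using Suc.prems(2)[of "Suc i" l] that by simp
    then show ?thesis using Suc.prems(1) unfolding stage_roots_def
      by (intro CollectI exI[of _ "Suc i"] exI[of _ l]) auto
  qed
  ultimately show ?case by auto
qed simp

lemma Gamma_blocks_subset:
  assumes "k \<le> n"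
  shows "set (Gamma_l n k) \<subseteq> stage_roots n" "set (Gamma_r n k) \<subseteq> stage_roots n"
proof -
  have "set (stages n (full_stage n k) k) \<subseteq> stage_roots n"
    by (rule stages_subset[OF assms]) (use assms in \<open>auto simp: stage_lower_def stage_upper_def bar_def\<close>)
  then show "set (Gamma_l n k) \<subseteq> stage_roots n" using rev_Gamma_l[OF assms] by (metis set_rev)
  have "set (stages n (stage_upper n) k) \<subseteq> stage_roots n"
    by (rule stages_subset[OF assms]) (use assms in \<open>auto simp: stage_upper_def\<close>)
  then show "set (Gamma_r n k) \<subseteq> stage_roots n" using rev_Gamma_r[OF assms] by (metis set_rev)
qed

lemma conj_part_le: "conj_part n \<mu> j \<le> n"
proof -
  have "card {i \<in> {1..n}. j \<le> \<mu> i} \<le> card {1..n}" by (rule card_mono) auto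
  then show ?thesis by (simp add: conj_part_def)
qed

lemma Gamma_subset: "set (Gamma n \<mu>) \<subseteq> stage_roots n"
proof -
  have "set (concat (map (\<lambda>i. Gamma_r n (conj_part n \<mu> i) @ Gamma_l n (conj_part n \<mu> i)) js))
      \<subseteq> stage_roots n" for js
    by (induction js) (simp_all add: Gamma_blocks_subset[OF conj_part_le])
  then show ?thesis by (simp only: Gamma_def Gamma_above_def)
qed

lemma Fbar_iff:
  assumes w: "w \<in> signed_perms n" and J: "J \<subseteq> {..<length (Gamma n \<mu>)}"
  shows "(w, J) \<in> Fbar n \<mu> \<longleftrightarrow> fold_upto n \<mu> w J (length (Gamma n \<mu>)) = id \<and>
    (\<forall>r\<in>J. qedge n (fold_upto n \<mu> w J (Suc r)) (Gamma n \<mu> ! r))"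
proof -
  let ?G = "Gamma n \<mu>" and ?g = "fold_upto n \<mu> w J"
  let ?m = "length ?G"
  have gl: "?g p = fold_list n w ?G J p" for p by (simp add: fold_upto_def fold_list_def)
  have gS: "?g p \<in> signed_perms n" if "p \<le> ?m" for p
    unfolding gl by (rule fold_list_signed[OF w Gamma_subset that])
  have finJ: "finite J" using J finite_subset by blast
  \<comment> \<open>The defect of a folding: the drop in length minus 1 for a positive one, and
    \<open>2 * rho_pairing - 1\<close> minus the rise in length for a negative one.\<close>
  define c :: "nat \<Rightarrow> int" where "c r = int (len n (?g r)) - int (len n (?g (Suc r))) - 1 +
    (if r \<in> neg_foldings n \<mu> w J then 2 * int (rho_pairing n (?G ! r)) else 0)" for r
  have c: "0 \<le> c r \<and> (c r = 0 \<longleftrightarrow> qedge n (?g (Suc r)) (?G ! r))" if r: "r \<in> J" for r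
  proof -
    have rm: "r < ?m" using J r by auto
    then have \<beta>: "?G ! r \<in> stage_roots n" using Gamma_subset nth_mem by blast
    let ?s = "reflection n (?G ! r)"
    have g1: "?g (Suc r) = ?g r \<circ> ?s" unfolding gl using fold_list_Suc[OF rm] r by simp
    have gs: "?g r \<in> signed_perms n" "?g (Suc r) \<in> signed_perms n" using gS rm by auto
    have g2: "?g (Suc r) \<circ> ?s = ?g r" unfolding g1 by (rule stage_roots_step(2)[OF \<beta> gs(1)])
    have neg: "r \<in> neg_foldings n \<mu> w J \<longleftrightarrow> len n (?g r) < len n (?g (Suc r))"
      unfolding neg_foldings_def using r bruhat_less_reflection[OF \<beta> gs(1)] g1 by simp
    have st: "len n (?g (Suc r)) \<noteq> len n (?g r)"
      "len n (?g (Suc r)) + 1 \<le> len n (?g r) + 2 * rho_pairing n (?G ! r)"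
      using stage_roots_step(3,4)[OF \<beta> gs(1)] g1 by auto
    have ht: "1 \<le> rho_pairing n (?G ! r)" using rho_pairing_pos stage_root_pos \<beta> by blast
    show ?thesis unfolding c_def qedge_def g2 neg using st ht by (cases "len n (?g r) < len n (?g (Suc r))") auto
  qed
  have tele: "(\<Sum>r\<in>J. int (len n (?g r)) - int (len n (?g (Suc r)))) = int (len n w) - int (len n (?g ?m))"
  proof -
    \<comment> \<open>Positions outside \<open>J\<close> do not change the permutation, so the sum
      extends to all positions and telescopes.\<close>
    have "(\<Sum>r\<in>J. int (len n (?g r)) - int (len n (?g (Suc r)))) =
        (\<Sum>r<?m. int (len n (?g r)) - int (len n (?g (Suc r))))"
      by (rule sum.mono_neutral_left) (use J in \<open>auto simp: gl fold_list_Suc\<close>)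
    also have "\<dots> = int (len n (?g 0)) - int (len n (?g ?m))"
      by (rule sum_lessThan_telescope')
    finally show ?thesis by (simp add: gl fold_list_0)
  qed
  have negsum: "(\<Sum>r\<in>J. if r \<in> neg_foldings n \<mu> w J then 2 * int (rho_pairing n (?G ! r)) else 0) =
      2 * (\<Sum>r\<in>neg_foldings n \<mu> w J. int (rho_pairing n (?G ! r)))"
    unfolding sum_distrib_left
    by (rule sum.mono_neutral_cong_right) (use finJ in \<open>auto simp: neg_foldings_def\<close>)
  have "(\<Sum>r\<in>J. c r) = int (len n w) - int (len n (?g ?m)) - int (card J) +
      2 * (\<Sum>r\<in>neg_foldings n \<mu> w J. int (rho_pairing n (?G ! r)))"
    unfolding c_def sum.distrib negsum sum_subtractf[of _ "\<lambda>_. 1"] tele by simp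
  then have tot: "real (len n w) + real (len n (?g ?m)) - real (card J) +
      2 * (\<Sum>r\<in>neg_foldings n \<mu> w J. real (rho_pairing n (?G ! r))) =
      of_int (2 * int (len n (?g ?m)) + (\<Sum>r\<in>J. c r))"
    by simp
  have "(w, J) \<in> Fbar n \<mu> \<longleftrightarrow> real (len n w) + real (len n (?g ?m)) - real (card J) +
      2 * (\<Sum>r\<in>neg_foldings n \<mu> w J. real (rho_pairing n (?G ! r))) = 0"
    using w J by (auto simp: Fbar_def end_perm_def field_simps)
  also have "\<dots> \<longleftrightarrow> 2 * int (len n (?g ?m)) + (\<Sum>r\<in>J. c r) = 0"
    unfolding tot of_int_eq_0_iff ..
  also have "\<dots> \<longleftrightarrow> len n (?g ?m) = 0 \<and> (\<Sum>r\<in>J. c r) = 0"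
  proof -
    have "0 \<le> (\<Sum>r\<in>J. c r)" using c by (intro sum_nonneg) auto
    then show ?thesis by linarith
  qed
  also have "\<dots> \<longleftrightarrow> ?g ?m = id \<and> (\<forall>r\<in>J. c r = 0)"
    using len_zero_id[OF gS[OF order.refl]] len_id sum_nonneg_eq_0_iff[OF finJ, of c] c by auto
  also have "\<dots> \<longleftrightarrow> ?g ?m = id \<and> (\<forall>r\<in>J. qedge n (?g (Suc r)) (?G ! r))"
    using c by auto
  finally show ?thesis .
qed

lemma upt_split: "i \<le> j \<Longrightarrow> [0..<j] = [0..<i] @ [i..<j]"
  using upt_add_eq_append[of 0 i "j - i"] by simp

lemma qwalk_appendI:
  "qwalk n v as bs u \<Longrightarrow> qwalk n u cs ds v' \<Longrightarrow> qwalk n v (as @ cs) (bs @ ds) v'"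
  using qwalk_append by blast

lemma sort_initial_word:
  assumes v: "v \<in> signed_perms n" and xs: "distinct xs" "sorted xs"
  shows "sort (initial_word v k) = xs \<longleftrightarrow> v ` {1..k} = set xs"
proof -
  have s: "set (initial_word v k) = v ` {1..k}"
    by (auto simp: initial_word_def)
  have d: "distinct (initial_word v k)"
    using inj_on_signed[OF v] by (simp add: initial_word_def distinct_map)
  show ?thesis
  proof
    assume "sort (initial_word v k) = xs"
    then show "v ` {1..k} = set xs" using s by auto
  next
    assume "v ` {1..k} = set xs"
    then show "sort (initial_word v k) = xs"
      using sorted_distinct_set_unique[of "sort (initial_word v k)" xs] s d xs by simp
  qed
qed

lemma sort_initial_word_eq:
  assumes "v \<in> signed_perms n" "u \<in> signed_perms n" "sort (initial_word v k) = sort (initial_word u k)"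
  shows "v ` {1..k} = u ` {1..k}"
proof -
  have "set (initial_word w k) = w ` {1..k}" for w by (auto simp: initial_word_def)
  then show ?thesis using arg_cong[OF assms(3), of set] by simp
qed

lemma sorted_columns: "sorted (r_col n D)" "sorted (l_col n D)"
  by (simp_all add: r_col_def l_col_def)

text \<open>The walk passes the left block before the right one, so the intermediate
  \<open>u\<close> yields \<open>l_col\<close> and the end \<open>v'\<close> yields
  \<open>r_col\<close>.\<close>

lemma block_sound:
  assumes k: "k \<le> n" and v: "v \<in> signed_perms n"
    and w: "qwalk n v (rev (Gamma_l n k)) b1 u" "qwalk n u (rev (Gamma_r n k)) b2 v'"
  shows "u \<in> signed_perms n" "v' \<in> signed_perms n"
    "\<exists>D. KN_column n D \<and> length D = k \<and> sort (initial_word v' k) = r_col n D \<and>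
      sort (initial_word u k) = l_col n D"
proof -
  show u: "u \<in> signed_perms n" by (rule Gamma_l_walk(1)[OF k v w(1)])
  show v': "v' \<in> signed_perms n" using Gamma_r_walk(1)[OF k u w(2)] by blast
  have "sign_dom n (u ` {1..k}) (v' ` {1..k})" using Gamma_r_walk(1)[OF k u w(2)] by blast
  then obtain D where D: "KN_column n D" "length D = card (u ` {1..k})"
    "set (l_col n D) = u ` {1..k}" "set (r_col n D) = v' ` {1..k}"
    using KN_column_exists[OF transversal_image[OF u k] transversal_image[OF v' k]] by blast
  obtain ts where ts: "is_column n D" "is_splitting n D ts" using D(1) by (auto simp: KN_column_def)
  note kn = KN_split_columns(3,4)[OF ts]
  show "\<exists>D. KN_column n D \<and> length D = k \<and> sort (initial_word v' k) = r_col n D \<and>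
      sort (initial_word u k) = l_col n D"
    using D card_signed_image[OF u] sort_initial_word[OF u kn(1) sorted_columns(2)]
      sort_initial_word[OF v' kn(2) sorted_columns(1)] by auto
qed

lemma block_complete:
  assumes v: "v \<in> signed_perms n" and D: "KN_column n D" "length D = k" and k: "k \<le> n"
  shows "\<exists>b1 u b2 v'. qwalk n v (rev (Gamma_l n k)) b1 u \<and> qwalk n u (rev (Gamma_r n k)) b2 v' \<and>
    v' \<in> signed_perms n \<and> sort (initial_word v' k) = r_col n D \<and> sort (initial_word u k) = l_col n D"
proof -
  obtain ts where ts: "is_column n D" "is_splitting n D ts" using D(1) by (auto simp: KN_column_def)
  note kn = KN_split_columns(3-6)[OF ts] and dom = KN_columns_dominated[OF ts]
  have "card (set (l_col n D)) = k" using kn(1,3) D(2) distinct_card by metis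
  then obtain b1 u where u: "qwalk n v (rev (Gamma_l n k)) b1 u" "u ` {1..k} = set (l_col n D)"
    using Gamma_l_walk(2)[OF k v dom(1)] by blast
  have uS: "u \<in> signed_perms n" by (rule Gamma_l_walk(1)[OF k v u(1)])
  obtain b2 v' where v': "qwalk n u (rev (Gamma_r n k)) b2 v'" "v' ` {1..k} = set (r_col n D)"
    using Gamma_r_walk(2)[OF k uS dom(2)] dom(3) u(2) by auto
  have "v' \<in> signed_perms n" using Gamma_r_walk(1)[OF k uS v'(1)] by blast
  then show ?thesis
    using u v' sort_initial_word[OF uS kn(1) sorted_columns(2)]
      sort_initial_word[of v' n, OF _ kn(2) sorted_columns(1)] by blast
qed

lemma concat_map_pairs_eq:
  assumes "concat (map (\<lambda>j. [f j, g j]) xs) = concat (map (\<lambda>j. [f' j, g' j]) xs)" "j \<in> set xs"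
  shows "f j = f' j \<and> g j = g' j"
  using assms by (induction xs) auto

section \<open>The chain cut into blocks\<close>

context
  fixes n :: nat and \<mu> :: "nat \<Rightarrow> nat"
begin

lemma Gamma_above_Suc:
  assumes "j < \<mu> 1"
  shows "Gamma_above n \<mu> j = Gamma_above n \<mu> (Suc j) @
    Gamma_r n (conj_part n \<mu> (Suc j)) @ Gamma_l n (conj_part n \<mu> (Suc j))"
proof -
  have "[j + 1..<\<mu> 1 + 1] = Suc j # [Suc j + 1..<\<mu> 1 + 1]" using assms by (simp add: upt_conv_Cons)
  then show ?thesis by (simp add: Gamma_above_def)
qed

lemma Gamma_above_top: "Gamma_above n \<mu> (\<mu> 1) = []"
  by (simp add: Gamma_above_def)

lemma Gamma_above_prefix: "j \<le> \<mu> 1 \<Longrightarrow> \<exists>ys. Gamma n \<mu> = Gamma_above n \<mu> j @ ys"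
proof (induction j)
  case (Suc j)
  then obtain ys where "Gamma n \<mu> = Gamma_above n \<mu> j @ ys" by auto
  then show ?case using Gamma_above_Suc[of j] Suc.prems by auto
qed (simp add: Gamma_def)

abbreviation (input) blk_cut where "blk_cut j \<equiv> length (Gamma_above n \<mu> j)"
abbreviation (input) blk_mid where "blk_mid j \<equiv> blk_cut j + length (Gamma_r n (conj_part n \<mu> j))"

lemma Gamma_segments:
  assumes j: "j < \<mu> 1"
  shows "blk_cut (Suc j) \<le> blk_mid (Suc j)" "blk_mid (Suc j) \<le> blk_cut j" "blk_cut j \<le> length (Gamma n \<mu>)"
    "drop (blk_mid (Suc j)) (take (blk_cut j) (Gamma n \<mu>)) = Gamma_l n (conj_part n \<mu> (Suc j))"
    "drop (blk_cut (Suc j)) (take (blk_mid (Suc j)) (Gamma n \<mu>)) = Gamma_r n (conj_part n \<mu> (Suc j))"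
proof -
  obtain ys where ys: "Gamma n \<mu> = Gamma_above n \<mu> j @ ys" using Gamma_above_prefix[of j] j by auto
  note S = Gamma_above_Suc[OF j]
  show "blk_cut (Suc j) \<le> blk_mid (Suc j)" "blk_mid (Suc j) \<le> blk_cut j" "blk_cut j \<le> length (Gamma n \<mu>)"
    "drop (blk_mid (Suc j)) (take (blk_cut j) (Gamma n \<mu>)) = Gamma_l n (conj_part n \<mu> (Suc j))"
    "drop (blk_cut (Suc j)) (take (blk_mid (Suc j)) (Gamma n \<mu>)) = Gamma_r n (conj_part n \<mu> (Suc j))"
    unfolding ys S by simp_all
qed

lemma cut_0: "blk_cut 0 = length (Gamma n \<mu>)"
  by (simp add: Gamma_def)

lemma ord_filling_map:
  "(ord_filling \<circ> filling_map n \<mu>) (w, J) = concat (map (\<lambda>j.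
     [sort (initial_word (pi_r n \<mu> w J j) (conj_part n \<mu> j)),
      sort (initial_word (pi_l n \<mu> w J j) (conj_part n \<mu> j))]) (rev [1..<\<mu> 1 + 1]))"
  by (simp add: ord_filling_def map_concat comp_def)

abbreviation (input) blk_bits where "blk_bits J p q \<equiv> rev (map (\<lambda>r. r \<in> J) [p..<q])"

text \<open>Block indices decrease along the chain and hence increase along the walk:
  \<open>pi_r\<close> at 0 is the end of the folding path, at \<open>\<mu> 1\<close> its
  start.\<close>

lemma Fbar_walks:
  assumes F: "(w, J) \<in> Fbar n \<mu>"
  shows "pi_r n \<mu> w J 0 = id" "pi_r n \<mu> w J (\<mu> 1) = w"
    "j \<le> \<mu> 1 \<Longrightarrow> pi_r n \<mu> w J j \<in> signed_perms n"
    "j < \<mu> 1 \<Longrightarrow> qwalk n (pi_r n \<mu> w J j) (rev (Gamma_l n (conj_part n \<mu> (Suc j))))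
      (blk_bits J (blk_mid (Suc j)) (blk_cut j)) (pi_l n \<mu> w J (Suc j))"
    "j < \<mu> 1 \<Longrightarrow> qwalk n (pi_l n \<mu> w J (Suc j)) (rev (Gamma_r n (conj_part n \<mu> (Suc j))))
      (blk_bits J (blk_cut (Suc j)) (blk_mid (Suc j))) (pi_r n \<mu> w J (Suc j))"
proof -
  have w: "w \<in> signed_perms n" and J: "J \<subseteq> {..<length (Gamma n \<mu>)}" using F by (auto simp: Fbar_def)
  let ?g = "fold_list n w (Gamma n \<mu>) J"
  have gl: "fold_upto n \<mu> w J = ?g" by (rule ext) (simp add: fold_upto_def fold_list_def)
  have E: "?g (length (Gamma n \<mu>)) = id" "\<forall>r\<in>J. qedge n (?g (Suc r)) (Gamma n \<mu> ! r)"
    using F unfolding Fbar_iff[OF w J] gl by auto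
  show "pi_r n \<mu> w J 0 = id" using E(1) by (simp add: pi_r_def gl cut_0)
  show "pi_r n \<mu> w J (\<mu> 1) = w" unfolding pi_r_def gl Gamma_above_top list.size by (rule fold_list_0)
  show "pi_r n \<mu> w J j \<in> signed_perms n" if j: "j \<le> \<mu> 1"
  proof -
    obtain ys where "Gamma n \<mu> = Gamma_above n \<mu> j @ ys" using Gamma_above_prefix[OF j] by blast
    then have "blk_cut j \<le> length (Gamma n \<mu>)" by simp
    then show ?thesis unfolding pi_r_def gl by (rule fold_list_signed[OF w Gamma_subset])
  qed
  show "qwalk n (pi_r n \<mu> w J j) (rev (Gamma_l n (conj_part n \<mu> (Suc j))))
      (blk_bits J (blk_mid (Suc j)) (blk_cut j)) (pi_l n \<mu> w J (Suc j))" if j: "j < \<mu> 1"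
    using fold_list_walk[OF w Gamma_subset Gamma_segments(2,3)[OF j], where J = J] E(2)
    unfolding Gamma_segments(4)[OF j] pi_r_def pi_l_def gl by blast
  show "qwalk n (pi_l n \<mu> w J (Suc j)) (rev (Gamma_r n (conj_part n \<mu> (Suc j))))
      (blk_bits J (blk_cut (Suc j)) (blk_mid (Suc j))) (pi_r n \<mu> w J (Suc j))" if j: "j < \<mu> 1"
    using fold_list_walk[OF w Gamma_subset Gamma_segments(1)[OF j]
        order.trans[OF Gamma_segments(2,3)[OF j]], where J = J] E(2)
    unfolding Gamma_segments(5)[OF j] pi_r_def pi_l_def gl by blast
qed

lemma filling_in_B:
  assumes F: "(w, J) \<in> Fbar n \<mu>"
  shows "(ord_filling \<circ> filling_map n \<mu>) (w, J) \<in> B_set n \<mu>"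
proof -
  have "\<exists>D. KN_column n D \<and> length D = conj_part n \<mu> j \<and>
      sort (initial_word (pi_r n \<mu> w J j) (conj_part n \<mu> j)) = r_col n D \<and>
      sort (initial_word (pi_l n \<mu> w J j) (conj_part n \<mu> j)) = l_col n D" if jr: "j \<in> {1..\<mu> 1}" for j
  proof -
    obtain i where i: "j = Suc i" "i < \<mu> 1" using jr by (cases j) auto
    show ?thesis unfolding i(1)
      using block_sound(3)[OF conj_part_le Fbar_walks(3)[OF F] Fbar_walks(4,5)[OF F i(2)]] i(2) by simp
  qed
  then obtain D where D: "\<forall>j\<in>{1..\<mu> 1}. KN_column n (D j) \<and> length (D j) = conj_part n \<mu> j \<and>
      sort (initial_word (pi_r n \<mu> w J j) (conj_part n \<mu> j)) = r_col n (D j) \<and>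
      sort (initial_word (pi_l n \<mu> w J j) (conj_part n \<mu> j)) = l_col n (D j)"
    by metis
  have "(ord_filling \<circ> filling_map n \<mu>) (w, J) =
      concat (map (\<lambda>j. [r_col n (D j), l_col n (D j)]) (rev [1..<\<mu> 1 + 1]))"
    unfolding ord_filling_map by (rule arg_cong[where f = concat], rule map_cong) (use D in auto)
  then show ?thesis using D unfolding B_set_def by blast
qed

lemma bits_eqD:
  assumes "blk_bits J p q = blk_bits J' p q" "p \<le> r" "r < q"
  shows "r \<in> J \<longleftrightarrow> r \<in> J'"
  using assms by simp

text \<open>From the common start \<open>id\<close>, equal columns force equal bits in one block
  after another, because both walks have reached the same permutation before each block; after the
  last block this permutation is \<open>w\<close>.\<close>

lemma filling_inj:
  assumes F: "(w, J) \<in> Fbar n \<mu>" "(w', J') \<in> Fbar n \<mu>"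
    and eq: "(ord_filling \<circ> filling_map n \<mu>) (w, J) = (ord_filling \<circ> filling_map n \<mu>) (w', J')"
  shows "w = w' \<and> J = J'"
proof -
  note W = Fbar_walks[OF F(1)] and W' = Fbar_walks[OF F(2)]
  have col: "sort (initial_word (pi_r n \<mu> w J j) (conj_part n \<mu> j)) =
      sort (initial_word (pi_r n \<mu> w' J' j) (conj_part n \<mu> j)) \<and>
    sort (initial_word (pi_l n \<mu> w J j) (conj_part n \<mu> j)) =
      sort (initial_word (pi_l n \<mu> w' J' j) (conj_part n \<mu> j))" if "j \<in> {1..\<mu> 1}" for j
    using eq unfolding ord_filling_map by (rule concat_map_pairs_eq) (use that in auto)
  have main: "pi_r n \<mu> w J j = pi_r n \<mu> w' J' j \<and>
      (\<forall>r. blk_cut j \<le> r \<and> r < length (Gamma n \<mu>) \<longrightarrow> (r \<in> J \<longleftrightarrow> r \<in> J'))" if "j \<le> \<mu> 1" for j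
    using that
  proof (induction j)
    case 0
    then show ?case using W(1) W'(1) cut_0 by auto
  next
    case (Suc j)
    have j: "j < \<mu> 1" using Suc.prems by simp
    let ?k = "conj_part n \<mu> (Suc j)"
    have k: "?k \<le> n" by (rule conj_part_le)
    have IH: "pi_r n \<mu> w J j = pi_r n \<mu> w' J' j"
      "\<And>r. blk_cut j \<le> r \<Longrightarrow> r < length (Gamma n \<mu>) \<Longrightarrow> r \<in> J \<longleftrightarrow> r \<in> J'"
      using Suc j by auto
    have v: "pi_r n \<mu> w J j \<in> signed_perms n" using W(3) j by simp
    note w1 = W(4)[OF j] and w1' = W'(4)[OF j, folded IH(1)]
    note w2 = W(5)[OF j] and w2' = W'(5)[OF j]
    have u: "pi_l n \<mu> w J (Suc j) \<in> signed_perms n" "pi_r n \<mu> w J (Suc j) \<in> signed_perms n"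
      by (rule block_sound(1,2)[OF k v w1 w2])+
    have u': "pi_l n \<mu> w' J' (Suc j) \<in> signed_perms n" "pi_r n \<mu> w' J' (Suc j) \<in> signed_perms n"
      by (rule block_sound(1,2)[OF k v w1' w2'])+
    have c: "Suc j \<in> {1..\<mu> 1}" using Suc.prems by simp
    have b1: "blk_bits J (blk_mid (Suc j)) (blk_cut j) = blk_bits J' (blk_mid (Suc j)) (blk_cut j)"
      by (rule Gamma_l_walk(3)[OF k v w1 w1'])
        (rule sort_initial_word_eq[OF u(1) u'(1)], use col[OF c] in blast)
    then have pl: "pi_l n \<mu> w J (Suc j) = pi_l n \<mu> w' J' (Suc j)" using qwalk_determ w1 w1' by metis
    have b2: "blk_bits J (blk_cut (Suc j)) (blk_mid (Suc j)) = blk_bits J' (blk_cut (Suc j)) (blk_mid (Suc j))"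
      by (rule Gamma_r_walk(3)[OF k u(1) w2 w2'[folded pl]])
        (rule sort_initial_word_eq[OF u(2) u'(2)], use col[OF c] in blast)
    then have "pi_r n \<mu> w J (Suc j) = pi_r n \<mu> w' J' (Suc j)" using qwalk_determ w2 w2' pl by metis
    moreover have "r \<in> J \<longleftrightarrow> r \<in> J'" if r: "blk_cut (Suc j) \<le> r" "r < length (Gamma n \<mu>)" for r
    proof -
      consider "blk_cut (Suc j) \<le> r" "r < blk_mid (Suc j)" | "blk_mid (Suc j) \<le> r" "r < blk_cut j" | "blk_cut j \<le> r"
        using r by linarith
      then show ?thesis using bits_eqD[OF b1] bits_eqD[OF b2] IH(2) r by cases auto
    qed
    ultimately show ?case by blast
  qed
  have J: "J \<subseteq> {..<length (Gamma n \<mu>)}" "J' \<subseteq> {..<length (Gamma n \<mu>)}" using F by (auto simp: Fbar_def)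
  have "w = w'" using main[OF order.refl] W(2) W'(2) by simp
  moreover have "r \<in> J \<longleftrightarrow> r \<in> J'" if "r < length (Gamma n \<mu>)" for r
    using main[OF order.refl] Gamma_above_top that by simp
  then have "J = J'" using J by blast
  ultimately show ?thesis ..
qed

text \<open>Walks for the blocks are chosen one after another from \<open>id\<close>, and their
  concatenated bits, reversed, give \<open>J\<close>. That the folding path of \<open>(w, J)\<close>
  runs through the chosen permutations follows since bits determine a walk.\<close>

lemma filling_surj:
  assumes b: "b \<in> B_set n \<mu>"
  shows "\<exists>w J. (w, J) \<in> Fbar n \<mu> \<and> (ord_filling \<circ> filling_map n \<mu>) (w, J) = b"
proof -
  obtain D where D: "\<forall>j\<in>{1..\<mu> 1}. KN_column n (D j) \<and> length (D j) = conj_part n \<mu> j"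
    and bD: "b = concat (map (\<lambda>j. [r_col n (D j), l_col n (D j)]) (rev [1..<\<mu> 1 + 1]))"
    using b unfolding B_set_def by blast
  let ?k = "conj_part n \<mu>" and ?G = "Gamma n \<mu>"
  let ?m = "length ?G"
  let ?blk = "\<lambda>j v b1 u b2 v'. qwalk n v (rev (Gamma_l n (?k (Suc j)))) b1 u \<and>
    qwalk n u (rev (Gamma_r n (?k (Suc j)))) b2 v' \<and>
    sort (initial_word v' (?k (Suc j))) = r_col n (D (Suc j)) \<and>
    sort (initial_word u (?k (Suc j))) = l_col n (D (Suc j))"
  have "\<exists>V. V 0 = id \<and> (\<forall>j. V j \<in> signed_perms n \<and> (j < \<mu> 1 \<longrightarrow>
      (\<exists>b1 u b2. ?blk j (V j) b1 u b2 (V (Suc j)))))"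
  proof -
    have "\<exists>V. \<forall>j. (V j \<in> signed_perms n \<and> (j = 0 \<longrightarrow> V j = id)) \<and> (j < \<mu> 1 \<longrightarrow>
      (\<exists>b1 u b2. ?blk j (V j) b1 u b2 (V (Suc j))))"
    \<comment> \<open>The choice runs over all natural numbers; from \<open>\<mu> 1\<close> on, the
      next element is only required to be a signed permutation.\<close>
    proof (rule dependent_nat_choice)
      show "\<exists>v. v \<in> signed_perms n \<and> (0 = (0::nat) \<longrightarrow> v = id)" using id_signed_perm by blast
      show "\<exists>v'. (v' \<in> signed_perms n \<and> (Suc j = 0 \<longrightarrow> v' = id)) \<and>
          (j < \<mu> 1 \<longrightarrow> (\<exists>b1 u b2. ?blk j v b1 u b2 v'))"
        if "v \<in> signed_perms n \<and> (j = 0 \<longrightarrow> v = id)" for v j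
      proof (cases "j < \<mu> 1")
        case True
        then have "KN_column n (D (Suc j))" "length (D (Suc j)) = ?k (Suc j)" using D by auto
        then show ?thesis using block_complete[of v n "D (Suc j)", OF _ _ _ conj_part_le] that by blast
      next
        case False
        then show ?thesis using that by blast
      qed
    qed
    then show ?thesis by blast
  qed
  then obtain V where V0: "V 0 = id"
    and V: "\<And>j. j < \<mu> 1 \<Longrightarrow> \<exists>b1 u b2. ?blk j (V j) b1 u b2 (V (Suc j))" by blast
  then obtain b1 U b2 where W: "\<And>j. j < \<mu> 1 \<Longrightarrow> ?blk j (V j) (b1 j) (U j) (b2 j) (V (Suc j))"
    by metis
  define B where "B j = concat (map (\<lambda>i. b1 i @ b2 i) [0..<j])" for j
  have BS: "B (Suc j) = B j @ b1 j @ b2 j" for j by (simp add: B_def)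
  have walk: "qwalk n id (rev (drop (blk_cut j) ?G)) (B j) (V j)" if "j \<le> \<mu> 1" for j
    using that
  proof (induction j)
    case 0
    then show ?case by (simp add: B_def V0 cut_0)
  next
    case (Suc j)
    have j: "j < \<mu> 1" using Suc.prems by simp
    obtain ys where ys: "?G = Gamma_above n \<mu> j @ ys" using Gamma_above_prefix[of j] j by auto
    have "drop (blk_cut (Suc j)) ?G = Gamma_r n (?k (Suc j)) @ Gamma_l n (?k (Suc j)) @ drop (blk_cut j) ?G"
      unfolding ys Gamma_above_Suc[OF j] by simp
    then have "rev (drop (blk_cut (Suc j)) ?G) =
        rev (drop (blk_cut j) ?G) @ rev (Gamma_l n (?k (Suc j))) @ rev (Gamma_r n (?k (Suc j)))"
      by simp
    moreover have "qwalk n (V j) (rev (Gamma_l n (?k (Suc j))) @ rev (Gamma_r n (?k (Suc j))))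
        (b1 j @ b2 j) (V (Suc j))"
      using W[OF j] qwalk_appendI by blast
    ultimately show ?case using Suc.IH j qwalk_appendI unfolding BS by simp
  qed
  define w where "w = V (\<mu> 1)"
  define J where "J = {p. p < length (B (\<mu> 1)) \<and> rev (B (\<mu> 1)) ! p}"
  have wk: "qwalk n id (rev ?G) (B (\<mu> 1)) w"
    using walk[OF order.refl] Gamma_above_top by (simp add: w_def)
  have fl: "fold_list n w ?G J ?m = id" "w \<in> signed_perms n"
    using walk_fold_list[OF id_signed_perm Gamma_subset wk] by (auto simp: J_def)
  have lB: "length (B (\<mu> 1)) = ?m" using qwalk_length[OF wk] by simp
  have J: "J \<subseteq> {..<?m}" using lB by (auto simp: J_def)
  have bitsJ: "blk_bits J 0 ?m = B (\<mu> 1)"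
  proof -
    have "map (\<lambda>r. r \<in> J) [0..<?m] = rev (B (\<mu> 1))"
      by (rule nth_equalityI) (use lB in \<open>auto simp: J_def\<close>)
    then show ?thesis by simp
  qed
  have "qwalk n (fold_list n w ?G J ?m) (rev (drop 0 (take ?m ?G))) (blk_bits J 0 ?m) (fold_list n w ?G J 0)"
    unfolding bitsJ fl(1) fold_list_0 using wk by simp
  then have "\<forall>r\<in>J. 0 \<le> r \<and> r < ?m \<longrightarrow> qedge n (fold_list n w ?G J (Suc r)) (?G ! r)"
    unfolding fold_list_walk[OF fl(2) Gamma_subset le0 order.refl] .
  then have "\<forall>r\<in>J. qedge n (fold_list n w ?G J (Suc r)) (?G ! r)" using J by auto
  moreover have gl: "fold_upto n \<mu> w J = fold_list n w ?G J"
    by (rule ext) (simp add: fold_upto_def fold_list_def)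
  ultimately have F: "(w, J) \<in> Fbar n \<mu>"
    unfolding Fbar_iff[OF fl(2) J] using fl(1) by simp
  note FW = Fbar_walks[OF F]
  have pre: "\<exists>cs. B (\<mu> 1) = B j @ cs" if "j \<le> \<mu> 1" for j
  proof -
    have "[0..<\<mu> 1] = [0..<j] @ [j..<\<mu> 1]" using upt_split[OF that] by simp
    then show ?thesis by (auto simp: B_def)
  qed
  \<comment> \<open>Bits are listed from the end of the chain, so the positions \<open>p..<q\<close>
    occupy the slice that starts at \<open>?m - q\<close>.\<close>
  have blk_bits: "blk_bits J p q = take (q - p) (drop (?m - q) (B (\<mu> 1)))" if "p \<le> q" "q \<le> ?m" for p q
  proof -
    have "[0..<?m] = [0..<p] @ [p..<q] @ [q..<?m]"
      using upt_split[OF that(1)] upt_split[OF that(2)] by simp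
    then show ?thesis unfolding bitsJ[symmetric] using that by simp
  qed
  have key: "\<forall>j\<le>\<mu> 1. pi_r n \<mu> w J j = V j" "\<forall>j<\<mu> 1. pi_l n \<mu> w J (Suc j) = U j"
  proof -
    have step: "pi_l n \<mu> w J (Suc j) = U j \<and> pi_r n \<mu> w J (Suc j) = V (Suc j)"
      if j: "j < \<mu> 1" and eq: "pi_r n \<mu> w J j = V j" for j
    proof -
      note g = Gamma_segments[OF j]
      have lj: "length (B j) = ?m - blk_cut j" using qwalk_length[OF walk[of j]] j by simp
      have l1: "length (b1 j) = blk_cut j - blk_mid (Suc j)"
        using qwalk_length[of n "V j" _ "b1 j"] W[OF j] arg_cong[OF g(4), of length] g(2,3) by auto
      have l2: "length (b2 j) = blk_mid (Suc j) - blk_cut (Suc j)"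
        using qwalk_length[of n "U j" _ "b2 j"] W[OF j] by auto
      obtain cs where cs: "B (\<mu> 1) = B j @ b1 j @ b2 j @ cs" using pre[of "Suc j"] j BS by auto
      have "blk_bits J (blk_mid (Suc j)) (blk_cut j) = b1 j"
        using blk_bits[OF g(2,3)] lj l1 unfolding cs by simp
      then have p1: "pi_l n \<mu> w J (Suc j) = U j"
        using FW(4)[OF j] W[OF j] eq qwalk_determ by metis
      have "?m - blk_mid (Suc j) = length (B j) + length (b1 j)" using lj l1 g(2,3) by linarith
      then have "blk_bits J (blk_cut (Suc j)) (blk_mid (Suc j)) = b2 j"
        using blk_bits[OF g(1)] g(2,3) l2 unfolding cs by simp
      then show ?thesis
        using FW(5)[OF j] W[OF j] p1 qwalk_determ by metis
    qed
    have r: "pi_r n \<mu> w J j = V j" if "j \<le> \<mu> 1" for j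
      using that by (induction j) (use FW(1) V0 step in auto)
    then show "\<forall>j\<le>\<mu> 1. pi_r n \<mu> w J j = V j" by blast
    show "\<forall>j<\<mu> 1. pi_l n \<mu> w J (Suc j) = U j" using step r by simp
  qed
  have "(ord_filling \<circ> filling_map n \<mu>) (w, J) = b"
    unfolding ord_filling_map bD
  proof (rule arg_cong[where f = concat], rule map_cong[OF refl])
    fix j assume "j \<in> set (rev [1..<\<mu> 1 + 1])"
    then have "1 \<le> j" "j \<le> \<mu> 1" by auto
    then obtain i where i: "j = Suc i" "i < \<mu> 1" by (cases j) auto
    show "[sort (initial_word (pi_r n \<mu> w J j) (?k j)), sort (initial_word (pi_l n \<mu> w J j) (?k j))] =
        [r_col n (D j), l_col n (D j)]"
      using key W[OF i(2)] i by simp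
  qed
  then show ?thesis using F by blast
qed

end

theorem theorem6p1:
  fixes n :: nat and \<mu> :: "nat \<Rightarrow> nat"
  assumes "1 \<le> n"
    and "dominant n \<mu>"
  shows "bij_betw (ord_filling \<circ> filling_map n \<mu>) (Fbar n \<mu>) (B_set n \<mu>)"
proof (rule bij_betw_imageI)
  show "inj_on (ord_filling \<circ> filling_map n \<mu>) (Fbar n \<mu>)"
    by (rule inj_onI) (metis filling_inj surj_pair)
  show "(ord_filling \<circ> filling_map n \<mu>) ` Fbar n \<mu> = B_set n \<mu>"
  proof (intro set_eqI iffI)
    fix b assume "b \<in> (ord_filling \<circ> filling_map n \<mu>) ` Fbar n \<mu>"
    then show "b \<in> B_set n \<mu>" using filling_in_B by (metis imageE surj_pair)
  next
    fix b assume "b \<in> B_set n \<mu>"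
    then show "b \<in> (ord_filling \<circ> filling_map n \<mu>) ` Fbar n \<mu>"
      using filling_surj by (metis imageI)
  qed
qed

end
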